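(* The geometric theory $\mathbb{L}oc$ of local MV-algebras is not of presheaf type, i.e. its classifying topos is not equivalent to any topos of presheaves $[\mathcal{C}^{\mathrm{op}},\mathbf{Set}]$ with $\mathcal{C}$ a small category.
   Context: An MV-algebra is a structure $(A,\oplus,\neg,0)$ such that $(A,\oplus,0)$ is a commutative monoid, $\neg\neg x=x$, $x\oplus\neg 0=\neg 0$ and $\neg(\neg x\oplus y)\oplus y=\neg(\neg y\oplus x)\oplus x$. Write $1=\neg 0$ and $kx=x\oplus\cdots\oplus x$ ($k$ times). $\mathbb{MV}$ denotes the algebraic theory of MV-algebras. A geometric formula is a first-order formula built from atomic formulae using finitary conjunctions, existential quantifications and arbitrary disjunctions; a geometric theory is a set of sequents $(\phi\vdash_{\vec x}\psi)$ with $\phi,\psi$ geometric; provability is in geometric logic. A quotient of a geometric theory is obtained by adding geometric axioms over the same signature. Every geometric theory $\mathbb{T}$ has a classifying topos $\mathbf{Set}[\mathbb{T}]$. $\mathbb{L}oc$ is the quotient of $\mathbb{MV}$ obtained by adding the axioms $(\top\vdash_x\bigvee_{k=1}^{\infty}(kx=1\vee k(\neg x)=1))$ and $(0=1\vdash\bot)$. *)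

theory Defs
  imports "HOL-Library.FuncSet"
begin

section \<open>Categories, functors and sheaves\<close>

record ('o, 'a) cat =
  Obj :: "'o set"
  Arr :: "'a set"
  Dom :: "'a \<Rightarrow> 'o"
  Cod :: "'a \<Rightarrow> 'o"
  Ident :: "'o \<Rightarrow> 'a"
  Comp :: "'a \<Rightarrow> 'a \<Rightarrow> 'a"

text \<open>\<open>Comp C g f\<close> is the composite ``first \<open>f\<close>, then \<open>g\<close>''; it is only meaningful
  when \<open>Cod C f = Dom C g\<close>.\<close>

locale category =
  fixes C :: "('o, 'a) cat"
  assumes Dom_in: "f \<in> Arr C \<Longrightarrow> Dom C f \<in> Obj C"
    and Cod_in: "f \<in> Arr C \<Longrightarrow> Cod C f \<in> Obj C"
    and Ident_in: "a \<in> Obj C \<Longrightarrow> Ident C a \<in> Arr C"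
    and Dom_Ident: "a \<in> Obj C \<Longrightarrow> Dom C (Ident C a) = a"
    and Cod_Ident: "a \<in> Obj C \<Longrightarrow> Cod C (Ident C a) = a"
    and Comp_in: "\<lbrakk>f \<in> Arr C; g \<in> Arr C; Cod C f = Dom C g\<rbrakk> \<Longrightarrow> Comp C g f \<in> Arr C"
    and Dom_Comp: "\<lbrakk>f \<in> Arr C; g \<in> Arr C; Cod C f = Dom C g\<rbrakk> \<Longrightarrow> Dom C (Comp C g f) = Dom C f"
    and Cod_Comp: "\<lbrakk>f \<in> Arr C; g \<in> Arr C; Cod C f = Dom C g\<rbrakk> \<Longrightarrow> Cod C (Comp C g f) = Cod C g"
    and Comp_Ident_right: "f \<in> Arr C \<Longrightarrow> Comp C f (Ident C (Dom C f)) = f"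
    and Comp_Ident_left: "f \<in> Arr C \<Longrightarrow> Comp C (Ident C (Cod C f)) f = f"
    and Comp_assoc: "\<lbrakk>f \<in> Arr C; g \<in> Arr C; h \<in> Arr C; Cod C f = Dom C g; Cod C g = Dom C h\<rbrakk>
        \<Longrightarrow> Comp C h (Comp C g f) = Comp C (Comp C h g) f"

definition op_cat :: "('o, 'a) cat \<Rightarrow> ('o, 'a) cat" where
  "op_cat C = \<lparr>Obj = Obj C, Arr = Arr C, Dom = Cod C, Cod = Dom C,
     Ident = Ident C, Comp = (\<lambda>g f. Comp C f g)\<rparr>"

definition isomorphic :: "('o, 'a) cat \<Rightarrow> 'o \<Rightarrow> 'o \<Rightarrow> bool" where
  "isomorphic C a b \<longleftrightarrow> (\<exists>f \<in> Arr C. \<exists>g \<in> Arr C.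
     Dom C f = a \<and> Cod C f = b \<and> Dom C g = b \<and> Cod C g = a \<and>
     Comp C g f = Ident C a \<and> Comp C f g = Ident C b)"

record ('o, 'a, 'p, 'b) fctr =
  omap :: "'o \<Rightarrow> 'p"
  amap :: "'a \<Rightarrow> 'b"

text \<open>Functors and natural transformations are extensional (\<open>undefined\<close> off the objects and
  arrows of the source), so that HOL equality is equality of functors and of transformations.\<close>

definition functors :: "('o, 'a) cat \<Rightarrow> ('p, 'b) cat \<Rightarrow> ('o, 'a, 'p, 'b) fctr set" where
  "functors C D = {F.
     omap F \<in> Obj C \<rightarrow>\<^sub>E Obj D \<and>
     amap F \<in> Arr C \<rightarrow>\<^sub>E Arr D \<and>
     (\<forall>f \<in> Arr C. Dom D (amap F f) = omap F (Dom C f) \<and> Cod D (amap F f) = omap F (Cod C f)) \<and>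
     (\<forall>a \<in> Obj C. amap F (Ident C a) = Ident D (omap F a)) \<and>
     (\<forall>f \<in> Arr C. \<forall>g \<in> Arr C. Cod C f = Dom C g \<longrightarrow>
        amap F (Comp C g f) = Comp D (amap F g) (amap F f))}"

definition id_functor :: "('o, 'a) cat \<Rightarrow> ('o, 'a, 'o, 'a) fctr" where
  "id_functor C = \<lparr>omap = (\<lambda>a \<in> Obj C. a), amap = (\<lambda>f \<in> Arr C. f)\<rparr>"

definition comp_functor ::
  "('o, 'a) cat \<Rightarrow> ('p, 'b, 'q, 'c) fctr \<Rightarrow> ('o, 'a, 'p, 'b) fctr \<Rightarrow> ('o, 'a, 'q, 'c) fctr" where
  "comp_functor C G F =
     \<lparr>omap = compose (Obj C) (omap G) (omap F), amap = compose (Arr C) (amap G) (amap F)\<rparr>"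

type_synonym ('o, 'a, 'p, 'b) nat_trans =
  "('o, 'a, 'p, 'b) fctr \<times> ('o \<Rightarrow> 'b) \<times> ('o, 'a, 'p, 'b) fctr"

definition nat_transformations ::
  "('o, 'a) cat \<Rightarrow> ('p, 'b) cat \<Rightarrow> ('o, 'a, 'p, 'b) nat_trans set" where
  "nat_transformations C D = {(F, \<eta>, G).
     F \<in> functors C D \<and> G \<in> functors C D \<and> \<eta> \<in> Obj C \<rightarrow>\<^sub>E Arr D \<and>
     (\<forall>a \<in> Obj C. Dom D (\<eta> a) = omap F a \<and> Cod D (\<eta> a) = omap G a) \<and>
     (\<forall>f \<in> Arr C. Comp D (\<eta> (Cod C f)) (amap F f) = Comp D (amap G f) (\<eta> (Dom C f)))}"

definition functor_cat ::
  "('o, 'a) cat \<Rightarrow> ('p, 'b) cat \<Rightarrow> (('o, 'a, 'p, 'b) fctr, ('o, 'a, 'p, 'b) nat_trans) cat" where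
  "functor_cat C D = \<lparr>Obj = functors C D, Arr = nat_transformations C D,
     Dom = (\<lambda>(F, \<eta>, G). F), Cod = (\<lambda>(F, \<eta>, G). G),
     Ident = (\<lambda>F. (F, \<lambda>a \<in> Obj C. Ident D (omap F a), F)),
     Comp = (\<lambda>(F', \<theta>, H) (F, \<eta>, G). (F, \<lambda>a \<in> Obj C. Comp D (\<theta> a) (\<eta> a), H))\<rparr>"

definition full_subcat :: "('o, 'a) cat \<Rightarrow> 'o set \<Rightarrow> ('o, 'a) cat" where
  "full_subcat C X = C\<lparr>Obj := Obj C \<inter> X, Arr := {f \<in> Arr C. Dom C f \<in> X \<and> Cod C f \<in> X}\<rparr>"

definition equivalent_cats :: "('o, 'a) cat \<Rightarrow> ('p, 'b) cat \<Rightarrow> bool" where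
  "equivalent_cats C D \<longleftrightarrow> (\<exists>F \<in> functors C D. \<exists>G \<in> functors D C.
     isomorphic (functor_cat C C) (comp_functor C G F) (id_functor C) \<and>
     isomorphic (functor_cat D D) (comp_functor D F G) (id_functor D))"

text \<open>HOL has no type of all sets, so sets are taken relative to a collection \<open>U\<close> of ``small''
  subsets of some type, closed under subsets and images. Grothendieck universes (transported to
  a type) are of this form, and so is the collection of all subsets of any type.\<close>

definition set_universe :: "'u set set \<Rightarrow> bool" where
  "set_universe U \<longleftrightarrow> (\<forall>A \<in> U. \<forall>(f :: 'u \<Rightarrow> 'u) B. B \<subseteq> f ` A \<longrightarrow> B \<in> U)"

definition small :: "'u set set \<Rightarrow> 'x set \<Rightarrow> bool" where
  "small U X \<longleftrightarrow> (\<exists>A \<in> U. \<exists>f. inj_on f X \<and> f ` X \<subseteq> A)"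

type_synonym 'u set_arr = "'u set \<times> ('u \<Rightarrow> 'u) \<times> 'u set"

definition set_cat :: "'u set set \<Rightarrow> ('u set, 'u set_arr) cat" where
  "set_cat U = \<lparr>Obj = U, Arr = {(A, f, B). A \<in> U \<and> B \<in> U \<and> f \<in> A \<rightarrow>\<^sub>E B},
     Dom = (\<lambda>(A, f, B). A), Cod = (\<lambda>(A, f, B). B),
     Ident = (\<lambda>A. (A, \<lambda>x \<in> A. x, A)),
     Comp = (\<lambda>(B', g, D) (A, f, B). (A, compose A g f, D))\<rparr>"

type_synonym ('o, 'a, 'u) presheaf = "('o, 'a, 'u set, 'u set_arr) fctr"

abbreviation presheaf_cat :: "'u set set \<Rightarrow> ('o, 'a) cat \<Rightarrow>
    (('o, 'a, 'u) presheaf, ('o, 'a, 'u set, 'u set_arr) nat_trans) cat" where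
  "presheaf_cat U C \<equiv> functor_cat (op_cat C) (set_cat U)"

definition restr :: "('o, 'a, 'u) presheaf \<Rightarrow> 'a \<Rightarrow> 'u \<Rightarrow> 'u" where
  "restr P f = fst (snd (amap P f))"

definition sieve :: "('o, 'a) cat \<Rightarrow> 'o \<Rightarrow> 'a set \<Rightarrow> bool" where
  "sieve C c S \<longleftrightarrow> S \<subseteq> {f \<in> Arr C. Cod C f = c} \<and>
     (\<forall>f \<in> S. \<forall>g \<in> Arr C. Cod C g = Dom C f \<longrightarrow> Comp C f g \<in> S)"

definition matching :: "('o, 'a) cat \<Rightarrow> ('o, 'a, 'u) presheaf \<Rightarrow> 'a set \<Rightarrow> ('a \<Rightarrow> 'u) \<Rightarrow> bool" where
  "matching C P S s \<longleftrightarrow> (\<forall>f \<in> S. s f \<in> omap P (Dom C f) \<and>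
     (\<forall>g \<in> Arr C. Cod C g = Dom C f \<longrightarrow> s (Comp C f g) = restr P g (s f)))"

definition is_sheaf ::
  "('o, 'a) cat \<Rightarrow> ('o \<Rightarrow> 'a set set) \<Rightarrow> ('o, 'a, 'u) presheaf \<Rightarrow> bool" where
  "is_sheaf C J P \<longleftrightarrow> (\<forall>c \<in> Obj C. \<forall>S \<in> J c. \<forall>s. matching C P S s \<longrightarrow>
     (\<exists>!x. x \<in> omap P c \<and> (\<forall>f \<in> S. restr P f x = s f)))"

definition sheaf_cat :: "'u set set \<Rightarrow> ('o, 'a) cat \<Rightarrow> ('o \<Rightarrow> 'a set set) \<Rightarrow>
    (('o, 'a, 'u) presheaf, ('o, 'a, 'u set, 'u set_arr) nat_trans) cat" where
  "sheaf_cat U C J = full_subcat (presheaf_cat U C) {P. is_sheaf C J P}"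


section \<open>Geometric logic over the signature of MV-algebras\<close>

datatype mvterm = Var nat | Zero | Neg mvterm | Plus mvterm mvterm

text \<open>Variables are de Bruijn indices: \<open>Ex\<close> binds index 0. Disjunctions are indexed by arbitrary
  subsets of \<open>nat + 'i\<close>, where \<open>'i\<close> is an arbitrary type; the summand \<open>nat\<close> only guarantees that
  countable disjunctions are available.\<close>

datatype 'i form =
    Eq mvterm mvterm
  | Top
  | And "'i form" "'i form"
  | Ex "'i form"
  | Disj "(nat + 'i) set" "nat + 'i \<Rightarrow> 'i form"

definition Bot :: "'i form" where
  "Bot = Disj {} (\<lambda>_. Top)"

definition Or :: "'i form \<Rightarrow> 'i form \<Rightarrow> 'i form" where
  "Or \<phi> \<psi> = Disj {Inl 0, Inl 1} (\<lambda>i. if i = Inl 0 then \<phi> else \<psi>)"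

definition Conj :: "'i form list \<Rightarrow> 'i form" where
  "Conj \<phi>s = foldr And \<phi>s Top"

primrec tvars :: "mvterm \<Rightarrow> nat set" where
  "tvars (Var k) = {k}"
| "tvars Zero = {}"
| "tvars (Neg t) = tvars t"
| "tvars (Plus s t) = tvars s \<union> tvars t"

text \<open>\<open>wff \<phi> n\<close>: \<open>\<phi>\<close> is a formula in the context of the \<open>n\<close> variables \<open>0, \<dots>, n - 1\<close>.\<close>

primrec wff :: "'i form \<Rightarrow> nat \<Rightarrow> bool" where
  "wff (Eq s t) = (\<lambda>n. tvars s \<union> tvars t \<subseteq> {..<n})"
| "wff Top = (\<lambda>n. True)"
| "wff (And \<phi> \<psi>) = (\<lambda>n. wff \<phi> n \<and> wff \<psi> n)"
| "wff (Ex \<phi>) = (\<lambda>n. wff \<phi> (Suc n))"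
| "wff (Disj I f) = (\<lambda>n. \<forall>i \<in> I. wff (f i) n)"

primrec tsubst :: "mvterm \<Rightarrow> (nat \<Rightarrow> mvterm) \<Rightarrow> mvterm" where
  "tsubst (Var k) \<sigma> = \<sigma> k"
| "tsubst Zero \<sigma> = Zero"
| "tsubst (Neg t) \<sigma> = Neg (tsubst t \<sigma>)"
| "tsubst (Plus s t) \<sigma> = Plus (tsubst s \<sigma>) (tsubst t \<sigma>)"

definition lift :: "(nat \<Rightarrow> mvterm) \<Rightarrow> nat \<Rightarrow> mvterm" where
  "lift \<sigma> = case_nat (Var 0) (\<lambda>k. tsubst (\<sigma> k) (\<lambda>j. Var (Suc j)))"

primrec subst :: "'i form \<Rightarrow> (nat \<Rightarrow> mvterm) \<Rightarrow> 'i form" where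
  "subst (Eq s t) = (\<lambda>\<sigma>. Eq (tsubst s \<sigma>) (tsubst t \<sigma>))"
| "subst Top = (\<lambda>\<sigma>. Top)"
| "subst (And \<phi> \<psi>) = (\<lambda>\<sigma>. And (subst \<phi> \<sigma>) (subst \<psi> \<sigma>))"
| "subst (Ex \<phi>) = (\<lambda>\<sigma>. Ex (subst \<phi> (lift \<sigma>)))"
| "subst (Disj I f) = (\<lambda>\<sigma>. Disj I (\<lambda>i. subst (f i) \<sigma>))"

abbreviation ren :: "'i form \<Rightarrow> (nat \<Rightarrow> nat) \<Rightarrow> 'i form" where
  "ren \<phi> r \<equiv> subst \<phi> (\<lambda>k. Var (r k))"

abbreviation inst :: "'i form \<Rightarrow> mvterm \<Rightarrow> 'i form" where
  "inst \<phi> t \<equiv> subst \<phi> (case_nat t Var)"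

text \<open>The triple \<open>(n, \<phi>, \<psi>)\<close> is the sequent from \<open>\<phi>\<close> to \<open>\<psi>\<close> in the context of \<open>n\<close> variables.\<close>

type_synonym 'i gtheory = "(nat \<times> 'i form \<times> 'i form) set"

inductive prov :: "'i gtheory \<Rightarrow> nat \<Rightarrow> 'i form \<Rightarrow> 'i form \<Rightarrow> bool" for T where
  axm: "\<lbrakk>(n, \<phi>, \<psi>) \<in> T; wff \<phi> n; wff \<psi> n\<rbrakk> \<Longrightarrow> prov T n \<phi> \<psi>"
| refl: "wff \<phi> n \<Longrightarrow> prov T n \<phi> \<phi>"
| cut: "\<lbrakk>prov T n \<phi> \<psi>; prov T n \<psi> \<chi>\<rbrakk> \<Longrightarrow> prov T n \<phi> \<chi>"
| substitution: "\<lbrakk>prov T n \<phi> \<psi>; \<forall>k<n. tvars (\<sigma> k) \<subseteq> {..<m}\<rbrakk>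
    \<Longrightarrow> prov T m (subst \<phi> \<sigma>) (subst \<psi> \<sigma>)"
| eq_refl: "tvars t \<subseteq> {..<n} \<Longrightarrow> prov T n Top (Eq t t)"
| eq_subst: "\<lbrakk>tvars s \<subseteq> {..<n}; tvars t \<subseteq> {..<n}; wff \<phi> (Suc n)\<rbrakk>
    \<Longrightarrow> prov T n (And (Eq s t) (inst \<phi> s)) (inst \<phi> t)"
| top: "wff \<phi> n \<Longrightarrow> prov T n \<phi> Top"
| and_left1: "\<lbrakk>wff \<phi> n; wff \<psi> n\<rbrakk> \<Longrightarrow> prov T n (And \<phi> \<psi>) \<phi>"
| and_left2: "\<lbrakk>wff \<phi> n; wff \<psi> n\<rbrakk> \<Longrightarrow> prov T n (And \<phi> \<psi>) \<psi>"
| and_right: "\<lbrakk>prov T n \<chi> \<phi>; prov T n \<chi> \<psi>\<rbrakk> \<Longrightarrow> prov T n \<chi> (And \<phi> \<psi>)"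
| disj_right: "\<lbrakk>\<forall>j \<in> I. wff (f j) n; i \<in> I\<rbrakk> \<Longrightarrow> prov T n (f i) (Disj I f)"
| disj_left: "\<lbrakk>\<forall>i \<in> I. prov T n (f i) \<psi>; wff \<psi> n\<rbrakk> \<Longrightarrow> prov T n (Disj I f) \<psi>"
| ex_left: "\<lbrakk>prov T (Suc n) \<phi> (ren \<psi> Suc); wff \<psi> n\<rbrakk> \<Longrightarrow> prov T n (Ex \<phi>) \<psi>"
| ex_right: "\<lbrakk>prov T n (Ex \<phi>) \<psi>; wff \<psi> n\<rbrakk> \<Longrightarrow> prov T (Suc n) \<phi> (ren \<psi> Suc)"
| distributivity: "\<lbrakk>wff \<phi> n; \<forall>i \<in> I. wff (f i) n\<rbrakk>
    \<Longrightarrow> prov T n (And \<phi> (Disj I f)) (Disj I (\<lambda>i. And \<phi> (f i)))"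
| frobenius: "\<lbrakk>wff \<phi> n; wff \<psi> (Suc n)\<rbrakk>
    \<Longrightarrow> prov T n (And \<phi> (Ex \<psi>)) (Ex (And (ren \<phi> Suc) \<psi>))"


section \<open>The syntactic site and the classifying topos\<close>

text \<open>An object is a formula in context. An arrow from \<open>(n, \<phi>)\<close> to \<open>(m, \<psi>)\<close> is a class, modulo
  provable equivalence, of formulas \<open>\<theta>\<close> in context \<open>m + n\<close>, provably functional from \<open>\<phi>\<close> to \<open>\<psi>\<close>:
  the variables \<open>0, \<dots>, m - 1\<close> are those of the target (so that \<open>(Ex ^^ m) \<theta>\<close> quantifies over
  them) and \<open>m, \<dots>, m + n - 1\<close> are those of the source.\<close>

type_synonym 'i fobj = "nat \<times> 'i form"
type_synonym 'i farr = "'i fobj \<times> 'i form set \<times> 'i fobj"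

definition functional :: "'i gtheory \<Rightarrow> 'i fobj \<Rightarrow> 'i fobj \<Rightarrow> 'i form \<Rightarrow> bool" where
  "functional T = (\<lambda>(n, \<phi>) (m, \<psi>) \<theta>. wff \<theta> (m + n) \<and>
     prov T (m + n) \<theta> (And (ren \<phi> (\<lambda>k. m + k)) \<psi>) \<and>
     prov T n \<phi> ((Ex ^^ m) \<theta>) \<and>
     prov T (m + m + n)
       (And (ren \<theta> (\<lambda>k. if k < m then k else m + k)) (ren \<theta> (\<lambda>k. m + k)))
       (Conj (map (\<lambda>j. Eq (Var j) (Var (m + j))) [0..<m])))"

definition prov_class :: "'i gtheory \<Rightarrow> nat \<Rightarrow> 'i form \<Rightarrow> 'i form set" where
  "prov_class T n \<theta> = {\<theta>'. prov T n \<theta> \<theta>' \<and> prov T n \<theta>' \<theta>}"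

text \<open>The relational composite of \<open>\<theta>\<close> from \<open>n\<close> to \<open>m\<close> variables and \<open>\<gamma>\<close> from \<open>m\<close> to \<open>l\<close> variables.\<close>

definition comp_form :: "nat \<Rightarrow> nat \<Rightarrow> 'i form \<Rightarrow> 'i form \<Rightarrow> 'i form" where
  "comp_form m l \<gamma> \<theta> = (Ex ^^ m)
     (And (ren \<theta> (\<lambda>k. if k < m then k else l + k)) (ren \<gamma> (\<lambda>k. if k < l then m + k else k - l)))"

definition id_form :: "'i fobj \<Rightarrow> 'i form" where
  "id_form = (\<lambda>(n, \<phi>). And \<phi> (Conj (map (\<lambda>j. Eq (Var j) (Var (n + j))) [0..<n])))"

definition syn_cat :: "'i gtheory \<Rightarrow> ('i fobj, 'i farr) cat" where
  "syn_cat T = \<lparr>Obj = {(n, \<phi>). wff \<phi> n},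
     Arr = {((n, \<phi>), prov_class T (m + n) \<theta>, (m, \<psi>)) | n \<phi> m \<psi> \<theta>.
              wff \<phi> n \<and> wff \<psi> m \<and> functional T (n, \<phi>) (m, \<psi>) \<theta>},
     Dom = (\<lambda>(a, X, b). a), Cod = (\<lambda>(a, X, b). b),
     Ident = (\<lambda>(n, \<phi>). ((n, \<phi>), prov_class T (n + n) (id_form (n, \<phi>)), (n, \<phi>))),
     Comp = (\<lambda>(b, Y, (l, \<chi>)) ((n, \<phi>), X, (m, \<psi>)).
       ((n, \<phi>), \<Union>\<theta> \<in> X. \<Union>\<gamma> \<in> Y. prov_class T (l + n) (comp_form m l \<gamma> \<theta>), (l, \<chi>)))\<rparr>"

text \<open>The image of \<open>\<theta>\<close>: the source variables are moved to the front and quantified away.\<close>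

definition image_form :: "nat \<Rightarrow> nat \<Rightarrow> 'i form \<Rightarrow> 'i form" where
  "image_form n m \<theta> = (Ex ^^ n) (ren \<theta> (\<lambda>k. if k < m then n + k else k - m))"

definition syn_top :: "'i gtheory \<Rightarrow> 'i fobj \<Rightarrow> 'i farr set set" where
  "syn_top T = (\<lambda>(m, \<psi>). {S. sieve (syn_cat T) (m, \<psi>) S \<and>
     (\<exists>I n \<theta>. (\<forall>i \<in> I. \<exists>\<phi> X. ((n i, \<phi>), X, (m, \<psi>)) \<in> S \<and> \<theta> i \<in> X) \<and>
        prov T m \<psi> (Disj I (\<lambda>i. image_form (n i) m (\<theta> i))))})"

definition classifying_topos :: "'u set set \<Rightarrow> 'i gtheory \<Rightarrow>
    (('i fobj, 'i farr, 'u) presheaf, ('i fobj, 'i farr, 'u set, 'u set_arr) nat_trans) cat" where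
  "classifying_topos U T = sheaf_cat U (syn_cat T) (syn_top T)"

text \<open>Every category with small sets of objects and arrows is isomorphic to one whose objects
  and arrows form members of \<open>U\<close>, so \<open>C\<close> below ranges over all small categories.\<close>

definition presheaf_type :: "'u set set \<Rightarrow> 'i gtheory \<Rightarrow> bool" where
  "presheaf_type U T \<longleftrightarrow> (\<exists>C :: ('u, 'u) cat. category C \<and> Obj C \<in> U \<and> Arr C \<in> U \<and>
     equivalent_cats (classifying_topos U T) (presheaf_cat U C))"


section \<open>The theory of local MV-algebras\<close>

fun multiple :: "nat \<Rightarrow> mvterm \<Rightarrow> mvterm" where
  "multiple 0 t = Zero"
| "multiple (Suc 0) t = t"
| "multiple (Suc (Suc k)) t = Plus (multiple (Suc k) t) t"

abbreviation One :: mvterm where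
  "One \<equiv> Neg Zero"

definition MV :: "'i gtheory" where
  "MV = (let x = Var 0; y = Var 1; z = Var 2 in
    {(3, Top, Eq (Plus (Plus x y) z) (Plus x (Plus y z))),
     (2, Top, Eq (Plus x y) (Plus y x)),
     (1, Top, Eq (Plus x Zero) x),
     (1, Top, Eq (Neg (Neg x)) x),
     (1, Top, Eq (Plus x One) One),
     (2, Top, Eq (Plus (Neg (Plus (Neg x) y)) y) (Plus (Neg (Plus (Neg y) x)) x))})"

definition Loc :: "'i gtheory" where
  "Loc = MV \<union>
    {(1, Top, Disj (Inl ` {1..})
        (\<lambda>i. Or (Eq (multiple (projl i) (Var 0)) One) (Eq (multiple (projl i) (Neg (Var 0))) One))),
     (0, Eq Zero One, Bot)}"

end

theory Submission
  imports Defs Complex_Main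
begin

text \<open>In a presheaf topos every object is generated by elements that are prime: if a family of
  subobjects covers the object, each element lies in one of them. More precisely, an element
  \<open>x\<close> of a presheaf \<open>X\<close> has a largest subpresheaf missing it, and every
  subobject either contains \<open>x\<close> or lies below that one. The definition
  \<open>prime_generated\<close> expresses this by arrows alone; it is invariant under equivalence
  (\<open>prime_generated_transport\<close>) and holds in presheaf categories
  (\<open>presheaf_prime_generated\<close>). The classifying topos of local MV-algebras violates it
  (\<open>not_prime_generated\<close>).

  The violation comes from the unit interval, a model of the theory. It has irrational elements
  \<open>a\<close>. Suppose that a prime element of an object of "numbers" takes the value
  \<open>a\<close> at some real point. The locality axiom says that for each term \<open>t\<close>
  the subobjects \<open>k t = 1\<close> and \<open>k (\<not> t) = 1\<close>, over all
  \<open>k\<close>, form a cover, so all values of the prime element satisfy one and the same of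
  these equations. Terms separate points: for each \<open>b \<noteq> a\<close> some \<open>t\<close>
  has value 0 at one of the two and 1 at the other (\<open>separating_term\<close>). Hence
  \<open>a\<close> is the only value of the prime element. On the other hand, geometric formulas
  cannot isolate an irrational point: moving all coordinates along an additive function that kills 1
  but not \<open>a\<close> preserves the truth of every geometric formula, if the step is small
  (\<open>perturb_sat\<close>). So the value moves as well, a contradiction.

  The object of "numbers" consists of the definable functions from the points of a formula to the
  unit interval whose graph is provably total (\<open>Shf\<close>). It is a sheaf on the syntactic
  site (\<open>Shf_sheaf\<close>), where gluing takes place on real points; its covers by level sets
  come from the locality axiom (\<open>agree_on_levels\<close>). Provability enters through the
  composition of functional formulas and through the existence of enough arrows, and is handled by
  reasoning about generic elements.\<close>

section \<open>The sequent calculus\<close>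

lemma tsubst_tsubst [simp]: "tsubst (tsubst t \<sigma>) \<tau> = tsubst t (\<lambda>k. tsubst (\<sigma> k) \<tau>)"
  by (induction t) auto

lemma tsubst_Var [simp]: "tsubst t Var = t"
  by (induction t) auto

lemma tvars_tsubst: "tvars (tsubst t \<sigma>) = (\<Union>k \<in> tvars t. tvars (\<sigma> k))"
  by (induction t) auto

lemma lift_comp: "(\<lambda>k. tsubst (lift \<sigma> k) (lift \<tau>)) = lift (\<lambda>k. tsubst (\<sigma> k) \<tau>)"
  by (rule ext) (simp add: lift_def split: nat.split)

lemma subst_subst [simp]: "subst (subst \<phi> \<sigma>) \<tau> = subst \<phi> (\<lambda>k. tsubst (\<sigma> k) \<tau>)"
  by (induction \<phi> arbitrary: \<sigma> \<tau>) (auto simp: lift_comp)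

lemma lift_Var [simp]: "lift Var = Var"
  by (rule ext) (simp add: lift_def split: nat.split)

lemma subst_Var [simp]: "subst \<phi> Var = \<phi>"
  by (induction \<phi>) auto

definition scoped :: "nat \<Rightarrow> nat \<Rightarrow> (nat \<Rightarrow> mvterm) \<Rightarrow> bool" where
  "scoped n m \<sigma> \<longleftrightarrow> (\<forall>k<n. tvars (\<sigma> k) \<subseteq> {..<m})"

text \<open>Variables come in blocks: \<open>app m w u\<close> fills a block of \<open>m\<close>
  variables from \<open>w\<close> and the remaining ones from \<open>u\<close>. With a source tuple
  \<open>u\<close> and a target tuple \<open>w\<close>, the relation expressed by a formula
  \<open>\<theta>\<close> in context \<open>m + n\<close> is \<open>subst \<theta> (app m w
  u)\<close>; the same function combines real points of the model.\<close>

definition app :: "nat \<Rightarrow> (nat \<Rightarrow> 'x) \<Rightarrow> (nat \<Rightarrow> 'x) \<Rightarrow> nat \<Rightarrow> 'x" where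
  "app m w u = (\<lambda>k. if k < m then w k else u (k - m))"

text \<open>Weakening by \<open>m\<close> new variables. When a block quantifier over a formula in
  the tuple \<open>u\<close> is eliminated, the witnesses are the new variables \<open>Var 0,
  \<dots>, Var (m - 1)\<close> and \<open>u\<close> becomes \<open>shift m u\<close>.\<close>

definition shift :: "nat \<Rightarrow> (nat \<Rightarrow> mvterm) \<Rightarrow> nat \<Rightarrow> mvterm" where
  "shift m u = (\<lambda>k. tsubst (u k) (\<lambda>j. Var (m + j)))"

lemma tvars_tsubst_scoped: "tvars t \<subseteq> {..<n} \<Longrightarrow> scoped n m \<sigma> \<Longrightarrow> tvars (tsubst t \<sigma>) \<subseteq> {..<m}"
  by (fastforce simp: tvars_tsubst scoped_def)

lemma scoped_lift: "scoped n m \<sigma> \<Longrightarrow> scoped (Suc n) (Suc m) (lift \<sigma>)"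
  by (fastforce simp: scoped_def lift_def tvars_tsubst split: nat.splits)

lemma scoped_app [intro!]: "scoped m N w \<Longrightarrow> scoped n N u \<Longrightarrow> scoped (m + n) N (app m w u)"
  by (auto simp: scoped_def app_def)

lemma scoped_shift [intro!]: "scoped n N u \<Longrightarrow> scoped n (m + N) (shift m u)"
  by (fastforce simp: scoped_def shift_def tvars_tsubst)

lemma scoped_Var [simp]: "scoped n m (\<lambda>k. Var (r k)) \<longleftrightarrow> (\<forall>k<n. r k < m)"
  by (auto simp: scoped_def)

lemma scoped_Var' [simp]: "scoped n m Var \<longleftrightarrow> n \<le> m"
  by (simp add: scoped_def) (meson not_le_imp_less order_less_irrefl order_less_le_trans)

lemma wff_subst: "wff \<phi> n \<Longrightarrow> scoped n m \<sigma> \<Longrightarrow> wff (subst \<phi> \<sigma>) m"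
proof (induction \<phi> arbitrary: n m \<sigma>)
  case (Eq s t)
  then show ?case using tvars_tsubst_scoped[of s n m \<sigma>] tvars_tsubst_scoped[of t n m \<sigma>] by simp
next
  case (Ex \<phi>)
  then show ?case using scoped_lift by simp
qed auto

lemma wff_ren: "wff \<phi> n \<Longrightarrow> (\<And>k. k < n \<Longrightarrow> r k < m) \<Longrightarrow> wff (ren \<phi> r) m"
  by (rule wff_subst) auto

lemma wff_Ex_pow [simp]: "wff ((Ex ^^ m) \<phi>) n = wff \<phi> (m + n)"
  by (induction m arbitrary: n) auto

lemma wff_Conj [simp]: "wff (Conj \<phi>s) n \<longleftrightarrow> (\<forall>\<phi> \<in> set \<phi>s. wff \<phi> n)"
  by (induction \<phi>s) (auto simp: Conj_def)

lemma subst_Conj [simp]: "subst (Conj \<phi>s) \<sigma> = Conj (map (\<lambda>\<phi>. subst \<phi> \<sigma>) \<phi>s)"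
  by (induction \<phi>s) (auto simp: Conj_def)

lemma app_Var [simp]: "app m Var (\<lambda>k. Var (m + k)) = Var"
  by (auto simp: app_def)

lemma shift_0 [simp]: "shift 0 u = u"
  by (simp add: shift_def)

lemma subst_Ex_pow: "subst ((Ex ^^ m) \<phi>) u = (Ex ^^ m) (subst \<phi> (app m Var (shift m u)))"
proof (induction m arbitrary: \<phi> u)
  case 0
  show ?case by (simp add: app_def)
next
  case (Suc m)
  have "app m Var (shift m (lift u)) = app (Suc m) Var (shift (Suc m) u)"
  proof
    show "app m Var (shift m (lift u)) k = app (Suc m) Var (shift (Suc m) u) k" for k
      by (cases "k - m") (auto simp: app_def shift_def lift_def simp: diff_Suc split: nat.splits)
  qed
  then show ?case using Suc.IH[of \<phi> "lift u"] by simp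
qed

lemma prov_wff: "prov T n \<phi> \<psi> \<Longrightarrow> wff \<phi> n \<and> wff \<psi> n"
proof (induction rule: prov.induct)
  case (substitution n \<phi> \<psi> \<sigma> m)
  then show ?case by (auto intro: wff_subst simp: scoped_def)
next
  case (eq_subst s n t \<phi>)
  have "scoped (Suc n) n (case_nat r Var)" if "tvars r \<subseteq> {..<n}" for r
    using that by (auto simp: scoped_def split: nat.split)
  with eq_subst show ?case by (auto intro: wff_subst)
next
  case (ex_right n \<phi> \<psi>)
  then show ?case by (auto intro: wff_ren)
next
  case (frobenius \<phi> n \<psi>)
  then show ?case by (auto intro: wff_ren)
qed auto

lemma prov_subst: "prov T n \<phi> \<psi> \<Longrightarrow> scoped n m \<sigma> \<Longrightarrow> prov T m (subst \<phi> \<sigma>) (subst \<psi> \<sigma>)"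
  by (rule prov.substitution) (auto simp: scoped_def)

lemma prov_And: "prov T n \<Gamma> (And \<phi> \<psi>) \<longleftrightarrow> prov T n \<Gamma> \<phi> \<and> prov T n \<Gamma> \<psi>"
  by (meson prov.and_left1 prov.and_left2 prov.and_right prov.cut prov_wff wff.simps(3))

lemma prov_Conj: "prov T n \<Gamma> (Conj \<phi>s) \<longleftrightarrow> wff \<Gamma> n \<and> (\<forall>\<phi> \<in> set \<phi>s. prov T n \<Gamma> \<phi>)"
  by (induction \<phi>s) (auto simp: Conj_def prov_And prov.top dest: prov_wff)

lemma prov_hyp1: "wff \<Gamma> n \<Longrightarrow> wff \<phi> n \<Longrightarrow> prov T n \<Gamma> \<chi> \<Longrightarrow> prov T n (And \<Gamma> \<phi>) \<chi>"
  by (meson prov.and_left1 prov.cut)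

lemma ex_elim:
  assumes "prov T n \<Gamma> (Ex \<phi>)" "prov T (Suc n) (And (ren \<Gamma> Suc) \<phi>) (ren \<psi> Suc)" "wff \<psi> n"
  shows "prov T n \<Gamma> \<psi>"
proof -
  have w: "wff \<Gamma> n" "wff \<phi> (Suc n)" using prov_wff[OF assms(1)] by auto
  have "prov T n \<Gamma> (And \<Gamma> (Ex \<phi>))" using assms(1) w by (simp add: prov_And prov.refl)
  moreover have "prov T n (And \<Gamma> (Ex \<phi>)) (Ex (And (ren \<Gamma> Suc) \<phi>))"
    using w by (rule prov.frobenius)
  moreover have "prov T n (Ex (And (ren \<Gamma> Suc) \<phi>)) \<psi>" using assms by (auto intro: prov.ex_left)
  ultimately show ?thesis by (meson prov.cut)
qed

lemma ex_pow_elim: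
  assumes "prov T n \<Gamma> ((Ex ^^ m) \<phi>)" "prov T (m + n) (And (ren \<Gamma> (\<lambda>k. m + k)) \<phi>) (ren \<psi> (\<lambda>k. m + k))"
    "wff \<psi> n"
  shows "prov T n \<Gamma> \<psi>"
  using assms
proof (induction m arbitrary: n \<Gamma> \<psi>)
  case 0
  then have "prov T n \<Gamma> (And \<Gamma> \<phi>)" by (auto simp: prov_And prov.refl dest: prov_wff)
  with 0 show ?case by (auto intro: prov.cut)
next
  case (Suc m)
  have w: "wff \<Gamma> n" "wff \<phi> (Suc (m + n))" using prov_wff[OF Suc.prems(1)] by auto
  let ?G = "And (ren \<Gamma> Suc) ((Ex ^^ m) \<phi>)"
  have wG: "wff ?G (Suc n)" using w by (auto intro: wff_ren)
  have "prov T (Suc n) ?G (ren \<psi> Suc)"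
  proof (rule Suc.IH)
    have "prov T (Suc n) ?G ?G" by (rule prov.refl[OF wG])
    then show "prov T (Suc n) ?G ((Ex ^^ m) \<phi>)" by (simp only: prov_And)
    let ?H = "And (ren ?G (\<lambda>k. m + k)) \<phi>"
    have "wff ?H (m + Suc n)" using w wff_ren[OF wG, of "\<lambda>k. m + k" "m + Suc n"] by auto
    then have "prov T (m + Suc n) ?H ?H" by (rule prov.refl)
    then have "prov T (m + Suc n) ?H (And (ren \<Gamma> (\<lambda>k. Suc m + k)) \<phi>)"
      by (simp add: prov_And)
    with Suc.prems(2) show "prov T (m + Suc n) ?H (ren (ren \<psi> Suc) (\<lambda>k. m + k))"
      by (auto intro: prov.cut)
    show "wff (ren \<psi> Suc) (Suc n)" using Suc.prems(3) by (auto intro: wff_ren)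
  qed
  with Suc.prems show ?case by (auto intro: ex_elim)
qed

lemma ex_pow_unit: "wff \<phi> (m + n) \<Longrightarrow> prov T (m + n) \<phi> (ren ((Ex ^^ m) \<phi>) (\<lambda>k. m + k))"
proof (induction m arbitrary: n)
  case 0
  then show ?case by (simp add: prov.refl)
next
  case (Suc m)
  have "prov T (m + Suc n) \<phi> (ren ((Ex ^^ m) \<phi>) (\<lambda>k. m + k))"
    using Suc.IH[of "Suc n"] Suc.prems by simp
  moreover have "prov T (Suc n) ((Ex ^^ m) \<phi>) (ren (Ex ((Ex ^^ m) \<phi>)) Suc)"
    by (rule prov.ex_right[OF prov.refl]) (use Suc.prems in simp_all)
  then have "prov T (m + Suc n) (ren ((Ex ^^ m) \<phi>) (\<lambda>k. m + k))
      (ren (ren (Ex ((Ex ^^ m) \<phi>)) Suc) (\<lambda>k. m + k))"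
    by (rule prov_subst) auto
  ultimately show ?case by (auto intro: prov.cut simp del: subst.simps)
qed

text \<open>The rules below treat \<open>prov T N \<Gamma> (subst \<phi> \<tau>)\<close> as a
  forcing relation: at stage \<open>\<Gamma>\<close> in context \<open>N\<close> the tuple of terms
  \<open>\<tau>\<close> satisfies \<open>\<phi>\<close>. Sequents between formulas with many
  variables are then proved by arguing about generic elements, and the context only grows at
  existential eliminations.\<close>

lemma exI_block:
  assumes "prov T N \<Gamma> (subst \<phi> (app m w u))" "wff \<phi> (m + n)" "scoped m N w" "scoped n N u"
  shows "prov T N \<Gamma> (subst ((Ex ^^ m) \<phi>) u)"
proof -
  have "prov T N (subst \<phi> (app m w u)) (subst (ren ((Ex ^^ m) \<phi>) (\<lambda>k. m + k)) (app m w u))"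
    by (rule prov_subst[OF ex_pow_unit[OF assms(2)] scoped_app[OF assms(3,4)]])
  also have "subst (ren ((Ex ^^ m) \<phi>) (\<lambda>k. m + k)) (app m w u) = subst ((Ex ^^ m) \<phi>) u"
    by (simp add: app_def)
  finally show ?thesis using assms(1) by (auto intro: prov.cut)
qed

text \<open>The stage \<open>\<Gamma>'\<close> that is produced is \<open>\<Gamma>\<close> together
  with a generic witness. It is kept abstract, so that its users see only that everything forced at
  \<open>\<Gamma>\<close> stays forced after shifting.\<close>

lemma exE_block:
  assumes "prov T N \<Gamma> (subst ((Ex ^^ m) \<theta>) u)" "wff \<psi> N"
    and step: "\<And>\<Gamma>'. wff \<Gamma>' (m + N) \<Longrightarrow>
      (\<And>\<chi>. prov T N \<Gamma> \<chi> \<Longrightarrow> prov T (m + N) \<Gamma>' (ren \<chi> (\<lambda>k. m + k))) \<Longrightarrow>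
      (\<And>\<chi> \<tau>. prov T N \<Gamma> (subst \<chi> \<tau>) \<Longrightarrow> prov T (m + N) \<Gamma>' (subst \<chi> (shift m \<tau>))) \<Longrightarrow>
      prov T (m + N) \<Gamma>' (subst \<theta> (app m Var (shift m u))) \<Longrightarrow> prov T (m + N) \<Gamma>' (ren \<psi> (\<lambda>k. m + k))"
  shows "prov T N \<Gamma> \<psi>"
proof -
  note 1 = assms(1)[unfolded subst_Ex_pow]
  let ?D = "subst \<theta> (app m Var (shift m u))"
  have w: "wff \<Gamma> N" "wff ?D (m + N)" using prov_wff[OF 1] by auto
  let ?G = "And (ren \<Gamma> (\<lambda>k. m + k)) ?D"
  have wG: "wff ?G (m + N)" using w by (auto intro!: wff_ren)
  then have G: "prov T (m + N) ?G ?G" by (rule prov.refl)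
  have weak: "prov T (m + N) ?G (ren \<chi> (\<lambda>k. m + k))" if "prov T N \<Gamma> \<chi>" for \<chi>
  proof (rule prov.cut)
    show "prov T (m + N) ?G (ren \<Gamma> (\<lambda>k. m + k))" using G by (simp only: prov_And)
    show "prov T (m + N) (ren \<Gamma> (\<lambda>k. m + k)) (ren \<chi> (\<lambda>k. m + k))"
      using that by (rule prov_subst) auto
  qed
  have weak': "prov T (m + N) ?G (subst \<chi> (shift m \<tau>))" if "prov T N \<Gamma> (subst \<chi> \<tau>)" for \<chi> \<tau>
    using weak[OF that] by (simp add: shift_def)
  show ?thesis
    by (rule ex_pow_elim[OF 1 step assms(2), OF wG weak weak']) (use G in \<open>simp_all only: prov_And\<close>)
qed

lemma disjE:
  assumes "prov T N \<Gamma> (Disj I f)" "wff \<psi> N"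
    and step: "\<And>i \<Gamma>'. i \<in> I \<Longrightarrow> (\<And>\<chi>. prov T N \<Gamma> \<chi> \<Longrightarrow> prov T N \<Gamma>' \<chi>) \<Longrightarrow>
      prov T N \<Gamma>' (f i) \<Longrightarrow> prov T N \<Gamma>' \<psi>"
  shows "prov T N \<Gamma> \<psi>"
proof -
  have w: "wff \<Gamma> N" "\<forall>i\<in>I. wff (f i) N" using prov_wff[OF assms(1)] by auto
  have "prov T N \<Gamma> (And \<Gamma> (Disj I f))" using w assms(1) by (simp add: prov_And prov.refl)
  moreover have "prov T N (And \<Gamma> (Disj I f)) (Disj I (\<lambda>i. And \<Gamma> (f i)))"
    using w by (rule prov.distributivity)
  moreover have "prov T N (And \<Gamma> (f i)) \<psi>" if "i \<in> I" for i
    using that w by (intro step) (auto intro: prov_hyp1 prov.and_left2)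
  then have "prov T N (Disj I (\<lambda>i. And \<Gamma> (f i))) \<psi>" using assms(2) by (auto intro: prov.disj_left)
  ultimately show ?thesis by (meson prov.cut)
qed

lemma disjI:
  assumes "prov T N \<Gamma> (f i)" "i \<in> I" "\<And>j. j \<in> I \<Longrightarrow> wff (f j) N"
  shows "prov T N \<Gamma> (Disj I f)"
  by (rule prov.cut[OF assms(1) prov.disj_right[of I f]]) (use assms in auto)

lemma ex_mono:
  assumes "prov T (Suc n) \<phi> \<psi>" shows "prov T n (Ex \<phi>) (Ex \<psi>)"
proof (rule prov.ex_left)
  have w: "wff (Ex \<psi>) n" using prov_wff[OF assms] by simp
  then show "wff (Ex \<psi>) n" .
  show "prov T (Suc n) \<phi> (ren (Ex \<psi>) Suc)"
    using assms w by (metis prov.cut prov.ex_right prov.refl)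
qed

text \<open>Outside its index set a disjunction may carry ill-scoped formulas, so substitutions that
  agree on the context give provably equivalent formulas, not equal ones.\<close>

lemma subst_agree:
  assumes "wff \<phi> n" "\<And>k. k < n \<Longrightarrow> \<sigma> k = \<tau> k" "scoped n m \<sigma>"
  shows "prov T m (subst \<phi> \<sigma>) (subst \<phi> \<tau>)"
  using assms
proof (induction \<phi> arbitrary: n m \<sigma> \<tau>)
  case (Eq s t)
  have "tsubst s \<sigma> = tsubst s \<tau>" if "tvars s \<subseteq> {..<n}" for s
    using that Eq.prems(2) by (induction s) auto
  with Eq have "subst (Eq s t) \<sigma> = subst (Eq s t) \<tau>" by auto
  then show ?case using Eq by (metis prov.refl wff_subst)
next
  case Top
  show ?case by (auto intro: prov.refl)
next
  case (And \<phi> \<psi>)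
  have w: "wff (subst \<phi> \<sigma>) m" "wff (subst \<psi> \<sigma>) m" using And.prems by (auto intro: wff_subst)
  have p: "prov T m (subst \<phi> \<sigma>) (subst \<phi> \<tau>)" "prov T m (subst \<psi> \<sigma>) (subst \<psi> \<tau>)"
    using And.prems And.IH by auto
  show ?case using p w by (auto simp: prov_And intro: prov.cut[OF prov.and_left1] prov.cut[OF prov.and_left2])
next
  case (Ex \<phi>)
  have "prov T (Suc m) (subst \<phi> (lift \<sigma>)) (subst \<phi> (lift \<tau>))"
  proof (rule Ex.IH)
    show "wff \<phi> (Suc n)" using Ex by simp
    show "scoped (Suc n) (Suc m) (lift \<sigma>)" using Ex by (auto intro: scoped_lift)
    show "lift \<sigma> k = lift \<tau> k" if "k < Suc n" for k
      using that Ex.prems(2) by (auto simp: lift_def split: nat.split)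
  qed
  then show ?case by (auto intro: ex_mono)
next
  case (Disj I f)
  have *: "prov T m (subst (f i) \<sigma>) (subst (f i) \<tau>)" if "i \<in> I" for i
    using Disj that by auto
  have "prov T m (subst (f i) \<sigma>) (Disj I (\<lambda>i. subst (f i) \<tau>))" if "i \<in> I" for i
    using that prov_wff[OF *] by (intro disjI[OF *]) auto
  moreover have "wff (Disj I (\<lambda>i. subst (f i) \<tau>)) m" using prov_wff[OF *] by auto
  ultimately show ?case by (auto intro: prov.disj_left)
qed

lemma prov_agree:
  assumes "prov T m \<Gamma> (subst \<phi> \<sigma>)" "wff \<phi> n" "\<And>k. k < n \<Longrightarrow> \<sigma> k = \<tau> k" "scoped n m \<sigma>"
  shows "prov T m \<Gamma> (subst \<phi> \<tau>)"
  using assms by (blast intro: prov.cut subst_agree)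

lemma prov_eq_refl: "wff \<Gamma> n \<Longrightarrow> tvars t \<subseteq> {..<n} \<Longrightarrow> prov T n \<Gamma> (Eq t t)"
  by (blast intro: prov.cut prov.top prov.eq_refl)

lemma prov_eq_inst:
  assumes "prov T n \<Gamma> (Eq s t)" "wff \<phi> (Suc n)" "prov T n \<Gamma> (inst \<phi> s)"
  shows "prov T n \<Gamma> (inst \<phi> t)"
  using assms prov_wff[OF assms(1)] by (auto intro!: prov.cut[OF _ prov.eq_subst] simp: prov_And)

text \<open>The calculus replaces one variable at a time, hence the interpolation \<open>mix\<close>
  between the two tuples.\<close>

lemma prov_eq_subst:
  assumes "prov T N \<Gamma> (subst \<phi> s)" "wff \<phi> n" "scoped n N s" "scoped n N t"
    and eq: "\<And>j. j < n \<Longrightarrow> prov T N \<Gamma> (Eq (s j) (t j))"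
  shows "prov T N \<Gamma> (subst \<phi> t)"
proof -
  define mix where "mix i k = (if k < i then t k else s k)" for i k
  have sc: "scoped n N (mix i)" for i using assms(3,4) by (auto simp: scoped_def mix_def)
  have "i \<le> n \<Longrightarrow> prov T N \<Gamma> (subst \<phi> (mix i))" for i
  proof (induction i)
    case 0
    then show ?case using assms(1) by (simp add: mix_def)
  next
    case (Suc i)
    define \<tau> where "\<tau> k = (if k = i then Var 0 else shift 1 (mix i) k)" for k
    have \<tau>: "scoped n (Suc N) \<tau>" using scoped_shift[OF sc, of 1 i] by (auto simp: \<tau>_def scoped_def)
    have inst: "inst (subst \<phi> \<tau>) r = subst \<phi> (\<lambda>k. if k = i then r else mix i k)" for r
      by (auto simp: \<tau>_def shift_def intro!: arg_cong[where f="subst \<phi>"])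
    have "prov T N \<Gamma> (inst (subst \<phi> \<tau>) (s i))"
    proof -
      have "(\<lambda>k. if k = i then s i else mix i k) = mix i" by (auto simp: mix_def)
      then show ?thesis unfolding inst using Suc by simp
    qed
    then have "prov T N \<Gamma> (inst (subst \<phi> \<tau>) (t i))"
      using Suc.prems assms(2) \<tau> by (intro prov_eq_inst[OF eq[of i]]) (auto intro: wff_subst)
    moreover have "(\<lambda>k. if k = i then t i else mix i k) = mix (Suc i)"
      by (auto simp: mix_def)
    ultimately show ?case by (simp only: inst)
  qed
  from this[of n] show ?thesis
    by (rule prov_agree[OF _ assms(2) _ sc]) (auto simp: mix_def)
qed

section \<open>Functional formulas and their composition\<close>

lemma prov_relI:
  assumes "\<And>\<Gamma> w u N. scoped m N w \<Longrightarrow> scoped n N u \<Longrightarrow> prov T N \<Gamma> (subst \<theta> (app m w u)) \<Longrightarrow>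
     prov T N \<Gamma> (subst \<theta>' (app m w u))"
    and "wff \<theta> (m + n)"
  shows "prov T (m + n) \<theta> \<theta>'"
  using assms(1)[of "m + n" Var "\<lambda>k. Var (m + k)" \<theta>] assms(2) by (simp add: prov.refl)

lemma prov_classI: "wff \<theta> n \<Longrightarrow> \<theta> \<in> prov_class T n \<theta>"
  by (simp add: prov_class_def prov.refl)

lemma prov_class_eq: "prov T n \<theta> \<theta>' \<Longrightarrow> prov T n \<theta>' \<theta> \<Longrightarrow> prov_class T n \<theta> = prov_class T n \<theta>'"
  by (auto simp: prov_class_def intro: prov.cut)

lemma prov_instance: "prov T n \<phi> \<psi> \<Longrightarrow> scoped n N u \<Longrightarrow> prov T N \<Gamma> (subst \<phi> u) \<Longrightarrow> prov T N \<Gamma> (subst \<psi> u)"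
  by (blast intro: prov.cut prov_subst)

lemma prov_eq_sym:
  assumes "prov T n \<Gamma> (Eq s t)" shows "prov T n \<Gamma> (Eq t s)"
proof -
  have w: "wff \<Gamma> n" "tvars s \<subseteq> {..<n}" "tvars t \<subseteq> {..<n}" using prov_wff[OF assms] by auto
  let ?p = "Eq (Var 0) (tsubst s (\<lambda>k. Var (Suc k))) :: 'a form"
  have "prov T n \<Gamma> (inst ?p t)"
    by (rule prov_eq_inst[OF assms]) (use w prov_eq_refl[OF w(1,2)] in \<open>auto simp: tvars_tsubst\<close>)
  then show ?thesis by simp
qed

lemma prov_eq_trans:
  assumes "prov T n \<Gamma> (Eq s t)" "prov T n \<Gamma> (Eq t r)" shows "prov T n \<Gamma> (Eq s r)"
proof -
  have w: "tvars s \<subseteq> {..<n}" using prov_wff[OF assms(1)] by auto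
  let ?p = "Eq (tsubst s (\<lambda>k. Var (Suc k))) (Var 0) :: 'a form"
  have "prov T n \<Gamma> (inst ?p r)"
    by (rule prov_eq_inst[OF assms(2)]) (use w assms in \<open>auto simp: tvars_tsubst\<close>)
  then show ?thesis by simp
qed

lemma app_lt [simp]: "k < m \<Longrightarrow> app m w u k = w k"
  and app_add [simp]: "app m w u (m + k) = u k"
  by (simp_all add: app_def)

lemma shift_app: "shift l (app m w u) = app m (shift l w) (shift l u)"
  by (auto simp: shift_def app_def)

lemma ren_subst: "ren (subst \<phi> u) (\<lambda>k. m + k) = subst \<phi> (shift m u)"
  by (simp add: shift_def)

text \<open>Functionality in terms of generic elements. The conditions in the definition are the
  instances at the generic tuples of variables, and \<open>functional_src\<close>,
  \<open>functional_tgt\<close>, \<open>functional_total\<close>, \<open>functional_unique\<close>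
  recover the general ones by substitution.\<close>

lemma functionalI:
  assumes w: "wff \<phi> n" "wff \<psi> m" "wff \<theta> (m + n)"
    and st: "\<And>N \<Gamma> w u. scoped m N w \<Longrightarrow> scoped n N u \<Longrightarrow> prov T N \<Gamma> (subst \<theta> (app m w u)) \<Longrightarrow>
      prov T N \<Gamma> (subst \<phi> u) \<and> prov T N \<Gamma> (subst \<psi> w)"
    and total: "\<And>N \<Gamma> u. scoped n N u \<Longrightarrow> prov T N \<Gamma> (subst \<phi> u) \<Longrightarrow>
      prov T N \<Gamma> (subst ((Ex ^^ m) \<theta>) u)"
    and unique: "\<And>N \<Gamma> w w' u j. scoped m N w \<Longrightarrow> scoped m N w' \<Longrightarrow> scoped n N u \<Longrightarrow>
      prov T N \<Gamma> (subst \<theta> (app m w u)) \<Longrightarrow> prov T N \<Gamma> (subst \<theta> (app m w' u)) \<Longrightarrow> j < m \<Longrightarrow>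
      prov T N \<Gamma> (Eq (w j) (w' j))"
  shows "functional T (n, \<phi>) (m, \<psi>) \<theta>"
proof -
  have "prov T (m + n) \<theta> (And (ren \<phi> (\<lambda>k. m + k)) \<psi>)"
    using st[of "m + n" Var "\<lambda>k. Var (m + k)" \<theta>] w by (simp add: prov.refl prov_And)
  moreover have "prov T n \<phi> ((Ex ^^ m) \<theta>)"
    using total[of n Var \<phi>] w by (simp add: prov.refl)
  moreover
  define r1 r2 where "r1 k = (if k < m then k else m + k)" and "r2 k = m + k" for k
  let ?G = "And (ren \<theta> r1) (ren \<theta> r2)"
  have "wff ?G (m + m + n)"
    using w by (auto intro!: wff_ren simp: r1_def r2_def)
  then have "prov T (m + m + n) ?G ?G" by (rule prov.refl)
  then have G: "prov T (m + m + n) ?G (ren \<theta> r1)" "prov T (m + m + n) ?G (ren \<theta> r2)"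
    by (simp_all only: prov_And)
  have "prov T (m + m + n) ?G (Conj (map (\<lambda>j. Eq (Var j) (Var (m + j))) [0..<m]))"
  proof -
    have "prov T (m + m + n) ?G (Eq (Var j) (Var (m + j)))" if "j < m" for j
    proof (rule unique[where u = "\<lambda>k. Var (m + m + k)" and w = Var and w' = "\<lambda>k. Var (m + k)"])
      have "app m Var (\<lambda>k. Var (m + m + k)) = (\<lambda>k. Var (r1 k))"
        by (auto simp: app_def r1_def)
      then show "prov T (m + m + n) ?G (subst \<theta> (app m Var (\<lambda>k. Var (m + m + k))))"
        using G by simp
      have "app m (\<lambda>k. Var (m + k)) (\<lambda>k. Var (m + m + k)) = (\<lambda>k. Var (r2 k))"
        by (auto simp: app_def r2_def)
      then show "prov T (m + m + n) ?G (subst \<theta> (app m (\<lambda>k. Var (m + k)) (\<lambda>k. Var (m + m + k))))"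
        using G by simp
    qed (use that in auto)
    then show ?thesis using prov_wff[OF G(1)] by (auto simp: prov_Conj)
  qed
  ultimately show ?thesis using w by (simp add: functional_def r1_def r2_def)
qed

lemma functional_wff: "functional T (n, \<phi>) (m, \<psi>) \<theta> \<Longrightarrow> wff \<theta> (m + n)"
  by (simp add: functional_def)

lemma functional_src0: "functional T (n, \<phi>) (m, \<psi>) \<theta> \<Longrightarrow> prov T (m + n) \<theta> (ren \<phi> (\<lambda>k. m + k))"
  and functional_tgt0: "functional T (n, \<phi>) (m, \<psi>) \<theta> \<Longrightarrow> prov T (m + n) \<theta> \<psi>"
  by (simp_all add: functional_def prov_And)

lemma functional_obj:
  assumes "functional T (n, \<phi>) (m, \<psi>) \<theta>" "wff \<psi> m"
  shows "wff \<phi> n"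
  using assms by (auto simp: functional_def dest: prov_wff)

lemma functional_src:
  assumes "functional T (n, \<phi>) (m, \<psi>) \<theta>" "prov T N \<Gamma> (subst \<theta> (app m w u))" "scoped m N w" "scoped n N u"
  shows "prov T N \<Gamma> (subst \<phi> u)"
  using prov_instance[OF functional_src0[OF assms(1)] scoped_app[OF assms(3,4)] assms(2)] by simp

lemma functional_tgt:
  assumes "functional T (n, \<phi>) (m, \<psi>) \<theta>" "wff \<psi> m" "prov T N \<Gamma> (subst \<theta> (app m w u))"
    "scoped m N w" "scoped n N u"
  shows "prov T N \<Gamma> (subst \<psi> w)"
proof (rule prov_agree)
  show "prov T N \<Gamma> (subst \<psi> (app m w u))"
    using prov_instance[OF functional_tgt0[OF assms(1)] scoped_app[OF assms(4,5)] assms(3)] .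
  show "scoped m N (app m w u)" using assms(4) by (simp add: scoped_def)
qed (use assms in auto)

lemma functional_total:
  assumes "functional T (n, \<phi>) (m, \<psi>) \<theta>" "prov T N \<Gamma> (subst \<phi> u)" "scoped n N u"
  shows "prov T N \<Gamma> (subst ((Ex ^^ m) \<theta>) u)"
proof -
  have "prov T n \<phi> ((Ex ^^ m) \<theta>)" using assms(1) by (simp add: functional_def)
  from prov_instance[OF this assms(3,2)] show ?thesis .
qed

lemma functional_unique:
  assumes F: "functional T (n, \<phi>) (m, \<psi>) \<theta>"
    and 1: "prov T N \<Gamma> (subst \<theta> (app m w u))" and 2: "prov T N \<Gamma> (subst \<theta> (app m w' u))"
    and sc: "scoped m N w" "scoped m N w'" "scoped n N u" and j: "j < m"
  shows "prov T N \<Gamma> (Eq (w j) (w' j))"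
proof -
  let ?s = "app m w (app m w' u)"
  have sc': "scoped (m + m + n) N ?s"
    using scoped_app[OF sc(1) scoped_app[OF sc(2,3)]] by (simp add: add.assoc)
  have "prov T (m + m + n)
       (And (ren \<theta> (\<lambda>k. if k < m then k else m + k)) (ren \<theta> (\<lambda>k. m + k)))
       (Conj (map (\<lambda>j. Eq (Var j) (Var (m + j))) [0..<m]))"
    using F by (simp add: functional_def)
  moreover have "(\<lambda>k. ?s (if k < m then k else m + k)) = app m w u"
    by (auto simp: app_def)
  then have "prov T N \<Gamma> (subst (And (ren \<theta> (\<lambda>k. if k < m then k else m + k)) (ren \<theta> (\<lambda>k. m + k))) ?s)"
    using 1 2 by (simp add: prov_And)
  ultimately have "prov T N \<Gamma> (subst (Conj (map (\<lambda>j. Eq (Var j) (Var (m + j))) [0..<m])) ?s)"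
    using prov_instance sc' by blast
  then show ?thesis using j by (simp add: prov_Conj)
qed

lemma functional_cong:
  assumes F: "functional T (n, \<phi>) (m, \<psi>) \<theta>" and eq: "prov T (m + n) \<theta> \<theta>'" "prov T (m + n) \<theta>' \<theta>"
    and w: "wff \<psi> m"
  shows "functional T (n, \<phi>) (m, \<psi>) \<theta>'"
proof (rule functionalI)
  show "wff \<phi> n" using functional_obj[OF F w] .
  show "wff \<theta>' (m + n)" using prov_wff[OF eq(1)] by simp
next
  fix N \<Gamma> w' u
  assume sc: "scoped m N w'" "scoped n N u" and "prov T N \<Gamma> (subst \<theta>' (app m w' u))"
  then have "prov T N \<Gamma> (subst \<theta> (app m w' u))" using eq prov_instance by blast
  then show "prov T N \<Gamma> (subst \<phi> u) \<and> prov T N \<Gamma> (subst \<psi> w')"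
    using functional_src[OF F] functional_tgt[OF F w] sc by blast
next
  fix N \<Gamma> u
  assume sc: "scoped n N u" and "prov T N \<Gamma> (subst \<phi> u)"
  then have 1: "prov T N \<Gamma> (subst ((Ex ^^ m) \<theta>) u)" using functional_total[OF F] by blast
  have wE: "wff (subst ((Ex ^^ m) \<theta>') u) N" using prov_wff[OF eq(1)] sc by (auto intro: wff_subst)
  show "prov T N \<Gamma> (subst ((Ex ^^ m) \<theta>') u)"
  proof (rule exE_block[OF 1 wE], unfold ren_subst)
    fix \<Gamma>'
    assume "prov T (m + N) \<Gamma>' (subst \<theta> (app m Var (shift m u)))"
    then have "prov T (m + N) \<Gamma>' (subst \<theta>' (app m Var (shift m u)))"
      by (rule prov_instance[OF eq(1), rotated]) (use sc in auto)
    then show "prov T (m + N) \<Gamma>' (subst ((Ex ^^ m) \<theta>') (shift m u))"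
      by (rule exI_block) (use prov_wff[OF eq(1)] sc in auto)
  qed
next
  fix N \<Gamma> w w' u j
  assume sc: "scoped m N w" "scoped m N w'" "scoped n N u" and "j < m"
    and 1: "prov T N \<Gamma> (subst \<theta>' (app m w u))" "prov T N \<Gamma> (subst \<theta>' (app m w' u))"
  have "prov T N \<Gamma> (subst \<theta> (app m w u))" "prov T N \<Gamma> (subst \<theta> (app m w' u))"
    using prov_instance[OF eq(2) scoped_app] sc 1 by blast+
  then show "prov T N \<Gamma> (Eq (w j) (w' j))"
    using functional_unique[OF F] sc \<open>j < m\<close> by blast
qed (fact w)

lemma wff_comp_form: "wff \<theta> (m + n) \<Longrightarrow> wff \<gamma> (l + m) \<Longrightarrow> wff (comp_form m l \<gamma> \<theta>) (l + n)"
  unfolding comp_form_def by (auto intro!: wff_ren)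

lemma app_comp1: "(\<lambda>k. app m w (app l y u) (if k < m then k else l + k)) = app m w u"
  by (rule ext) (auto simp: app_def intro!: arg_cong[where f = u])

lemma app_comp2: "k < l + m \<Longrightarrow> app m w (app l y u) (if k < l then m + k else k - l) = app l y w k"
  by (auto simp: app_def)

lemma comp_formI:
  assumes "prov T N \<Gamma> (subst \<theta> (app m w u))" "prov T N \<Gamma> (subst \<gamma> (app l y w))"
    and w: "wff \<theta> (m + n)" "wff \<gamma> (l + m)" and sc: "scoped n N u" "scoped m N w" "scoped l N y"
  shows "prov T N \<Gamma> (subst (comp_form m l \<gamma> \<theta>) (app l y u))"
  unfolding comp_form_def
proof (rule exI_block[where n = "l + n"])
  have 2: "prov T N \<Gamma> (subst \<gamma> (\<lambda>k. app m w (app l y u) (if k < l then m + k else k - l)))"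
    by (rule prov_agree[OF assms(2) w(2)]) (use sc app_comp2[of _ l m w y u] in auto)
  show "prov T N \<Gamma> (subst (And (ren \<theta> (\<lambda>k. if k < m then k else l + k))
      (ren \<gamma> (\<lambda>k. if k < l then m + k else k - l))) (app m w (app l y u)))"
    using assms(1) 2 by (simp add: prov_And app_comp1)
qed (use w sc in \<open>auto intro!: wff_ren\<close>)

lemma comp_formE:
  assumes 1: "prov T N \<Gamma> (subst (comp_form m l \<gamma> \<theta>) (app l y u))" and "wff \<psi> N"
    and w: "wff \<theta> (m + n)" "wff \<gamma> (l + m)" and sc: "scoped n N u" "scoped l N y"
    and step: "\<And>\<Gamma>'. wff \<Gamma>' (m + N) \<Longrightarrow>
      (\<And>\<chi>. prov T N \<Gamma> \<chi> \<Longrightarrow> prov T (m + N) \<Gamma>' (ren \<chi> (\<lambda>k. m + k))) \<Longrightarrow>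
      (\<And>\<chi> \<tau>. prov T N \<Gamma> (subst \<chi> \<tau>) \<Longrightarrow> prov T (m + N) \<Gamma>' (subst \<chi> (shift m \<tau>))) \<Longrightarrow>
      prov T (m + N) \<Gamma>' (subst \<theta> (app m Var (shift m u))) \<Longrightarrow>
      prov T (m + N) \<Gamma>' (subst \<gamma> (app l (shift m y) Var)) \<Longrightarrow> prov T (m + N) \<Gamma>' (ren \<psi> (\<lambda>k. m + k))"
  shows "prov T N \<Gamma> \<psi>"
proof (rule exE_block[OF 1[unfolded comp_form_def] \<open>wff \<psi> N\<close>])
  fix \<Gamma>'
  assume W: "wff \<Gamma>' (m + N)"
    "\<And>\<chi>. prov T N \<Gamma> \<chi> \<Longrightarrow> prov T (m + N) \<Gamma>' (ren \<chi> (\<lambda>k. m + k))"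
    "\<And>\<chi> \<tau>. prov T N \<Gamma> (subst \<chi> \<tau>) \<Longrightarrow> prov T (m + N) \<Gamma>' (subst \<chi> (shift m \<tau>))"
    and G: "prov T (m + N) \<Gamma>' (subst (And (ren \<theta> (\<lambda>k. if k < m then k else l + k))
      (ren \<gamma> (\<lambda>k. if k < l then m + k else k - l))) (app m Var (shift m (app l y u))))"
  have A: "prov T (m + N) \<Gamma>' (subst \<theta> (app m Var (shift m u)))"
    using G by (simp add: prov_And shift_app app_comp1)
  have "prov T (m + N) \<Gamma>' (subst \<gamma> (\<lambda>k. app m Var (app l (shift m y) (shift m u)) (if k < l then m + k else k - l)))"
    using G by (simp add: prov_And shift_app)
  then have B: "prov T (m + N) \<Gamma>' (subst \<gamma> (app l (shift m y) Var))"
  proof (rule prov_agree[OF _ w(2)])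
    have "scoped (l + m) (m + N) (app l (shift m y) Var)" using sc by auto
    then show "scoped (l + m) (m + N) (\<lambda>k. app m Var (app l (shift m y) (shift m u)) (if k < l then m + k else k - l))"
      unfolding scoped_def by (metis app_comp2)
  qed (rule app_comp2)
  show "prov T (m + N) \<Gamma>' (ren \<psi> (\<lambda>k. m + k))" using W A B by (rule step)
qed

lemma comp_form_mono:
  assumes "prov T (m + n) \<theta> \<theta>'" "prov T (l + m) \<gamma> \<gamma>'"
  shows "prov T (l + n) (comp_form m l \<gamma> \<theta>) (comp_form m l \<gamma>' \<theta>')"
proof (rule prov_relI)
  have w: "wff \<theta> (m + n)" "wff \<gamma> (l + m)" "wff \<theta>' (m + n)" "wff \<gamma>' (l + m)"
    using assms by (auto dest: prov_wff)
  show "wff (comp_form m l \<gamma> \<theta>) (l + n)" using w by (auto intro: wff_comp_form)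
  fix \<Gamma> y u N
  assume sc: "scoped l N y" "scoped n N u" and 1: "prov T N \<Gamma> (subst (comp_form m l \<gamma> \<theta>) (app l y u))"
  show "prov T N \<Gamma> (subst (comp_form m l \<gamma>' \<theta>') (app l y u))"
  proof (rule comp_formE[OF 1 _ w(1,2) sc(2,1)], unfold ren_subst shift_app)
    show "wff (subst (comp_form m l \<gamma>' \<theta>') (app l y u)) N"
      using w sc by (auto intro!: wff_subst[where n = "l + n"] wff_comp_form)
    fix \<Gamma>'
    assume A: "prov T (m + N) \<Gamma>' (subst \<theta> (app m Var (shift m u)))"
      and B: "prov T (m + N) \<Gamma>' (subst \<gamma> (app l (shift m y) Var))"
    have "prov T (m + N) \<Gamma>' (subst \<theta>' (app m Var (shift m u)))"
      by (rule prov_instance[OF assms(1) _ A]) (use sc in auto)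
    moreover have "prov T (m + N) \<Gamma>' (subst \<gamma>' (app l (shift m y) Var))"
      by (rule prov_instance[OF assms(2) _ B]) (use sc in auto)
    ultimately show "prov T (m + N) \<Gamma>' (subst (comp_form m l \<gamma>' \<theta>') (app l (shift m y) (shift m u)))"
      by (rule comp_formI) (use w sc in auto)
  qed
qed

text \<open>Totality passes to composites independently of single-valuedness, so the lemma also
  serves for the reversed relations by which functions are glued along a cover.\<close>

lemma comp_form_total:
  assumes 1: "prov T N \<Gamma> (subst ((Ex ^^ m) \<theta>) u)" and 2: "prov T (m + n) \<theta> \<psi>"
    and 3: "prov T m \<psi> ((Ex ^^ l) \<gamma>)" and sc: "scoped n N u"
  shows "prov T N \<Gamma> (subst ((Ex ^^ l) (comp_form m l \<gamma> \<theta>)) u)"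
proof -
  have w: "wff \<theta> (m + n)" "wff \<gamma> (l + m)" "wff \<psi> m"
    using prov_wff[OF 2] prov_wff[OF 3] by auto
  note wc = wff_comp_form[OF w(1,2)]
  let ?E = "(Ex ^^ l) (comp_form m l \<gamma> \<theta>)"
  have wE: "wff ?E n" using wc by simp
  show ?thesis
  proof (rule exE_block[OF 1], unfold ren_subst)
    show "wff (subst ?E u) N" using wE sc by (rule wff_subst)
    fix \<Gamma>'
    assume A: "prov T (m + N) \<Gamma>' (subst \<theta> (app m Var (shift m u)))"
    have "prov T (m + N) \<Gamma>' (subst \<psi> (app m Var (shift m u)))"
      by (rule prov_instance[OF 2 _ A]) (use sc in auto)
    then have "prov T (m + N) \<Gamma>' (subst \<psi> Var)"
      by (rule prov_agree[OF _ w(3)]) (auto simp: scoped_def)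
    then have B: "prov T (m + N) \<Gamma>' (subst ((Ex ^^ l) \<gamma>) Var)"
      by (rule prov_instance[OF 3, rotated]) auto
    show "prov T (m + N) \<Gamma>' (subst ?E (shift m u))"
    proof (rule exE_block[OF B], unfold ren_subst)
      show "wff (subst ?E (shift m u)) (m + N)" using wE sc by (auto intro: wff_subst)
      fix \<Gamma>''
      assume W: "\<And>\<chi> \<tau>. prov T (m + N) \<Gamma>' (subst \<chi> \<tau>) \<Longrightarrow> prov T (l + (m + N)) \<Gamma>'' (subst \<chi> (shift l \<tau>))"
        and C: "prov T (l + (m + N)) \<Gamma>'' (subst \<gamma> (app l Var (shift l Var)))"
      have "prov T (l + (m + N)) \<Gamma>'' (subst (comp_form m l \<gamma> \<theta>) (app l Var (shift l (shift m u))))"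
        by (rule comp_formI[OF W[OF A, unfolded shift_app] C]) (use w sc in auto)
      then show "prov T (l + (m + N)) \<Gamma>'' (subst ?E (shift l (shift m u)))"
        by (rule exI_block) (use wc sc in auto)
    qed
  qed
qed

lemma functional_comp:
  assumes F: "functional T (n, \<phi>) (m, \<psi>) \<theta>" and G: "functional T (m, \<psi>) (l, \<chi>) \<gamma>"
    and "wff \<chi> l"
  shows "functional T (n, \<phi>) (l, \<chi>) (comp_form m l \<gamma> \<theta>)"
proof (rule functionalI)
  have w: "wff \<theta> (m + n)" "wff \<gamma> (l + m)" "wff \<psi> m" "wff \<phi> n"
    using functional_wff[OF F] functional_wff[OF G] functional_obj[OF G \<open>wff \<chi> l\<close>]
      functional_obj[OF F functional_obj[OF G \<open>wff \<chi> l\<close>]] by auto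
  then show "wff \<phi> n" "wff (comp_form m l \<gamma> \<theta>) (l + n)" using wff_comp_form by auto
  {
    fix N \<Gamma> y u
    assume sc: "scoped l N y" "scoped n N u" and 1: "prov T N \<Gamma> (subst (comp_form m l \<gamma> \<theta>) (app l y u))"
    have "prov T N \<Gamma> (And (subst \<phi> u) (subst \<chi> y))"
    proof (rule comp_formE[OF 1 _ w(1,2) sc(2,1)])
      show "wff (And (subst \<phi> u) (subst \<chi> y)) N" using w sc \<open>wff \<chi> l\<close> by (auto intro: wff_subst)
      fix \<Gamma>'
      assume "prov T (m + N) \<Gamma>' (subst \<theta> (app m Var (shift m u)))"
        "prov T (m + N) \<Gamma>' (subst \<gamma> (app l (shift m y) Var))"
      then show "prov T (m + N) \<Gamma>' (ren (And (subst \<phi> u) (subst \<chi> y)) (\<lambda>k. m + k))"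
        using functional_src[OF F] functional_tgt[OF G] \<open>wff \<chi> l\<close> sc
        unfolding subst.simps ren_subst prov_And by (metis le_add1 scoped_Var' scoped_shift)
    qed
    then show "prov T N \<Gamma> (subst \<phi> u) \<and> prov T N \<Gamma> (subst \<chi> y)" by (simp add: prov_And)
  next
    fix N \<Gamma> u
    assume sc: "scoped n N u" and 1: "prov T N \<Gamma> (subst \<phi> u)"
    have "prov T m \<psi> ((Ex ^^ l) \<gamma>)" using G by (simp add: functional_def)
    from comp_form_total[OF functional_total[OF F 1 sc] functional_tgt0[OF F] this sc]
    show "prov T N \<Gamma> (subst ((Ex ^^ l) (comp_form m l \<gamma> \<theta>)) u)" .
  next
    fix N \<Gamma> y y' u j
    assume sc: "scoped l N y" "scoped l N y'" "scoped n N u" and "j < l"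
      and 1: "prov T N \<Gamma> (subst (comp_form m l \<gamma> \<theta>) (app l y u))"
      and 2: "prov T N \<Gamma> (subst (comp_form m l \<gamma> \<theta>) (app l y' u))"
    show "prov T N \<Gamma> (Eq (y j) (y' j))"
    proof (rule comp_formE[OF 1 _ w(1,2) sc(3,1)])
      show "wff (Eq (y j) (y' j)) N" using sc \<open>j < l\<close> by (auto simp: scoped_def)
      fix \<Gamma>1
      assume W1: "\<And>\<chi> \<tau>. prov T N \<Gamma> (subst \<chi> \<tau>) \<Longrightarrow> prov T (m + N) \<Gamma>1 (subst \<chi> (shift m \<tau>))"
        and A: "prov T (m + N) \<Gamma>1 (subst \<theta> (app m Var (shift m u)))"
          "prov T (m + N) \<Gamma>1 (subst \<gamma> (app l (shift m y) Var))"
      have 3: "prov T (m + N) \<Gamma>1 (subst (comp_form m l \<gamma> \<theta>) (app l (shift m y') (shift m u)))"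
        using W1[OF 2] by (simp add: shift_app)
      have "prov T (m + N) \<Gamma>1 (Eq (shift m y j) (shift m y' j))"
      proof (rule comp_formE[OF 3 _ w(1,2)])
        show "wff (Eq (shift m y j) (shift m y' j)) (m + N)"
          using sc \<open>j < l\<close> scoped_shift[of l N y m] scoped_shift[of l N y' m] by (auto simp: scoped_def)
        fix \<Gamma>2
        let ?N = "m + (m + N)"
        assume W2: "\<And>\<chi> \<tau>. prov T (m + N) \<Gamma>1 (subst \<chi> \<tau>) \<Longrightarrow> prov T ?N \<Gamma>2 (subst \<chi> (shift m \<tau>))"
          and B: "prov T ?N \<Gamma>2 (subst \<theta> (app m Var (shift m (shift m u))))"
            "prov T ?N \<Gamma>2 (subst \<gamma> (app l (shift m (shift m y')) Var))"
        note C = W2[OF A(1), unfolded shift_app] W2[OF A(2), unfolded shift_app]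
        have e: "prov T ?N \<Gamma>2 (Eq (shift m Var k) (Var k))" if "k < m" for k
          by (rule functional_unique[OF F C(1) B(1)]) (use sc that in auto)
        have "prov T ?N \<Gamma>2 (subst \<gamma> (app l (shift m (shift m y)) Var))"
        proof (rule prov_eq_subst[OF C(2) w(2)])
          show "prov T ?N \<Gamma>2 (Eq (app l (shift m (shift m y)) (shift m Var) j) (app l (shift m (shift m y)) Var j))"
            if "j < l + m" for j
          proof (cases "j < l")
            case True
            have "scoped l ?N (shift m (shift m y))" using sc by auto
            then show ?thesis using True prov_wff[OF B(1)] by (simp add: scoped_def prov_eq_refl)
          next
            case False
            then show ?thesis using that e[of "j - l"] by (simp add: app_def)
          qed
        qed (use sc in auto)
        then have "prov T ?N \<Gamma>2 (Eq (shift m (shift m y) j) (shift m (shift m y') j))"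
          using B(2) by (rule functional_unique[OF G]) (use sc \<open>j < l\<close> in auto)
        then show "prov T ?N \<Gamma>2 (ren (Eq (shift m y j) (shift m y' j)) (\<lambda>k. m + k))"
          by (simp add: shift_def)
      qed (use sc in auto)
      then show "prov T (m + N) \<Gamma>1 (ren (Eq (y j) (y' j)) (\<lambda>k. m + k))"
        by (simp add: shift_def)
    qed
  }
qed fact

text \<open>The arrow \<open>z \<mapsto> (z (r 0), \<dots>, z (r (n - 1)))\<close>. Identities, the
  projections of a refined cover and the legs of a pullback all have this form.\<close>

definition graph_form :: "nat \<Rightarrow> (nat \<Rightarrow> nat) \<Rightarrow> 'i form \<Rightarrow> 'i form" where
  "graph_form n r \<chi> = And (ren \<chi> (\<lambda>k. n + k)) (Conj (map (\<lambda>j. Eq (Var j) (Var (n + r j))) [0..<n]))"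

lemma prov_graph_form:
  "prov T M \<Gamma> (subst (graph_form n r \<chi>) (app n w z)) \<longleftrightarrow>
     prov T M \<Gamma> (subst \<chi> z) \<and> (\<forall>j<n. prov T M \<Gamma> (Eq (w j) (z (r j))))"
  unfolding graph_form_def by (auto simp: prov_And prov_Conj dest: prov_wff)

lemma wff_graph_form: "wff \<chi> N \<Longrightarrow> (\<And>j. j < n \<Longrightarrow> r j < N) \<Longrightarrow> wff (graph_form n r \<chi>) (n + N)"
  unfolding graph_form_def by (auto intro: wff_ren)

lemma functional_graph_form:
  assumes r: "\<And>j. j < n \<Longrightarrow> r j < N" and p: "prov T N \<chi> (ren \<phi> r)" and w: "wff \<phi> n"
  shows "functional T (N, \<chi>) (n, \<phi>) (graph_form n r \<chi>)"
proof (rule functionalI)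
  show wc: "wff \<chi> N" using prov_wff[OF p] by simp
  show wg: "wff (graph_form n r \<chi>) (n + N)" using wc r by (rule wff_graph_form)
  have scr: "scoped n M (\<lambda>j. z (r j))" if "scoped N M z" for M z
    using that r by (auto simp: scoped_def)
  fix M \<Gamma> z
  assume sz: "scoped N M z"
  {
    fix y
    assume sy: "scoped n M y"
      and "prov T M \<Gamma> (subst (graph_form n r \<chi>) (app n y z))"
    then have 1: "prov T M \<Gamma> (subst \<chi> z)" and 2: "\<And>j. j < n \<Longrightarrow> prov T M \<Gamma> (Eq (y j) (z (r j)))"
      by (auto simp: prov_graph_form)
    have "prov T M \<Gamma> (subst \<phi> (\<lambda>j. z (r j)))"
      using prov_instance[OF p sz 1] by simp
    then have "prov T M \<Gamma> (subst \<phi> y)"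
      by (rule prov_eq_subst[OF _ w scr[OF sz] sy]) (blast intro: prov_eq_sym 2)
    with 1 show "prov T M \<Gamma> (subst \<chi> z) \<and> prov T M \<Gamma> (subst \<phi> y)" ..
  next
    assume 1: "prov T M \<Gamma> (subst \<chi> z)"
    have "prov T M \<Gamma> (subst (graph_form n r \<chi>) (app n (\<lambda>j. z (r j)) z))"
      unfolding prov_graph_form using 1 scr[OF sz] prov_wff[OF 1]
      by (auto simp: scoped_def intro: prov_eq_refl)
    then show "prov T M \<Gamma> (subst ((Ex ^^ n) (graph_form n r \<chi>)) z)"
      by (rule exI_block[OF _ wg scr[OF sz] sz])
  next
    fix y y' j
    assume "prov T M \<Gamma> (subst (graph_form n r \<chi>) (app n y z))"
      "prov T M \<Gamma> (subst (graph_form n r \<chi>) (app n y' z))" "j < n"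
    then show "prov T M \<Gamma> (Eq (y j) (y' j))"
      unfolding prov_graph_form by (blast intro: prov_eq_sym prov_eq_trans)
  }
qed fact

text \<open>Since \<open>\<theta>\<close> is single-valued, its composite with the tuple
  \<open>r\<close> is any tuple \<open>\<rho>\<close> that \<open>\<chi>\<close> proves to be a
  value. This one equation makes squares of syntactic arrows commute.\<close>

lemma comp_graph_form:
  assumes F: "functional T (n, \<phi>) (m, \<psi>) \<theta>" and p: "prov T N \<chi> (ren \<theta> (app m \<rho> r))"
    and r: "\<And>j. j < n \<Longrightarrow> r j < N" and \<rho>: "\<And>j. j < m \<Longrightarrow> \<rho> j < N"
  shows "prov_class T (m + N) (comp_form n m \<theta> (graph_form n r \<chi>)) =
    prov_class T (m + N) (graph_form m \<rho> \<chi>)"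
proof (rule prov_class_eq)
  have wc: "wff \<chi> N" using prov_wff[OF p] by simp
  have wt: "wff \<theta> (m + n)" using functional_wff[OF F] .
  have wg: "wff (graph_form n r \<chi>) (n + N)" "wff (graph_form m \<rho> \<chi>) (m + N)"
    by (rule wff_graph_form[OF wc], fact)+
  have scr: "scoped n M (\<lambda>j. z (r j))" and sc\<rho>: "scoped m M (\<lambda>j. z (\<rho> j))" if "scoped N M z" for M z
    using that r \<rho> by (auto simp: scoped_def)
  have inst: "prov T M \<Gamma> (subst \<theta> (app m (\<lambda>j. z (\<rho> j)) (\<lambda>j. z (r j))))"
    if "prov T M \<Gamma> (subst \<chi> z)" "scoped N M z" for M \<Gamma> z
  proof -
    have "(\<lambda>k. z (app m \<rho> r k)) = app m (\<lambda>j. z (\<rho> j)) (\<lambda>j. z (r j))" by (auto simp: app_def)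
    then show ?thesis using prov_instance[OF p that(2,1)] by simp
  qed
  show "prov T (m + N) (comp_form n m \<theta> (graph_form n r \<chi>)) (graph_form m \<rho> \<chi>)"
  proof (rule prov_relI)
    show "wff (comp_form n m \<theta> (graph_form n r \<chi>)) (m + N)" using wt wg(1) by (intro wff_comp_form)
    fix \<Gamma> y z M
    assume sc: "scoped m M y" "scoped N M z"
      and 1: "prov T M \<Gamma> (subst (comp_form n m \<theta> (graph_form n r \<chi>)) (app m y z))"
    show "prov T M \<Gamma> (subst (graph_form m \<rho> \<chi>) (app m y z))"
    proof (rule comp_formE[OF 1 _ wg(1) wt sc(2,1)], unfold ren_subst shift_app)
      show "wff (subst (graph_form m \<rho> \<chi>) (app m y z)) M" using wg(2) sc by (auto intro: wff_subst)
      fix \<Gamma>'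
      let ?z = "shift n z" and ?y = "shift n y"
      assume "prov T (n + M) \<Gamma>' (subst (graph_form n r \<chi>) (app n Var ?z))"
        and A: "prov T (n + M) \<Gamma>' (subst \<theta> (app m ?y Var))"
      then have B: "prov T (n + M) \<Gamma>' (subst \<chi> ?z)" and C: "\<And>j. j < n \<Longrightarrow> prov T (n + M) \<Gamma>' (Eq (Var j) (?z (r j)))"
        by (auto simp: prov_graph_form)
      have sz: "scoped N (n + M) ?z" and sy: "scoped m (n + M) ?y" using sc by auto
      have "prov T (n + M) \<Gamma>' (subst \<theta> (app m ?y (\<lambda>j. ?z (r j))))"
      proof (rule prov_eq_subst[OF A wt])
        show "scoped (m + n) (n + M) (app m ?y Var)" using sy by auto
        show "scoped (m + n) (n + M) (app m ?y (\<lambda>j. ?z (r j)))" using sy scr[OF sz] by auto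
        show "prov T (n + M) \<Gamma>' (Eq (app m ?y Var j) (app m ?y (\<lambda>j. ?z (r j)) j))" if "j < m + n" for j
        proof (cases "j < m")
          case True
          then show ?thesis using sy prov_wff[OF A] by (simp add: scoped_def prov_eq_refl)
        next
          case False
          then show ?thesis using that C[of "j - m"] by (simp add: app_def)
        qed
      qed
      then have "prov T (n + M) \<Gamma>' (Eq (?y j) (?z (\<rho> j)))" if "j < m" for j
        using inst[OF B sz] by (rule functional_unique[OF F]) (use sy scr[OF sz] sc\<rho>[OF sz] that in auto)
      with B show "prov T (n + M) \<Gamma>' (subst (graph_form m \<rho> \<chi>) (app m ?y ?z))"
        by (simp add: prov_graph_form)
    qed
  qed
  show "prov T (m + N) (graph_form m \<rho> \<chi>) (comp_form n m \<theta> (graph_form n r \<chi>))"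
  proof (rule prov_relI)
    show "wff (graph_form m \<rho> \<chi>) (m + N)" by fact
    fix \<Gamma> y z M
    assume sc: "scoped m M y" "scoped N M z"
      and "prov T M \<Gamma> (subst (graph_form m \<rho> \<chi>) (app m y z))"
    then have B: "prov T M \<Gamma> (subst \<chi> z)" and C: "\<And>j. j < m \<Longrightarrow> prov T M \<Gamma> (Eq (y j) (z (\<rho> j)))"
      by (auto simp: prov_graph_form)
    have 2: "prov T M \<Gamma> (subst (graph_form n r \<chi>) (app n (\<lambda>j. z (r j)) z))"
      unfolding prov_graph_form using B scr[OF sc(2)] prov_wff[OF B]
      by (auto simp: scoped_def intro: prov_eq_refl)
    have "prov T M \<Gamma> (subst \<theta> (app m y (\<lambda>j. z (r j))))"
    proof (rule prov_eq_subst[OF inst[OF B sc(2)] wt])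
      show "prov T M \<Gamma> (Eq (app m (\<lambda>j. z (\<rho> j)) (\<lambda>j. z (r j)) j) (app m y (\<lambda>j. z (r j)) j))"
        if "j < m + n" for j
      proof (cases "j < m")
        case True
        then show ?thesis using C by (simp add: prov_eq_sym)
      next
        case False
        then show ?thesis using that scr[OF sc(2)] prov_wff[OF B]
          by (simp add: app_def scoped_def prov_eq_refl)
      qed
    qed (use sc scr[OF sc(2)] sc\<rho>[OF sc(2)] in auto)
    with 2 show "prov T M \<Gamma> (subst (comp_form n m \<theta> (graph_form n r \<chi>)) (app m y z))"
      by (rule comp_formI) (use wt wg sc scr[OF sc(2)] in auto)
  qed
qed

lemma id_form_graph_form:
  assumes "wff \<phi> n"
  shows "prov_class T (n + n) (id_form (n, \<phi>)) = prov_class T (n + n) (graph_form n (\<lambda>k. k) \<phi>)"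
proof (rule prov_class_eq)
  have F: "prov T M \<Gamma> (subst (id_form (n, \<phi>)) (app n y z)) \<longleftrightarrow>
    prov T M \<Gamma> (subst (graph_form n (\<lambda>k. k) \<phi>) (app n y z))"
    if sc: "scoped n M y" "scoped n M z" for M \<Gamma> y z
  proof -
    have "prov T M \<Gamma> (subst (id_form (n, \<phi>)) (app n y z)) \<longleftrightarrow>
      prov T M \<Gamma> (subst \<phi> (app n y z)) \<and> (\<forall>j<n. prov T M \<Gamma> (Eq (y j) (z j)))"
      unfolding id_form_def by (auto simp: prov_And prov_Conj dest: prov_wff)
    moreover have "scoped n M (app n y z)" using sc by (simp add: scoped_def)
    then have "prov T M \<Gamma> (subst \<phi> (app n y z)) \<longleftrightarrow> prov T M \<Gamma> (subst \<phi> y)"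
      using sc by (intro iffI) (erule prov_agree[OF _ assms]; simp)+
    moreover have "prov T M \<Gamma> (subst \<phi> y) \<longleftrightarrow> prov T M \<Gamma> (subst \<phi> z)"
      if "\<forall>j<n. prov T M \<Gamma> (Eq (y j) (z j))"
      using that sc by (meson assms prov_eq_subst prov_eq_sym)
    ultimately show ?thesis unfolding prov_graph_form by blast
  qed
  have w: "wff (id_form (n, \<phi>)) (n + n)"
    using assms wff_ren[OF assms, of "\<lambda>k. k" "n + n"] by (auto simp: id_form_def)
  show "prov T (n + n) (id_form (n, \<phi>)) (graph_form n (\<lambda>k. k) \<phi>)"
    using w by (rule prov_relI[rotated]) (simp add: F)
  show "prov T (n + n) (graph_form n (\<lambda>k. k) \<phi>) (id_form (n, \<phi>))"
    by (rule prov_relI) (simp_all add: F wff_graph_form assms)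
qed

text \<open>The reversed relation, of which the image formula is the domain.\<close>

definition swap_form :: "nat \<Rightarrow> nat \<Rightarrow> 'i form \<Rightarrow> 'i form" where
  "swap_form n m \<theta> = ren \<theta> (\<lambda>k. if k < m then n + k else k - m)"

lemma image_form_swap: "image_form n m \<theta> = (Ex ^^ n) (swap_form n m \<theta>)"
  by (simp add: image_form_def swap_form_def)

lemma wff_swap_form: "wff \<theta> (m + n) \<Longrightarrow> wff (swap_form n m \<theta>) (n + m)"
  unfolding swap_form_def by (rule wff_ren) auto

lemma image_formI:
  assumes "prov T N \<Gamma> (subst \<theta> (app m w u))" "wff \<theta> (m + n)" "scoped m N w" "scoped n N u"
  shows "prov T N \<Gamma> (subst (image_form n m \<theta>) w)"
  unfolding image_form_swap
proof (rule exI_block)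
  show "wff (swap_form n m \<theta>) (n + m)" using assms(2) by (rule wff_swap_form)
  show "prov T N \<Gamma> (subst (swap_form n m \<theta>) (app n u w))"
    unfolding swap_form_def subst_subst tsubst.simps
    by (rule prov_agree[OF assms(1,2) _ scoped_app[OF assms(3,4)]]) (auto simp: app_def)
qed fact+

lemma swap_form_src:
  assumes "functional T (n, \<phi>) (m, \<psi>) \<theta>"
  shows "prov T (n + m) (swap_form n m \<theta>) \<phi>"
proof -
  have "scoped (m + n) (n + m) (\<lambda>k. Var (if k < m then n + k else k - m))" by auto
  from prov_subst[OF functional_src0[OF assms] this] show ?thesis
    by (simp add: swap_form_def)
qed

text \<open>The graph of the function glued along a cover relates a point to the values that the
  \<open>\<gamma> i\<close> take on its preimages. Only totality is derived in the calculus;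
  single-valuedness will hold in the model.\<close>

lemma glue_total:
  assumes cover: "prov T m \<psi> (Disj I (\<lambda>i. image_form (n i) m (\<theta> i)))"
    and F: "\<And>i. i \<in> I \<Longrightarrow> functional T (n i, \<phi> i) (m, \<psi>) (\<theta> i)"
    and G: "\<And>i. i \<in> I \<Longrightarrow> prov T (n i) (\<phi> i) (Ex (\<gamma> i))"
  shows "prov T m \<psi> (Ex (Disj I (\<lambda>i. comp_form (n i) 1 (\<gamma> i) (swap_form (n i) m (\<theta> i)))))"
proof -
  let ?g = "\<lambda>i. comp_form (n i) 1 (\<gamma> i) (swap_form (n i) m (\<theta> i))"
  have wg: "wff (?g i) (Suc m)" if "i \<in> I" for i
    using wff_comp_form[OF wff_swap_form[OF functional_wff[OF F[OF that]]], of "\<gamma> i" 1]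
      prov_wff[OF G[OF that]] by simp
  show ?thesis
  proof (rule disjE[OF cover])
    show "wff (Ex (Disj I ?g)) m" using wg by simp
    fix i \<Gamma>
    assume "i \<in> I" and 1: "prov T m \<Gamma> (image_form (n i) m (\<theta> i))"
    have 2: "prov T m \<Gamma> (subst ((Ex ^^ n i) (swap_form (n i) m (\<theta> i))) Var)"
      using 1 by (simp add: image_form_swap)
    have "prov T m \<Gamma> (subst ((Ex ^^ 1) (?g i)) Var)"
      by (rule comp_form_total[OF 2 swap_form_src[OF F[OF \<open>i \<in> I\<close>]]])
        (use G[OF \<open>i \<in> I\<close>] in auto)
    then have "prov T m \<Gamma> (Ex (?g i))" by simp
    moreover have "prov T m (Ex (?g i)) (Ex (Disj I ?g))"
      by (rule ex_mono, rule disjI[where i = i]) (use wg \<open>i \<in> I\<close> in \<open>auto intro: prov.refl\<close>)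
    ultimately show "prov T m \<Gamma> (Ex (Disj I ?g))" by (rule prov.cut)
  qed
qed

text \<open>Adding the value of a total relation \<open>\<gamma>\<close> as a new variable, and then
  distinguishing the cases of a provable disjunction about it, covers the domain
  \<open>\<phi>\<close> by projections from the cases.\<close>

lemma split_cover:
  assumes 1: "prov T n \<phi> (Ex \<gamma>)" and 2: "prov T (Suc n) (And (ren \<phi> Suc) \<gamma>) (Disj I \<alpha>)"
  defines "\<delta> i \<equiv> And (And (ren \<phi> Suc) \<gamma>) (\<alpha> i)"
  shows "prov T n \<phi> (Disj I (\<lambda>i. image_form (Suc n) n (graph_form n Suc (\<delta> i))))"
    and "\<And>i. i \<in> I \<Longrightarrow> functional T (Suc n, \<delta> i) (n, \<phi>) (graph_form n Suc (\<delta> i))"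
    and "\<And>i. i \<in> I \<Longrightarrow> wff (\<delta> i) (Suc n)"
proof -
  have w: "wff \<phi> n" "wff \<gamma> (Suc n)" "\<And>i. i \<in> I \<Longrightarrow> wff (\<alpha> i) (Suc n)"
    using prov_wff[OF 1] prov_wff[OF 2] by auto
  show wd: "wff (\<delta> i) (Suc n)" if "i \<in> I" for i using w that by (auto simp: \<delta>_def intro: wff_ren)
  have wg: "wff (graph_form n Suc (\<delta> i)) (n + Suc n)" if "i \<in> I" for i
    using wd[OF that] by (rule wff_graph_form) simp
  have wi: "wff (image_form (Suc n) n (graph_form n Suc (\<delta> i))) n" if "i \<in> I" for i
    using wff_swap_form[OF wg[OF that]] unfolding image_form_swap by (simp add: add.commute)
  show "functional T (Suc n, \<delta> i) (n, \<phi>) (graph_form n Suc (\<delta> i))" if "i \<in> I" for i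
  proof (rule functional_graph_form)
    show "prov T (Suc n) (\<delta> i) (ren \<phi> Suc)"
      using prov.refl[OF wd[OF that], of T] unfolding \<delta>_def prov_And by simp
  qed (use w in auto)
  let ?D = "Disj I (\<lambda>i. image_form (Suc n) n (graph_form n Suc (\<delta> i)))"
  have wD: "wff ?D n" using wi by simp
  show "prov T n \<phi> ?D"
  proof (rule ex_elim[OF 1 _ wD])
    let ?G = "And (ren \<phi> Suc) \<gamma>"
    have wG: "wff ?G (Suc n)" using w by (auto intro: wff_ren)
    show "prov T (Suc n) ?G (ren ?D Suc)"
    proof (rule disjE[OF 2])
      show "wff (ren ?D Suc) (Suc n)" using wD by (rule wff_ren) simp
      fix i \<Gamma>
      assume i: "i \<in> I" and W: "\<And>\<chi>. prov T (Suc n) ?G \<chi> \<Longrightarrow> prov T (Suc n) \<Gamma> \<chi>"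
        and A: "prov T (Suc n) \<Gamma> (\<alpha> i)"
      have "prov T (Suc n) \<Gamma> (subst (\<delta> i) Var)"
        using A W[OF prov.refl[OF wG]] by (simp add: \<delta>_def prov_And)
      then have "prov T (Suc n) \<Gamma> (subst (graph_form n Suc (\<delta> i)) (app n (\<lambda>k. Var (Suc k)) Var))"
        unfolding prov_graph_form using prov_wff[OF A] by (auto intro: prov_eq_refl)
      then have "prov T (Suc n) \<Gamma> (subst (image_form (Suc n) n (graph_form n Suc (\<delta> i))) (\<lambda>k. Var (Suc k)))"
        by (rule image_formI[OF _ wg[OF i]]) auto
      then show "prov T (Suc n) \<Gamma> (ren ?D Suc)"
        unfolding subst.simps
        by (rule disjI[where i = i and f = "\<lambda>i. ren (image_form (Suc n) n (graph_form n Suc (\<delta> i))) Suc"])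
          (use i wi in \<open>auto intro: wff_ren\<close>)
    qed
  qed
qed

section \<open>The standard model on the unit interval\<close>

primrec tval :: "mvterm \<Rightarrow> (nat \<Rightarrow> real) \<Rightarrow> real" where
  "tval (Var k) = (\<lambda>v. v k)"
| "tval Zero = (\<lambda>v. 0)"
| "tval (Neg t) = (\<lambda>v. 1 - tval t v)"
| "tval (Plus s t) = (\<lambda>v. min 1 (tval s v + tval t v))"

primrec sat :: "'i form \<Rightarrow> (nat \<Rightarrow> real) \<Rightarrow> bool" where
  "sat (Eq s t) = (\<lambda>v. tval s v = tval t v)"
| "sat Top = (\<lambda>v. True)"
| "sat (And \<phi> \<psi>) = (\<lambda>v. sat \<phi> v \<and> sat \<psi> v)"
| "sat (Ex \<phi>) = (\<lambda>v. \<exists>x\<in>{0..1}. sat \<phi> (case_nat x v))"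
| "sat (Disj I f) = (\<lambda>v. \<exists>i\<in>I. sat (f i) v)"

definition cube :: "(nat \<Rightarrow> real) set" where
  "cube = {v. \<forall>k. 0 \<le> v k \<and> v k \<le> 1}"

text \<open>Finite tuples are padded with zeros, so that a point of a context of \<open>n\<close>
  variables is a unique total valuation.\<close>

definition fcube :: "nat \<Rightarrow> (nat \<Rightarrow> real) set" where
  "fcube n = {v \<in> cube. \<forall>k\<ge>n. v k = 0}"

lemma cubeD: "v \<in> cube \<Longrightarrow> 0 \<le> v k" "v \<in> cube \<Longrightarrow> v k \<le> 1"
  by (auto simp: cube_def)

lemma fcube_cube: "v \<in> fcube n \<Longrightarrow> v \<in> cube"
  by (simp add: fcube_def)

lemma tval_range: "v \<in> cube \<Longrightarrow> 0 \<le> tval t v \<and> tval t v \<le> 1"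
  by (induction t) (auto simp: cubeD)

lemma cube_tval: "v \<in> cube \<Longrightarrow> (\<lambda>k. tval (\<sigma> k) v) \<in> cube"
  using tval_range by (auto simp: cube_def)

lemma cube_case_nat: "x \<in> {0..1} \<Longrightarrow> v \<in> cube \<Longrightarrow> case_nat x v \<in> cube"
  by (auto simp: cube_def split: nat.splits)

lemma cube_comp: "v \<in> cube \<Longrightarrow> (\<lambda>k. v (r k)) \<in> cube"
  by (auto simp: cube_def)

lemma tval_tsubst [simp]: "tval (tsubst t \<sigma>) v = tval t (\<lambda>k. tval (\<sigma> k) v)"
  by (induction t) auto

lemma tval_lift: "(\<lambda>k. tval (lift \<sigma> k) (case_nat x v)) = case_nat x (\<lambda>k. tval (\<sigma> k) v)"
  by (rule ext) (simp add: lift_def split: nat.split)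

lemma sat_subst [simp]: "sat (subst \<phi> \<sigma>) v = sat \<phi> (\<lambda>k. tval (\<sigma> k) v)"
  by (induction \<phi> arbitrary: \<sigma> v) (auto simp: tval_lift)

lemma tval_cong: "tvars t \<subseteq> {..<n} \<Longrightarrow> (\<And>k. k < n \<Longrightarrow> v k = w k) \<Longrightarrow> tval t v = tval t w"
  by (induction t) auto

lemma sat_cong: "wff \<phi> n \<Longrightarrow> (\<And>k. k < n \<Longrightarrow> v k = w k) \<Longrightarrow> sat \<phi> v = sat \<phi> w"
proof (induction \<phi> arbitrary: n v w)
  case (Eq s t)
  then show ?case using tval_cong[of s n v w] tval_cong[of t n v w] by simp
next
  case (And \<phi> \<psi>)
  then show ?case using And.IH(1)[of n v w] And.IH(2)[of n v w] by simp
next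
  case (Ex \<phi>)
  have "sat \<phi> (case_nat x v) = sat \<phi> (case_nat x w)" for x
    using Ex.prems by (intro Ex.IH[of "Suc n"]) (auto split: nat.split)
  then show ?case by simp
next
  case (Disj I f)
  have "sat (f i) v = sat (f i) w" if "i \<in> I" for i
    using Disj.prems that by (intro Disj.IH[of "f i" n]) auto
  then show ?case by simp
qed simp

lemma sat_Conj [simp]: "sat (Conj \<phi>s) v \<longleftrightarrow> (\<forall>\<phi> \<in> set \<phi>s. sat \<phi> v)"
  by (induction \<phi>s) (auto simp: Conj_def)

lemma tval_multiple: "v \<in> cube \<Longrightarrow> tval (multiple k t) v = min 1 (real k * tval t v)"
proof (induction k t rule: multiple.induct)
  case (3 k t)
  then show ?case using tval_range[OF 3(2), of t] by (auto simp: min_def algebra_simps)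
qed (auto simp: tval_range)

lemma sat_Ex_pow: "sat ((Ex ^^ m) \<phi>) v \<longleftrightarrow> (\<exists>w \<in> fcube m. sat \<phi> (app m w v))"
proof (induction m arbitrary: v)
  case 0
  have "(\<lambda>k. 0) \<in> fcube 0" by (auto simp: fcube_def cube_def)
  then show ?case by (auto simp: app_def)
next
  case (Suc m)
  have 1: "app (Suc m) (w(m := x)) v = app m w (case_nat x v)" for w x
    by (rule ext) (auto simp: app_def not_less less_Suc_eq split: nat.split
        intro: arg_cong[where f = v] dest: le_antisym)
  show ?case
  proof
    assume "sat ((Ex ^^ Suc m) \<phi>) v"
    then obtain x w where x: "x \<in> {0..1}" and w: "w \<in> fcube m" and s: "sat \<phi> (app m w (case_nat x v))"
      using Suc by auto
    have "w(m := x) \<in> fcube (Suc m)" using x w by (auto simp: fcube_def cube_def)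
    then show "\<exists>w \<in> fcube (Suc m). sat \<phi> (app (Suc m) w v)" using s 1 by metis
  next
    assume "\<exists>w \<in> fcube (Suc m). sat \<phi> (app (Suc m) w v)"
    then obtain w where w: "w \<in> fcube (Suc m)" and s: "sat \<phi> (app (Suc m) w v)" by blast
    have "app (Suc m) w v = app m (w(m := 0)) (case_nat (w m) v)"
      using 1[of "w(m := 0)" "w m"] by simp
    moreover have "w(m := 0) \<in> fcube m" "w m \<in> {0..1}"
      using w by (auto simp: fcube_def cube_def Suc_le_eq)
    ultimately show "sat ((Ex ^^ Suc m) \<phi>) v" using s Suc by auto
  qed
qed

lemma MV_sound:
  assumes "(n, \<phi>, \<psi>) \<in> MV" "v \<in> cube" shows "sat \<psi> v"
  using assms(1) cubeD[OF assms(2), of 0] cubeD[OF assms(2), of 1] cubeD[OF assms(2), of 2]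
  by (auto simp: MV_def Let_def min_def)

text \<open>In the unit interval the locality axiom holds with \<open>k = 2\<close>: one of
  \<open>x\<close> and \<open>1 - x\<close> is at least one half.\<close>

lemma Loc_sound:
  assumes "(n, \<phi>, \<psi>) \<in> Loc" "v \<in> cube" "sat \<phi> v" shows "sat \<psi> v"
proof -
  consider "(n, \<phi>, \<psi>) \<in> MV" | "\<psi> = Disj (Inl ` {1..})
        (\<lambda>i. Or (Eq (multiple (projl i) (Var 0)) One) (Eq (multiple (projl i) (Neg (Var 0))) One))"
    | "\<phi> = Eq Zero One"
    using assms(1) by (auto simp: Loc_def)
  then show ?thesis
  proof cases
    case 1
    then show ?thesis using MV_sound assms by blast
  next
    case 2
    have "2 \<in> {1::nat..}" by simp
    moreover have "tval (multiple 2 (Var 0)) v = 1 \<or> tval (multiple 2 (Neg (Var 0))) v = 1"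
      using assms(2) by (auto simp: tval_multiple)
    ultimately show ?thesis unfolding 2 Or_def by (force simp: image_iff)
  next
    case 3
    then show ?thesis using assms(3) by simp
  qed
qed

lemma tval_case_nat_Var: "(\<lambda>k. tval (case_nat t Var k) v) = case_nat (tval t v) v"
  by (auto split: nat.split)

lemma soundness: "prov Loc n \<phi> \<psi> \<Longrightarrow> v \<in> cube \<Longrightarrow> sat \<phi> v \<Longrightarrow> sat \<psi> v"
proof (induction arbitrary: v rule: prov.induct)
  case (axm n \<phi> \<psi>)
  then show ?case using Loc_sound by blast
next
  case (substitution n \<phi> \<psi> \<sigma> m)
  then show ?case by (simp add: cube_tval)
next
  case (ex_left n \<phi> \<psi>)
  then show ?case using cube_case_nat by fastforce
next
  case (ex_right n \<phi> \<psi>)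
  have "case_nat (v 0) (\<lambda>k. v (Suc k)) = v" by (auto split: nat.split)
  then have "sat (Ex \<phi>) (\<lambda>k. v (Suc k))" using ex_right.prems by (auto simp: cubeD intro!: bexI[of _ "v 0"])
  then show ?case using ex_right.IH[of "\<lambda>k. v (Suc k)"] ex_right.prems cube_comp by simp
qed (auto simp: tval_case_nat_Var)

section \<open>Perturbation along an additive function\<close>

text \<open>For an additive \<open>L\<close> with \<open>L 1 = 0\<close>, small perturbations
  \<open>v + \<epsilon> L(v)\<close> preserve every geometric formula. At a kink of the truncated
  sum, \<open>x + y = 1\<close> gives \<open>L x + L y = 0\<close>, so the perturbed sum stays
  exactly at the kink; elsewhere the order relations are stable for small \<open>\<epsilon>\<close>.
  An irrational coordinate \<open>a\<close> is really moved if \<open>L a = 1\<close>, which a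
  rational basis provides.\<close>

definition perturb :: "(real \<Rightarrow> real) \<Rightarrow> real \<Rightarrow> (nat \<Rightarrow> real) \<Rightarrow> nat \<Rightarrow> real" where
  "perturb L \<epsilon> v = (\<lambda>k. v k + \<epsilon> * L (v k))"

context
  fixes L :: "real \<Rightarrow> real"
  assumes add: "L (x + y) = L x + L y" and one: "L 1 = 0"
begin

lemma L_zero: "L 0 = 0" using add[of 0 0] by simp

lemma L_compl: "L (1 - x) = - L x" using add[of "1 - x" x] one by simp

lemma tendsto_perturb: "((\<lambda>\<epsilon>. x + \<epsilon> * y) \<longlongrightarrow> (x::real)) (at_right 0)"
  by (rule tendsto_eq_intros refl | simp)+

lemma perturb_range:
  assumes "0 \<le> x" "x \<le> 1"
  shows "eventually (\<lambda>\<epsilon>. 0 \<le> x + \<epsilon> * L x \<and> x + \<epsilon> * L x \<le> 1) (at_right 0)"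
proof (cases "x = 0 \<or> x = 1")
  case True
  then show ?thesis using L_zero one by auto
next
  case False
  then have "0 < x" "x < 1" using assms by auto
  then have "eventually (\<lambda>\<epsilon>. 0 < x + \<epsilon> * L x) (at_right 0)" "eventually (\<lambda>\<epsilon>. x + \<epsilon> * L x < 1) (at_right 0)"
    using order_tendstoD[OF tendsto_perturb] by blast+
  then show ?thesis by eventually_elim simp
qed

lemma perturb_fcube:
  assumes "v \<in> fcube n"
  shows "eventually (\<lambda>\<epsilon>. perturb L \<epsilon> v \<in> fcube n) (at_right 0)"
proof -
  have "eventually (\<lambda>\<epsilon>. \<forall>k\<in>{..<n}. 0 \<le> v k + \<epsilon> * L (v k) \<and> v k + \<epsilon> * L (v k) \<le> 1) (at_right 0)"
    using assms by (intro eventually_ball_finite) (auto intro!: perturb_range simp: fcube_def cubeD)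
  then show ?thesis
  proof eventually_elim
    case (elim \<epsilon>)
    have "0 \<le> perturb L \<epsilon> v k \<and> perturb L \<epsilon> v k \<le> 1" for k
      using elim assms L_zero by (cases "k < n") (auto simp: perturb_def fcube_def)
    then show ?case using assms L_zero by (auto simp: fcube_def cube_def perturb_def)
  qed
qed

lemma perturb_tval:
  assumes "v \<in> fcube n"
  shows "eventually (\<lambda>\<epsilon>. tval t (perturb L \<epsilon> v) = tval t v + \<epsilon> * L (tval t v)) (at_right 0)"
proof (induction t)
  case (Plus s t)
  let ?x = "tval s v" and ?y = "tval t v"
  let ?z = "?x + ?y"
  have *: "?x + \<epsilon> * L ?x + (?y + \<epsilon> * L ?y) = ?z + \<epsilon> * L ?z" for \<epsilon>
    by (simp add: add algebra_simps)
  consider "?z < 1" | "?z = 1" | "?z > 1" by linarith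
  then have "eventually (\<lambda>\<epsilon>. min 1 (?z + \<epsilon> * L ?z) = min 1 ?z + \<epsilon> * L (min 1 ?z)) (at_right 0)"
  proof cases
    case 1
    then have "eventually (\<lambda>\<epsilon>. ?z + \<epsilon> * L ?z < 1) (at_right 0)"
      using order_tendstoD[OF tendsto_perturb] by blast
    then show ?thesis by eventually_elim (use 1 in auto)
  next
    case 2
    then show ?thesis by (simp add: one)
  next
    case 3
    then have "eventually (\<lambda>\<epsilon>. ?z + \<epsilon> * L ?z > 1) (at_right 0)"
      using order_tendstoD[OF tendsto_perturb] by blast
    then show ?thesis by eventually_elim (use 3 one in auto)
  qed
  with Plus show ?case by eventually_elim (simp add: *)
qed (auto simp: perturb_def L_zero L_compl elim: eventually_mono)

lemma perturb_sat:
  assumes "v \<in> fcube n" "sat \<phi> v"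
  shows "eventually (\<lambda>\<epsilon>. sat \<phi> (perturb L \<epsilon> v)) (at_right 0)"
  using assms
proof (induction \<phi> arbitrary: v n)
  case (Eq s t)
  then show ?case
    using perturb_tval[OF Eq.prems(1), of s] perturb_tval[OF Eq.prems(1), of t]
    by (auto elim: eventually_elim2)
next
  case (And \<phi> \<psi>)
  then show ?case by (auto intro: eventually_conj)
next
  case (Ex \<phi>)
  then obtain x where x: "x \<in> {0..1}" "sat \<phi> (case_nat x v)" by auto
  then have "case_nat x v \<in> fcube (Suc n)" using Ex.prems
    by (auto simp: fcube_def cube_case_nat split: nat.split)
  then have "eventually (\<lambda>\<epsilon>. sat \<phi> (perturb L \<epsilon> (case_nat x v))) (at_right 0)"
    using Ex.IH x by blast
  moreover have "perturb L \<epsilon> (case_nat x v) = case_nat (x + \<epsilon> * L x) (perturb L \<epsilon> v)" for \<epsilon>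
    by (auto simp: perturb_def split: nat.split)
  moreover have "eventually (\<lambda>\<epsilon>. x + \<epsilon> * L x \<in> {0..1}) (at_right 0)"
    using perturb_range x by simp
  ultimately have "eventually (\<lambda>\<epsilon>. sat \<phi> (case_nat (x + \<epsilon> * L x) (perturb L \<epsilon> v)) \<and>
      x + \<epsilon> * L x \<in> {0..1}) (at_right 0)"
    by (simp add: eventually_conj)
  then show ?case by eventually_elim auto
next
  case (Disj I f)
  then obtain i where "i \<in> I" "sat (f i) v" by auto
  then have "eventually (\<lambda>\<epsilon>. sat (f i) (perturb L \<epsilon> v)) (at_right 0)" using Disj by auto
  then show ?case using \<open>i \<in> I\<close> by (auto elim: eventually_mono)
qed auto

end

lemma irrational_ex: "\<exists>a::real. 0 < a \<and> a < 1 \<and> a \<notin> \<rat>"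
proof (intro exI conjI)
  show "0 < 1 / sqrt (2::real)" "1 / sqrt (2::real) < 1" by auto
  show "1 / sqrt (2::real) \<notin> \<rat>"
  proof
    assume "1 / sqrt (2::real) \<in> \<rat>"
    then obtain m n :: nat where n: "n \<noteq> 0" and eq: "\<bar>1 / sqrt (2::real)\<bar> = real m / real n" and co: "coprime m n"
      by (rule Rats_abs_nat_div_natE)
    have "(1 / sqrt (2::real))^2 = (real m / real n)^2" using eq by (metis power2_abs)
    then have "real (n^2) = real (2 * m^2)" using n by (simp add: field_simps power_divide)
    then have nm: "n^2 = 2 * m^2" by (simp only: of_nat_eq_iff)
    then have "even n" by (metis dvd_triv_left even_power pos2)
    then obtain k where "n = 2 * k" by blast
    with nm have "m^2 = 2 * k^2" by (simp add: power_mult_distrib)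
    then have "even m" by (metis dvd_triv_left even_power pos2)
    with \<open>even n\<close> co show False by (metis coprime_common_divisor odd_one)
  qed
qed

lemma additive_ex:
  assumes "(a::real) \<notin> \<rat>"
  shows "\<exists>L::real \<Rightarrow> real. (\<forall>x y. L (x + y) = L x + L y) \<and> L 1 = 0 \<and> L a = 1"
proof -
  let ?s = "\<lambda>(q::rat) (x::real). of_rat q * x"
  interpret V: vector_space ?s
    by standard (auto simp: algebra_simps of_rat_add of_rat_mult)
  interpret VP: vector_space_pair ?s ?s ..
  have "a \<notin> V.span {1}"
    using assms by (auto simp: V.span_singleton Rats_def)
  then have "V.independent {a, 1}"
    by (simp add: V.independent_insert)
  from VP.linear_independent_extend[OF this, of "\<lambda>x. if x = a then 1 else 0"]
  obtain L where L: "Vector_Spaces.linear ?s ?s L" "\<forall>x\<in>{a, 1}. L x = (if x = a then 1 else 0)"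
    by auto
  interpret L: Vector_Spaces.linear ?s ?s L by fact
  have "a \<noteq> 1" using assms by auto
  then show ?thesis using L L.add by auto
qed

section \<open>Separation of points by terms\<close>

text \<open>The maps \<open>x \<mapsto> min 1 (2x)\<close> and \<open>x \<mapsto> max 0 (2x -
  1)\<close> double the distance of two points that lie in the same half of the interval. After
  finitely many steps the points lie on different sides of one half, unless they have become 0 and
  1; then the second map sends the smaller one to 0, and a multiple sends the other to 1.\<close>

lemma separating_term_aux:
  assumes "tvars s \<subseteq> {0}" and "v \<in> cube" "w \<in> cube"
    and "tval s v < tval s w" "2 ^ N * (tval s w - tval s v) \<ge> 1"
  shows "\<exists>t. tvars t \<subseteq> {0} \<and> tval t v = 0 \<and> tval t w = 1"
  using assms(1,4,5)
proof (induction N arbitrary: s)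
  case 0
  then have "tval s v = 0" "tval s w = 1"
    using tval_range[OF assms(2), of s] tval_range[OF assms(3), of s] by auto
  with 0 show ?case by blast
next
  case (Suc N)
  let ?a = "tval s v" and ?b = "tval s w" and ?p = "Plus s s" and ?m = "Neg (Plus (Neg s) (Neg s))"
  note r = tval_range[OF assms(2), of s] tval_range[OF assms(3), of s]
  consider "?b \<le> 1/2" | "?a \<ge> 1/2" | "?a < 1/2" "?b > 1/2" by linarith
  then show ?case
  proof cases
    case 1
    then have "tval ?p v = 2 * ?a" "tval ?p w = 2 * ?b" using r Suc.prems by auto
    then show ?thesis using Suc.IH[of ?p] Suc.prems by (simp add: algebra_simps)
  next
    case 2
    then have "tval ?m v = 2 * ?a - 1" "tval ?m w = 2 * ?b - 1" using r Suc.prems by auto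
    then show ?thesis using Suc.IH[of ?m] Suc.prems by (simp add: algebra_simps)
  next
    case 3
    then have m: "tval ?m v = 0" "tval ?m w > 0" by auto
    then obtain k where k: "1 < real k * tval ?m w" using reals_Archimedean3 by blast
    have "tval (multiple k ?m) v = 0" "tval (multiple k ?m) w = 1"
      using k m by (simp_all add: tval_multiple assms del: tval.simps)
    moreover have "tvars (multiple k t) \<subseteq> tvars t" for t
      by (induction k t rule: multiple.induct) auto
    then have "tvars (multiple k ?m) \<subseteq> {0}" using Suc.prems(1) by fastforce
    ultimately show ?thesis by blast
  qed
qed

lemma separating_term:
  assumes "x \<in> {0..1}" "y \<in> {0..1}" "x \<noteq> y"
  shows "\<exists>t. tvars t \<subseteq> {0} \<and> (\<forall>v. v 0 = x \<longrightarrow> tval t v = 0) \<and> (\<forall>v. v 0 = y \<longrightarrow> tval t v = 1)"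
proof -
  let ?v = "\<lambda>x k. if k = (0::nat) then x else (0::real)"
  have cube: "?v x \<in> cube" "?v y \<in> cube" using assms by (auto simp: cube_def)
  have "\<exists>t. tvars t \<subseteq> {0} \<and> tval t (?v x) = 0 \<and> tval t (?v y) = 1"
  proof (cases "x < y")
    case True
    obtain N where "1 / (y - x) < 2 ^ N" using real_arch_pow[of 2 "1 / (y - x)"] by auto
    then have "2 ^ N * (y - x) \<ge> 1" using True by (simp add: field_simps)
    then show ?thesis using separating_term_aux[of "Var 0" "?v x" "?v y" N] cube True by simp
  next
    case False
    then have l: "y < x" using assms by simp
    obtain N where "1 / (x - y) < 2 ^ N" using real_arch_pow[of 2 "1 / (x - y)"] by auto
    then have "2 ^ N * (x - y) \<ge> 1" using l by (simp add: field_simps)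
    then obtain t where "tvars t \<subseteq> {0}" "tval t (?v y) = 0" "tval t (?v x) = 1"
      using separating_term_aux[of "Var 0" "?v y" "?v x" N] cube l by auto
    then show ?thesis by (intro exI[of _ "Neg t"]) auto
  qed
  then obtain t where t: "tvars t \<subseteq> {0}" "tval t (?v x) = 0" "tval t (?v y) = 1" by blast
  have "tval t v = tval t (?v (v 0))" for v
    using t(1) by (intro tval_cong[of t 1]) auto
  with t show ?thesis by metis
qed

section \<open>Prime generation and equivalences of categories\<close>

text \<open>The part of the structure of a category on which presheaves and natural transformations
  depend. For the syntactic category it amounts to deriving identities and composites in the
  calculus.\<close>

locale precategory =
  fixes C :: "('o, 'a) cat"
  assumes pre_Dom [simp]: "f \<in> Arr C \<Longrightarrow> Dom C f \<in> Obj C"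
    and pre_Cod [simp]: "f \<in> Arr C \<Longrightarrow> Cod C f \<in> Obj C"
    and pre_Ident [simp]: "a \<in> Obj C \<Longrightarrow> Ident C a \<in> Arr C"
    and pre_Dom_Ident [simp]: "a \<in> Obj C \<Longrightarrow> Dom C (Ident C a) = a"
    and pre_Cod_Ident [simp]: "a \<in> Obj C \<Longrightarrow> Cod C (Ident C a) = a"
    and pre_Comp [simp]: "\<lbrakk>f \<in> Arr C; g \<in> Arr C; Cod C f = Dom C g\<rbrakk> \<Longrightarrow> Comp C g f \<in> Arr C"
    and pre_Dom_Comp [simp]: "\<lbrakk>f \<in> Arr C; g \<in> Arr C; Cod C f = Dom C g\<rbrakk> \<Longrightarrow> Dom C (Comp C g f) = Dom C f"
    and pre_Cod_Comp [simp]: "\<lbrakk>f \<in> Arr C; g \<in> Arr C; Cod C f = Dom C g\<rbrakk> \<Longrightarrow> Cod C (Comp C g f) = Cod C g"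

sublocale category \<subseteq> precategory
  by unfold_locales
    (simp_all add: Dom_in Cod_in Ident_in Dom_Ident Cod_Ident Comp_in Dom_Comp Cod_Comp)

definition hom :: "('o, 'a) cat \<Rightarrow> 'o \<Rightarrow> 'o \<Rightarrow> 'a set" where
  "hom C a b = {f \<in> Arr C. Dom C f = a \<and> Cod C f = b}"

definition monic :: "('o, 'a) cat \<Rightarrow> 'a \<Rightarrow> bool" where
  "monic C n \<longleftrightarrow> (\<forall>u\<in>Arr C. \<forall>v\<in>Arr C. Dom C u = Dom C v \<and> Cod C u = Dom C n \<and> Cod C v = Dom C n \<and>
     Comp C n u = Comp C n v \<longrightarrow> u = v)"

definition split_epi :: "('o, 'a) cat \<Rightarrow> 'a \<Rightarrow> bool" where
  "split_epi C n \<longleftrightarrow> (\<exists>s \<in> hom C (Cod C n) (Dom C n). Comp C n s = Ident C (Cod C n))"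

definition factors :: "('o, 'a) cat \<Rightarrow> 'a \<Rightarrow> 'a \<Rightarrow> bool" where
  "factors C m n \<longleftrightarrow> (\<exists>r \<in> hom C (Dom C m) (Dom C n). Comp C n r = m)"

text \<open>The property that tells presheaf toposes apart. The arrow \<open>n\<close> is a proper
  subobject of \<open>X\<close>; the arrow \<open>m\<close> stands for an element of
  \<open>X\<close> outside \<open>n\<close>, and the pair \<open>p, q\<close> detects membership of
  this element: an arrow into \<open>X\<close> either hits it, and then \<open>m\<close> factors
  through that arrow, or is equalized by \<open>p\<close> and \<open>q\<close>. Since \<open>p
  \<noteq> q\<close>, arrows that jointly determine arrows out of \<open>X\<close> cannot all miss
  the element, so \<open>m\<close> factors through one member of each cover of \<open>X\<close>.
  Stated in terms of arrows only, the property is visibly invariant under equivalence.\<close>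

definition prime_generated :: "('o, 'a) cat \<Rightarrow> 'o \<Rightarrow> bool" where
  "prime_generated C X \<longleftrightarrow> (\<forall>n \<in> Arr C. Cod C n = X \<and> monic C n \<and> \<not> split_epi C n \<longrightarrow>
     (\<exists>P Q. \<exists>m \<in> hom C P X. \<exists>p \<in> hom C X Q. \<exists>q \<in> hom C X Q. p \<noteq> q \<and> \<not> factors C m n \<and>
        (\<forall>n' \<in> Arr C. Cod C n' = X \<longrightarrow> factors C m n' \<or> Comp C p n' = Comp C q n')))"

lemma (in precategory) hom_Comp [intro]: "f \<in> hom C a b \<Longrightarrow> g \<in> hom C b c \<Longrightarrow> Comp C g f \<in> hom C a c"
  by (auto simp: hom_def)

lemma (in category) hom_assoc:
  "f \<in> hom C a b \<Longrightarrow> g \<in> hom C b c \<Longrightarrow> h \<in> hom C c d \<Longrightarrow> Comp C (Comp C h g) f = Comp C h (Comp C g f)"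
  by (auto simp: hom_def Comp_assoc)

lemma (in category) hom_id_left: "f \<in> hom C a b \<Longrightarrow> Comp C (Ident C b) f = f"
  and hom_id_right: "f \<in> hom C a b \<Longrightarrow> Comp C f (Ident C a) = f"
  by (auto simp: hom_def Comp_Ident_left Comp_Ident_right)

lemma (in category) Ident_hom [intro]: "a \<in> Obj C \<Longrightarrow> Ident C a \<in> hom C a a"
  by (auto simp: hom_def)

lemma hom_Dom: "f \<in> hom C a b \<Longrightarrow> Dom C f = a"
  and hom_Cod: "f \<in> hom C a b \<Longrightarrow> Cod C f = b"
  and hom_Arr: "f \<in> hom C a b \<Longrightarrow> f \<in> Arr C"
  by (auto simp: hom_def)

text \<open>Full, faithful and surjective up to isomorphism. Passing to this form avoids replacing
  an equivalence by an adjoint one.\<close>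

locale ff_equivalence = D: category D + E: category E
  for D :: "('o, 'a) cat" and E :: "('p, 'b) cat" +
  fixes G :: "('o, 'a, 'p, 'b) fctr"
  assumes functor_G: "G \<in> functors D E"
    and faithful: "\<lbrakk>f \<in> hom D a b; g \<in> hom D a b; amap G f = amap G g\<rbrakk> \<Longrightarrow> f = g"
    and full: "\<lbrakk>a \<in> Obj D; b \<in> Obj D; h \<in> hom E (omap G a) (omap G b)\<rbrakk> \<Longrightarrow> \<exists>f \<in> hom D a b. amap G f = h"
    and surj: "X \<in> Obj E \<Longrightarrow> \<exists>Y \<in> Obj D. isomorphic E (omap G Y) X"
begin

lemma G_hom: "f \<in> hom D a b \<Longrightarrow> amap G f \<in> hom E (omap G a) (omap G b)"
  using functor_G by (auto simp: functors_def hom_def)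

lemma G_comp: "f \<in> hom D a b \<Longrightarrow> g \<in> hom D b c \<Longrightarrow> amap G (Comp D g f) = Comp E (amap G g) (amap G f)"
  using functor_G by (auto simp: functors_def hom_def)

lemma G_id: "a \<in> Obj D \<Longrightarrow> amap G (Ident D a) = Ident E (omap G a)"
  using functor_G by (auto simp: functors_def)

lemma surjE:
  assumes "X \<in> Obj E"
  obtains Y i j where "Y \<in> Obj D" "i \<in> hom E (omap G Y) X" "j \<in> hom E X (omap G Y)"
    "Comp E j i = Ident E (omap G Y)" "Comp E i j = Ident E X"
  using surj[OF assms] unfolding isomorphic_def hom_def by blast

lemma prime_generated_transport:
  assumes D: "\<And>Y. Y \<in> Obj D \<Longrightarrow> prime_generated D Y" and X: "X \<in> Obj E"
  shows "prime_generated E X"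
  unfolding prime_generated_def
proof (intro ballI impI)
  obtain Y i j where Y: "Y \<in> Obj D" and i: "i \<in> hom E (omap G Y) X" and j: "j \<in> hom E X (omap G Y)"
    and ji: "Comp E j i = Ident E (omap G Y)" and ij: "Comp E i j = Ident E X"
    using surjE[OF X] by blast
  have jic: "Comp E j (Comp E i f) = f" if "f \<in> hom E Z (omap G Y)" for f Z
    using E.hom_assoc[OF that i j] E.hom_id_left[OF that] ji by simp
  have ijc: "Comp E i (Comp E j f) = f" if "f \<in> hom E Z X" for f Z
    using E.hom_assoc[OF that j i] E.hom_id_left[OF that] ij by simp
  \<comment> \<open>surjectivity on objects and fullness replace any arrow into \<open>X\<close> by the image of an arrow into \<open>Y\<close>\<close>
  have arrow: "\<exists>K \<in> Obj D. \<exists>k \<in> hom D K Y. \<exists>a \<in> hom E (omap G K) (Dom E n). \<exists>b \<in> hom E (Dom E n) (omap G K).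
      Comp E b a = Ident E (omap G K) \<and> Comp E a b = Ident E (Dom E n) \<and>
      Comp E n a = Comp E i (amap G k) \<and> n = Comp E i (Comp E (amap G k) b)"
    if n: "n \<in> Arr E" "Cod E n = X" for n
  proof -
    have "Dom E n \<in> Obj E" using n by simp
    then obtain K a b where K: "K \<in> Obj D" and a: "a \<in> hom E (omap G K) (Dom E n)"
      and b: "b \<in> hom E (Dom E n) (omap G K)"
      and ba: "Comp E b a = Ident E (omap G K)" and ab: "Comp E a b = Ident E (Dom E n)"
      by (rule surjE)
    have nh: "n \<in> hom E (Dom E n) X" using n by (simp add: hom_def)
    have na: "Comp E n a \<in> hom E (omap G K) X" using a nh by blast
    then have "Comp E j (Comp E n a) \<in> hom E (omap G K) (omap G Y)" using j by blast
    then obtain k where k: "k \<in> hom D K Y" "amap G k = Comp E j (Comp E n a)" using full K Y by blast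
    have 1: "Comp E i (amap G k) = Comp E n a" using k ijc[OF na] by simp
    have "Comp E i (Comp E (amap G k) b) = Comp E (Comp E n a) b"
      using E.hom_assoc[OF b G_hom[OF k(1)] i] 1 by simp
    also have "\<dots> = n" using E.hom_assoc[OF b a nh] ab E.hom_id_right[OF nh] by simp
    finally show ?thesis using K k a b ba ab 1 by metis
  qed
  fix n assume n: "n \<in> Arr E" and "Cod E n = X \<and> monic E n \<and> \<not> split_epi E n"
  then have nX: "Cod E n = X" and mono: "monic E n" and nsplit: "\<not> split_epi E n" by auto
  have nh: "n \<in> hom E (Dom E n) X" using n nX by (simp add: hom_def)
  obtain K k a b where K: "K \<in> Obj D" and k: "k \<in> hom D K Y" and a: "a \<in> hom E (omap G K) (Dom E n)"
      and b: "b \<in> hom E (Dom E n) (omap G K)"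
      and ba: "Comp E b a = Ident E (omap G K)" and ab: "Comp E a b = Ident E (Dom E n)"
      and na: "Comp E n a = Comp E i (amap G k)" and nk: "n = Comp E i (Comp E (amap G k) b)"
    using arrow[OF n nX] by blast
  note Gk = G_hom[OF k]
  have "monic D k"
    unfolding monic_def
  proof (intro ballI impI)
    fix u v assume uv: "u \<in> Arr D" "v \<in> Arr D"
      "Dom D u = Dom D v \<and> Cod D u = Dom D k \<and> Cod D v = Dom D k \<and> Comp D k u = Comp D k v"
    then have u: "u \<in> hom D (Dom D u) K" and v: "v \<in> hom D (Dom D u) K" and e: "Comp D k u = Comp D k v"
      using k by (auto simp: hom_def)
    note Gu = G_hom[OF u] and Gv = G_hom[OF v]
    have *: "Comp E n (Comp E a (amap G w)) = Comp E i (amap G (Comp D k w))" if w: "w \<in> hom D (Dom D u) K" for w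
      using E.hom_assoc[OF G_hom[OF w] a nh] E.hom_assoc[OF G_hom[OF w] Gk i] na G_comp[OF w k] by simp
    have "Comp E n (Comp E a (amap G u)) = Comp E n (Comp E a (amap G v))"
      using *[OF u] *[OF v] e by simp
    moreover have h: "Comp E a (amap G u) \<in> hom E (omap G (Dom D u)) (Dom E n)"
      "Comp E a (amap G v) \<in> hom E (omap G (Dom D u)) (Dom E n)" using a Gu Gv by blast+
    ultimately have "Comp E a (amap G u) = Comp E a (amap G v)"
      using mono unfolding monic_def hom_def by auto
    then have "Comp E b (Comp E a (amap G u)) = Comp E b (Comp E a (amap G v))" by simp
    then have "amap G u = amap G v"
      using E.hom_assoc[OF Gu a b] E.hom_assoc[OF Gv a b] ba E.hom_id_left[OF Gu] E.hom_id_left[OF Gv] by simp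
    then show "u = v" using faithful u v by blast
  qed
  moreover have "\<not> split_epi D k"
  proof
    assume "split_epi D k"
    then obtain s where s: "s \<in> hom D Y K" "Comp D k s = Ident D Y"
      using k unfolding split_epi_def by (auto simp: hom_Dom hom_Cod)
    note Gs = G_hom[OF s(1)]
    let ?s = "Comp E a (Comp E (amap G s) j)"
    have sj: "Comp E (amap G s) j \<in> hom E X (omap G K)" using Gs j by blast
    have sh: "?s \<in> hom E X (Dom E n)" using sj a by blast
    have "Comp E n ?s = Comp E (Comp E n a) (Comp E (amap G s) j)"
      using E.hom_assoc[OF sj a nh] by simp
    also have "\<dots> = Comp E i (Comp E (amap G k) (Comp E (amap G s) j))"
      using E.hom_assoc[OF sj Gk i] na by simp
    also have "Comp E (amap G k) (Comp E (amap G s) j) = Comp E (amap G (Comp D k s)) j"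
      using E.hom_assoc[OF j Gs Gk] G_comp[OF s(1) k] by simp
    also have "\<dots> = j" using s(2) G_id[OF Y] E.hom_id_left[OF j] by simp
    finally have "Comp E n ?s = Ident E X" using ij by simp
    with sh nsplit show False unfolding split_epi_def nX by blast
  qed
  ultimately obtain P Q m p q where m: "m \<in> hom D P Y" and p: "p \<in> hom D Y Q" and q: "q \<in> hom D Y Q"
    and pq: "p \<noteq> q" and mk: "\<not> factors D m k"
    and all: "\<And>n'. n' \<in> Arr D \<Longrightarrow> Cod D n' = Y \<Longrightarrow> factors D m n' \<or> Comp D p n' = Comp D q n'"
    using D[OF Y] k unfolding prime_generated_def by (metis hom_Arr hom_Cod)
  have PQ: "P \<in> Obj D" "Q \<in> Obj D" using m p by (auto simp: hom_def)
  note Gm = G_hom[OF m] and Gp = G_hom[OF p] and Gq = G_hom[OF q]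
  let ?m = "Comp E i (amap G m)" and ?p = "Comp E (amap G p) j" and ?q = "Comp E (amap G q) j"
  have hm: "?m \<in> hom E (omap G P) X" and hp: "?p \<in> hom E X (omap G Q)" and hq: "?q \<in> hom E X (omap G Q)"
    using i j Gm Gp Gq by blast+
  have "?p \<noteq> ?q"
  proof
    assume "?p = ?q"
    then have "Comp E ?p i = Comp E ?q i" by simp
    then have "amap G p = amap G q"
      using E.hom_assoc[OF i j Gp] E.hom_assoc[OF i j Gq] ji E.hom_id_right[OF Gp] E.hom_id_right[OF Gq] by simp
    then show False using faithful p q pq by blast
  qed
  moreover have "\<not> factors E ?m n"
  proof
    assume "factors E ?m n"
    then obtain r where r: "r \<in> hom E (omap G P) (Dom E n)" "Comp E n r = ?m"
      unfolding factors_def using hm by (auto simp: hom_Dom)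
    then have br: "Comp E b r \<in> hom E (omap G P) (omap G K)" using b by blast
    then obtain r' where r': "r' \<in> hom D P K" "amap G r' = Comp E b r" using full K PQ by blast
    have kb: "Comp E (amap G k) b \<in> hom E (Dom E n) (omap G Y)" using b Gk by blast
    have "amap G m = Comp E j ?m" using jic[OF Gm] by simp
    also have "\<dots> = Comp E j (Comp E i (Comp E (Comp E (amap G k) b) r))"
      using r(2) nk E.hom_assoc[OF r(1) kb i] by metis
    also have "\<dots> = Comp E (Comp E (amap G k) b) r" using jic kb r(1) by blast
    also have "\<dots> = amap G (Comp D k r')"
      using E.hom_assoc[OF r(1) b Gk] G_comp[OF r'(1) k] r'(2) by simp
    finally have "amap G m = amap G (Comp D k r')" .
    moreover have "Comp D k r' \<in> hom D P Y" using r' k by blast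
    ultimately have "m = Comp D k r'" using faithful m by blast
    then show False using mk r' k m unfolding factors_def by (auto simp: hom_Dom)
  qed
  moreover have "factors E ?m n' \<or> Comp E ?p n' = Comp E ?q n'" if n': "n' \<in> Arr E" "Cod E n' = X" for n'
  proof -
    have nh': "n' \<in> hom E (Dom E n') X" using n' by (simp add: hom_def)
    obtain K' k' a' b' where K': "K' \<in> Obj D" and k': "k' \<in> hom D K' Y"
      and a': "a' \<in> hom E (omap G K') (Dom E n')" and b': "b' \<in> hom E (Dom E n') (omap G K')"
      and na': "Comp E n' a' = Comp E i (amap G k')" and nk': "n' = Comp E i (Comp E (amap G k') b')"
      using arrow[OF n'] by blast
    note Gk' = G_hom[OF k']
    consider "factors D m k'" | "Comp D p k' = Comp D q k'"
      using all[of k'] k' by (auto simp: hom_def)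
    then show ?thesis
    proof cases
      case 1
      then obtain r where r: "r \<in> hom D P K'" "Comp D k' r = m"
        using m k' unfolding factors_def by (auto simp: hom_Dom)
      note Gr = G_hom[OF r(1)]
      have "Comp E n' (Comp E a' (amap G r)) = Comp E i (Comp E (amap G k') (amap G r))"
        using E.hom_assoc[OF Gr a' nh'] E.hom_assoc[OF Gr Gk' i] na' by simp
      also have "\<dots> = ?m" using G_comp[OF r(1) k'] r(2) by simp
      finally have "Comp E n' (Comp E a' (amap G r)) = ?m" .
      moreover have "Comp E a' (amap G r) \<in> hom E (omap G P) (Dom E n')" using Gr a' by blast
      ultimately show ?thesis unfolding factors_def using hm by (auto simp: hom_Dom)
    next
      case 2
      have kb: "Comp E (amap G k') b' \<in> hom E (Dom E n') (omap G Y)" using b' Gk' by blast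
      have "Comp E (Comp E (amap G w) j) n' = Comp E (amap G (Comp D w k')) b'" if w: "w \<in> hom D Y Q" for w
      proof -
        have "Comp E (Comp E (amap G w) j) n' = Comp E (amap G w) (Comp E j n')"
          using E.hom_assoc[OF nh' j G_hom[OF w]] .
        also have "Comp E j n' = Comp E (amap G k') b'" using nk' jic[OF kb] by simp
        finally show ?thesis using E.hom_assoc[OF b' Gk' G_hom[OF w]] G_comp[OF k' w] by simp
      qed
      then show ?thesis using 2 p q by simp
    qed
  qed
  ultimately show "\<exists>P Q. \<exists>m \<in> hom E P X. \<exists>p \<in> hom E X Q. \<exists>q \<in> hom E X Q. p \<noteq> q \<and> \<not> factors E m n \<and>
      (\<forall>n' \<in> Arr E. Cod E n' = X \<longrightarrow> factors E m n' \<or> Comp E p n' = Comp E q n')"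
    using hm hp hq by blast
qed

end

lemma iso_nat:
  assumes D: "category D" and F: "F \<in> functors D D"
    and iso: "isomorphic (functor_cat D D) F (id_functor D)"
  obtains \<alpha> \<beta> where "\<And>a. a \<in> Obj D \<Longrightarrow> \<alpha> a \<in> hom D (omap F a) a" "\<And>a. a \<in> Obj D \<Longrightarrow> \<beta> a \<in> hom D a (omap F a)"
    "\<And>a. a \<in> Obj D \<Longrightarrow> Comp D (\<beta> a) (\<alpha> a) = Ident D (omap F a)"
    "\<And>a. a \<in> Obj D \<Longrightarrow> Comp D (\<alpha> a) (\<beta> a) = Ident D a"
    "\<And>f a b. f \<in> hom D a b \<Longrightarrow> Comp D (\<alpha> b) (amap F f) = Comp D f (\<alpha> a)"
proof -
  interpret category D by fact
  let ?I = "id_functor D"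
  obtain A B where AB: "A \<in> nat_transformations D D" "B \<in> nat_transformations D D"
    "Dom (functor_cat D D) A = F" "Cod (functor_cat D D) A = ?I"
    "Dom (functor_cat D D) B = ?I" "Cod (functor_cat D D) B = F"
    "Comp (functor_cat D D) B A = Ident (functor_cat D D) F" "Comp (functor_cat D D) A B = Ident (functor_cat D D) ?I"
    using iso unfolding isomorphic_def by (auto simp: functor_cat_def)
  obtain \<alpha> where A: "A = (F, \<alpha>, ?I)" using AB by (cases A) (auto simp: functor_cat_def)
  obtain \<beta> where B: "B = (?I, \<beta>, F)" using AB by (cases B) (auto simp: functor_cat_def)
  have "Comp D (\<beta> a) (\<alpha> a) = Ident D (omap F a)" "Comp D (\<alpha> a) (\<beta> a) = Ident D a" if "a \<in> Obj D" for a
    using AB(7,8) that unfolding A B functor_cat_def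
    by (auto simp: id_functor_def dest: fun_cong[where x = a])
  moreover have "\<alpha> a \<in> hom D (omap F a) a" "\<beta> a \<in> hom D a (omap F a)" if "a \<in> Obj D" for a
    using AB(1,2) that unfolding A B nat_transformations_def hom_def by (auto simp: id_functor_def)
  moreover have "Comp D (\<alpha> b) (amap F f) = Comp D f (\<alpha> a)" if "f \<in> hom D a b" for f a b
    using AB(1) that unfolding A nat_transformations_def hom_def by (auto simp: id_functor_def)
  ultimately show ?thesis using that by blast
qed

lemma comp_functor_in:
  assumes "category D" "F \<in> functors D E" "G \<in> functors E D'"
  shows "comp_functor D G F \<in> functors D D'"
proof -
  interpret category D by fact
  have Fm: "\<And>a. a \<in> Obj D \<Longrightarrow> omap F a \<in> Obj E" "\<And>f. f \<in> Arr D \<Longrightarrow> amap F f \<in> Arr E"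
    "\<And>f. f \<in> Arr D \<Longrightarrow> Dom E (amap F f) = omap F (Dom D f) \<and> Cod E (amap F f) = omap F (Cod D f)"
    using assms(2) by (auto simp: functors_def)
  show ?thesis
    using assms(2,3) Fm unfolding functors_def comp_functor_def
    by (auto simp: compose_def PiE_iff)
qed

lemma equivalence_ff:
  assumes D: "category D" and E: "category E" and eq: "equivalent_cats E D"
  obtains G where "ff_equivalence D E G"
proof -
  interpret D: category D by fact
  interpret E: category E by fact
  obtain F G where F: "F \<in> functors E D" and G: "G \<in> functors D E"
    and GF: "isomorphic (functor_cat E E) (comp_functor E G F) (id_functor E)"
    and FG: "isomorphic (functor_cat D D) (comp_functor D F G) (id_functor D)"
    using eq unfolding equivalent_cats_def by blast
  obtain \<eta> \<eta>' where \<eta>: "\<And>a. a \<in> Obj E \<Longrightarrow> \<eta> a \<in> hom E (omap (comp_functor E G F) a) a"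
    "\<And>a. a \<in> Obj E \<Longrightarrow> \<eta>' a \<in> hom E a (omap (comp_functor E G F) a)"
    "\<And>a. a \<in> Obj E \<Longrightarrow> Comp E (\<eta>' a) (\<eta> a) = Ident E (omap (comp_functor E G F) a)"
    "\<And>a. a \<in> Obj E \<Longrightarrow> Comp E (\<eta> a) (\<eta>' a) = Ident E a"
    "\<And>f a b. f \<in> hom E a b \<Longrightarrow> Comp E (\<eta> b) (amap (comp_functor E G F) f) = Comp E f (\<eta> a)"
    using iso_nat[OF E comp_functor_in[OF E F G] GF] by blast
  obtain \<epsilon> \<epsilon>' where \<epsilon>: "\<And>a. a \<in> Obj D \<Longrightarrow> \<epsilon> a \<in> hom D (omap (comp_functor D F G) a) a"
    "\<And>a. a \<in> Obj D \<Longrightarrow> \<epsilon>' a \<in> hom D a (omap (comp_functor D F G) a)"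
    "\<And>a. a \<in> Obj D \<Longrightarrow> Comp D (\<epsilon>' a) (\<epsilon> a) = Ident D (omap (comp_functor D F G) a)"
    "\<And>a. a \<in> Obj D \<Longrightarrow> Comp D (\<epsilon> a) (\<epsilon>' a) = Ident D a"
    "\<And>f a b. f \<in> hom D a b \<Longrightarrow> Comp D (\<epsilon> b) (amap (comp_functor D F G) f) = Comp D f (\<epsilon> a)"
    using iso_nat[OF D comp_functor_in[OF D G F] FG] by blast
  have [simp]: "omap (comp_functor E G F) a = omap G (omap F a)" if "a \<in> Obj E" for a
    using that by (simp add: comp_functor_def compose_def)
  have [simp]: "amap (comp_functor E G F) f = amap G (amap F f)" if "f \<in> Arr E" for f
    using that by (simp add: comp_functor_def compose_def)
  have [simp]: "omap (comp_functor D F G) a = omap F (omap G a)" if "a \<in> Obj D" for a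
    using that by (simp add: comp_functor_def compose_def)
  have [simp]: "amap (comp_functor D F G) f = amap F (amap G f)" if "f \<in> Arr D" for f
    using that by (simp add: comp_functor_def compose_def)
  have homD: "f \<in> Arr D \<and> a \<in> Obj D \<and> b \<in> Obj D" if "f \<in> hom D a b" for f a b
    using that by (auto simp: hom_def)
  have homE: "f \<in> Arr E \<and> a \<in> Obj E \<and> b \<in> Obj E" if "f \<in> hom E a b" for f a b
    using that by (auto simp: hom_def)
  have faith: "f = g" if f: "f \<in> hom D a b" and g: "g \<in> hom D a b" and e: "amap G f = amap G g" for f g a b
  proof -
    note a = homD[OF f] homD[OF g]
    have "Comp D f (\<epsilon> a) = Comp D g (\<epsilon> a)" using \<epsilon>(5)[OF f] \<epsilon>(5)[OF g] a e by simp
    then have "Comp D (Comp D f (\<epsilon> a)) (\<epsilon>' a) = Comp D (Comp D g (\<epsilon> a)) (\<epsilon>' a)" by simp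
    then show "f = g"
      using D.hom_assoc[OF \<epsilon>(2) \<epsilon>(1) f] D.hom_assoc[OF \<epsilon>(2) \<epsilon>(1) g] a \<epsilon>(4) D.hom_id_right[OF f] D.hom_id_right[OF g] by simp
  qed
  have faithF: "f = g" if f: "f \<in> hom E a b" and g: "g \<in> hom E a b" and e: "amap F f = amap F g" for f g a b
  proof -
    note a = homE[OF f] homE[OF g]
    have "Comp E f (\<eta> a) = Comp E g (\<eta> a)" using \<eta>(5)[OF f] \<eta>(5)[OF g] a e by simp
    then have "Comp E (Comp E f (\<eta> a)) (\<eta>' a) = Comp E (Comp E g (\<eta> a)) (\<eta>' a)" by simp
    then show "f = g"
      using E.hom_assoc[OF \<eta>(2) \<eta>(1) f] E.hom_assoc[OF \<eta>(2) \<eta>(1) g] a \<eta>(4) E.hom_id_right[OF f] E.hom_id_right[OF g] by simp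
  qed
  have Gh: "amap G f \<in> hom E (omap G a) (omap G b)" if "f \<in> hom D a b" for f a b
    using G that by (auto simp: functors_def hom_def)
  have Fh: "amap F f \<in> hom D (omap F a) (omap F b)" if "f \<in> hom E a b" for f a b
    using F that by (auto simp: functors_def hom_def)
  have GO: "omap G a \<in> Obj E" if "a \<in> Obj D" for a
    using G that by (auto simp: functors_def)
  have FO: "omap F a \<in> Obj D" if "a \<in> Obj E" for a
    using F that by (auto simp: functors_def)
  have fl: "\<exists>f \<in> hom D a b. amap G f = h" if ab: "a \<in> Obj D" "b \<in> Obj D" and h: "h \<in> hom E (omap G a) (omap G b)" for a b h
  proof -
    have ea: "\<epsilon> a \<in> hom D (omap F (omap G a)) a" "\<epsilon>' a \<in> hom D a (omap F (omap G a))"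
      "Comp D (\<epsilon>' a) (\<epsilon> a) = Ident D (omap F (omap G a))"
      using \<epsilon>(1-3)[of a] ab by auto
    have eb: "\<epsilon> b \<in> hom D (omap F (omap G b)) b" "\<epsilon>' b \<in> hom D b (omap F (omap G b))"
      "Comp D (\<epsilon>' b) (\<epsilon> b) = Ident D (omap F (omap G b))"
      using \<epsilon>(1-3)[of b] ab by auto
    note Fhh = Fh[OF h]
    let ?f = "Comp D (\<epsilon> b) (Comp D (amap F h) (\<epsilon>' a))"
    have fe: "Comp D (amap F h) (\<epsilon>' a) \<in> hom D a (omap F (omap G b))" using Fhh ea by blast
    have f: "?f \<in> hom D a b" using fe eb by blast
    have Ff: "amap F (amap G ?f) \<in> hom D (omap F (omap G a)) (omap F (omap G b))" using Fh Gh f by blast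
    have "Comp D (\<epsilon> b) (amap F (amap G ?f)) = Comp D ?f (\<epsilon> a)" using \<epsilon>(5)[OF f] homD[OF f] by simp
    also have "\<dots> = Comp D (\<epsilon> b) (Comp D (Comp D (amap F h) (\<epsilon>' a)) (\<epsilon> a))"
      using D.hom_assoc[OF ea(1) fe eb(1)] .
    also have "Comp D (Comp D (amap F h) (\<epsilon>' a)) (\<epsilon> a) = amap F h"
      using D.hom_assoc[OF ea(1,2) Fhh] ea(3) D.hom_id_right[OF Fhh] by simp
    finally have "Comp D (\<epsilon> b) (amap F (amap G ?f)) = Comp D (\<epsilon> b) (amap F h)" .
    then have "Comp D (\<epsilon>' b) (Comp D (\<epsilon> b) (amap F (amap G ?f))) = Comp D (\<epsilon>' b) (Comp D (\<epsilon> b) (amap F h))" by simp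
    then have "amap F (amap G ?f) = amap F h"
      using D.hom_assoc[OF Ff eb(1,2)] D.hom_assoc[OF Fhh eb(1,2)] eb(3) D.hom_id_left[OF Ff] D.hom_id_left[OF Fhh] by simp
    then show ?thesis using faithF[OF Gh[OF f] h] f by blast
  qed
  have "ff_equivalence D E G"
  proof (unfold_locales)
    show "G \<in> functors D E" by fact
    show "\<exists>Y\<in>Obj D. isomorphic E (omap G Y) X" if "X \<in> Obj E" for X
    proof
      show "omap F X \<in> Obj D" using FO that .
      show "isomorphic E (omap G (omap F X)) X"
        using \<eta>(1-4)[OF that] that unfolding isomorphic_def hom_def by auto
    qed
  qed (fact faith fl)+
  then show ?thesis by (rule that)
qed

section \<open>Presheaf categories\<close>

lemma op_cat_simps [simp]: "Obj (op_cat C) = Obj C" "Arr (op_cat C) = Arr C" "Dom (op_cat C) = Cod C"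
  "Cod (op_cat C) = Dom C" "Ident (op_cat C) = Ident C" "Comp (op_cat C) g f = Comp C f g"
  by (simp_all add: op_cat_def)

lemma set_cat_simps [simp]: "Obj (set_cat U) = U" "Dom (set_cat U) (A, f, B) = A" "Cod (set_cat U) (A, f, B) = B"
  "(A, f, B) \<in> Arr (set_cat U) \<longleftrightarrow> A \<in> U \<and> B \<in> U \<and> f \<in> A \<rightarrow>\<^sub>E B"
  "Ident (set_cat U) A = (A, \<lambda>x \<in> A. x, A)"
  "Comp (set_cat U) (B', g, D) (A, f, B) = (A, compose A g f, D)"
  by (simp_all add: set_cat_def)

lemma functor_cat_simps [simp]: "Obj (functor_cat C D) = functors C D" "Arr (functor_cat C D) = nat_transformations C D"
  "Dom (functor_cat C D) (F, \<eta>, G) = F" "Cod (functor_cat C D) (F, \<eta>, G) = G"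
  by (simp_all add: functor_cat_def)

definition mk_psh :: "('o, 'a) cat \<Rightarrow> ('o \<Rightarrow> 'u set) \<Rightarrow> ('a \<Rightarrow> 'u \<Rightarrow> 'u) \<Rightarrow> ('o, 'a, 'u) presheaf" where
  "mk_psh C P \<rho> = \<lparr>omap = (\<lambda>c \<in> Obj C. P c),
     amap = (\<lambda>f \<in> Arr C. (P (Cod C f), restrict (\<rho> f) (P (Cod C f)), P (Dom C f)))\<rparr>"

text \<open>The function underlying a component of a natural transformation.\<close>

definition cmp :: "('o, 'a, 'u set, 'u set_arr) nat_trans \<Rightarrow> 'o \<Rightarrow> 'u \<Rightarrow> 'u" where
  "cmp m c = fst (snd (fst (snd m) c))"

definition mk_nt :: "('o, 'a) cat \<Rightarrow> ('o, 'a, 'u) presheaf \<Rightarrow> ('o \<Rightarrow> 'u \<Rightarrow> 'u) \<Rightarrow> ('o, 'a, 'u) presheaf \<Rightarrow>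
    ('o, 'a, 'u set, 'u set_arr) nat_trans" where
  "mk_nt C P h Q = (P, \<lambda>c \<in> Obj C. (omap P c, restrict (h c) (omap P c), omap Q c), Q)"

locale presheaves = precategory C for C :: "('o, 'a) cat" +
  fixes U :: "'u set set"
begin

abbreviation "Psh \<equiv> functors (op_cat C) (set_cat U)"
abbreviation "PC \<equiv> presheaf_cat U C"

lemma psh_amap:
  assumes "P \<in> Psh" "f \<in> Arr C"
  shows "amap P f = (omap P (Cod C f), restr P f, omap P (Dom C f))"
    and "restr P f \<in> omap P (Cod C f) \<rightarrow>\<^sub>E omap P (Dom C f)"
proof -
  obtain A g B where 1: "amap P f = (A, g, B)" by (cases "amap P f") auto
  have "amap P f \<in> Arr (set_cat U)" "Dom (set_cat U) (amap P f) = omap P (Cod C f)"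
    "Cod (set_cat U) (amap P f) = omap P (Dom C f)"
    using assms by (auto simp: functors_def)
  with 1 show "amap P f = (omap P (Cod C f), restr P f, omap P (Dom C f))"
    and "restr P f \<in> omap P (Cod C f) \<rightarrow>\<^sub>E omap P (Dom C f)"
    by (auto simp: restr_def)
qed

lemma psh_omap: "P \<in> Psh \<Longrightarrow> c \<in> Obj C \<Longrightarrow> omap P c \<in> U"
  by (auto simp: functors_def)

lemma restr_in: "P \<in> Psh \<Longrightarrow> f \<in> Arr C \<Longrightarrow> z \<in> omap P (Cod C f) \<Longrightarrow> restr P f z \<in> omap P (Dom C f)"
  using psh_amap(2) by blast

lemma restr_Ident:
  assumes "P \<in> Psh" "c \<in> Obj C" "z \<in> omap P c"
  shows "restr P (Ident C c) z = z"
proof -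
  have "amap P (Ident C c) = (omap P c, \<lambda>x \<in> omap P c. x, omap P c)"
    using assms by (auto simp: functors_def)
  then show ?thesis using assms by (simp add: restr_def)
qed

lemma restr_Comp:
  assumes "P \<in> Psh" "f \<in> Arr C" "g \<in> Arr C" "Cod C g = Dom C f" "z \<in> omap P (Cod C f)"
  shows "restr P (Comp C f g) z = restr P g (restr P f z)"
proof -
  have "amap P (Comp C f g) = Comp (set_cat U) (amap P g) (amap P f)"
    using assms by (auto simp: functors_def)
  then have "restr P (Comp C f g) = compose (omap P (Cod C f)) (restr P g) (restr P f)"
    using psh_amap(1)[OF assms(1,2)] psh_amap(1)[OF assms(1,3)] psh_amap(1)[OF assms(1), of "Comp C f g"] assms
    by simp
  then show ?thesis using assms(5) by (simp add: compose_def)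
qed

lemma mk_psh_in:
  assumes "\<And>c. c \<in> Obj C \<Longrightarrow> P c \<in> U"
    and "\<And>f z. f \<in> Arr C \<Longrightarrow> z \<in> P (Cod C f) \<Longrightarrow> \<rho> f z \<in> P (Dom C f)"
    and "\<And>c z. c \<in> Obj C \<Longrightarrow> z \<in> P c \<Longrightarrow> \<rho> (Ident C c) z = z"
    and "\<And>f g z. f \<in> Arr C \<Longrightarrow> g \<in> Arr C \<Longrightarrow> Cod C g = Dom C f \<Longrightarrow> z \<in> P (Cod C f) \<Longrightarrow>
      \<rho> (Comp C f g) z = \<rho> g (\<rho> f z)"
  shows "mk_psh C P \<rho> \<in> Psh"
proof -
  have 1: "compose (P (Cod C f)) (restrict (\<rho> g) (P (Cod C g))) (restrict (\<rho> f) (P (Cod C f))) =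
      restrict (\<rho> (Comp C f g)) (P (Cod C f))"
    if "f \<in> Arr C" "g \<in> Arr C" "Dom C f = Cod C g" for f g
    using that assms(2)[OF that(1)] assms(4)[OF that(1,2)] by (auto simp: compose_def fun_eq_iff)
  have 2: "restrict (\<rho> (Ident C c)) (P c) = (\<lambda>x \<in> P c. x)" if "c \<in> Obj C" for c
    using that assms(3) by (auto simp: fun_eq_iff)
  show ?thesis
    unfolding functors_def mk_psh_def using assms(1,2) by (auto simp: 1 2)
qed

lemma mk_psh_simps [simp]:
  "c \<in> Obj C \<Longrightarrow> omap (mk_psh C P \<rho>) c = P c"
  "f \<in> Arr C \<Longrightarrow> z \<in> P (Cod C f) \<Longrightarrow> restr (mk_psh C P \<rho>) f z = \<rho> f z"
  by (auto simp: mk_psh_def restr_def)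

lemma nt_form:
  assumes "m \<in> Arr PC"
  obtains P \<eta> Q where "m = (P, \<eta>, Q)" "P \<in> Psh" "Q \<in> Psh"
    "\<And>c. c \<in> Obj C \<Longrightarrow> \<eta> c = (omap P c, cmp m c, omap Q c) \<and> cmp m c \<in> omap P c \<rightarrow>\<^sub>E omap Q c"
    "\<eta> \<in> extensional (Obj C)"
    "\<And>f. f \<in> Arr C \<Longrightarrow> Comp (set_cat U) (\<eta> (Dom C f)) (amap P f) = Comp (set_cat U) (amap Q f) (\<eta> (Cod C f))"
proof -
  obtain P \<eta> Q where m: "m = (P, \<eta>, Q)" by (cases m)
  have N: "P \<in> Psh" "Q \<in> Psh" "\<eta> \<in> Obj C \<rightarrow>\<^sub>E Arr (set_cat U)"
    "\<And>c. c \<in> Obj C \<Longrightarrow> Dom (set_cat U) (\<eta> c) = omap P c \<and> Cod (set_cat U) (\<eta> c) = omap Q c"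
    "\<And>f. f \<in> Arr C \<Longrightarrow> Comp (set_cat U) (\<eta> (Dom C f)) (amap P f) = Comp (set_cat U) (amap Q f) (\<eta> (Cod C f))"
    using assms unfolding m by (auto simp: nat_transformations_def)
  have "\<eta> c = (omap P c, cmp m c, omap Q c) \<and> cmp m c \<in> omap P c \<rightarrow>\<^sub>E omap Q c" if c: "c \<in> Obj C" for c
  proof -
    obtain A g B where 1: "\<eta> c = (A, g, B)" by (cases "\<eta> c") auto
    have "\<eta> c \<in> Arr (set_cat U)" using N(3) c by blast
    with 1 N(4)[OF c] show ?thesis by (auto simp: cmp_def m)
  qed
  moreover have "\<eta> \<in> extensional (Obj C)" using N(3) by (simp add: PiE_iff)
  ultimately show ?thesis using that[OF m N(1,2)] N(5) by blast
qed

lemma nt_psh: "m \<in> Arr PC \<Longrightarrow> Dom PC m \<in> Psh" "m \<in> Arr PC \<Longrightarrow> Cod PC m \<in> Psh"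
  by (erule nt_form, simp)+

lemma cmp_PiE: "m \<in> Arr PC \<Longrightarrow> c \<in> Obj C \<Longrightarrow> cmp m c \<in> omap (Dom PC m) c \<rightarrow>\<^sub>E omap (Cod PC m) c"
  by (erule nt_form) simp

lemma cmp_in: "m \<in> Arr PC \<Longrightarrow> c \<in> Obj C \<Longrightarrow> z \<in> omap (Dom PC m) c \<Longrightarrow> cmp m c z \<in> omap (Cod PC m) c"
  using cmp_PiE by blast

lemma cmp_natural:
  assumes m: "m \<in> Arr PC" and f: "f \<in> Arr C" and z: "z \<in> omap (Dom PC m) (Cod C f)"
  shows "cmp m (Dom C f) (restr (Dom PC m) f z) = restr (Cod PC m) f (cmp m (Cod C f) z)"
proof -
  obtain P \<eta> Q where N: "m = (P, \<eta>, Q)" "P \<in> Psh" "Q \<in> Psh"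
    "\<And>c. c \<in> Obj C \<Longrightarrow> \<eta> c = (omap P c, cmp m c, omap Q c) \<and> cmp m c \<in> omap P c \<rightarrow>\<^sub>E omap Q c"
    "\<And>f. f \<in> Arr C \<Longrightarrow> Comp (set_cat U) (\<eta> (Dom C f)) (amap P f) = Comp (set_cat U) (amap Q f) (\<eta> (Cod C f))"
    using nt_form[OF m] by metis
  have "compose (omap P (Cod C f)) (cmp m (Dom C f)) (restr P f) = compose (omap P (Cod C f)) (restr Q f) (cmp m (Cod C f))"
    using N(5)[OF f] N(4) f psh_amap(1)[OF N(2) f] psh_amap(1)[OF N(3) f] by simp
  from fun_cong[OF this, of z] show ?thesis using z N(1) by (simp add: compose_def)
qed

lemma nt_eqI:
  assumes m: "m \<in> Arr PC" and m': "m' \<in> Arr PC" and "Dom PC m = Dom PC m'" "Cod PC m = Cod PC m'"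
    and eq: "\<And>c z. c \<in> Obj C \<Longrightarrow> z \<in> omap (Dom PC m) c \<Longrightarrow> cmp m c z = cmp m' c z"
  shows "m = m'"
proof -
  obtain P \<eta> Q where N: "m = (P, \<eta>, Q)" "\<And>c. c \<in> Obj C \<Longrightarrow> \<eta> c = (omap P c, cmp m c, omap Q c) \<and> cmp m c \<in> omap P c \<rightarrow>\<^sub>E omap Q c"
    "\<eta> \<in> extensional (Obj C)" using nt_form[OF m] by metis
  obtain P' \<eta>' Q' where N': "m' = (P', \<eta>', Q')" "\<And>c. c \<in> Obj C \<Longrightarrow> \<eta>' c = (omap P' c, cmp m' c, omap Q' c) \<and> cmp m' c \<in> omap P' c \<rightarrow>\<^sub>E omap Q' c"
    "\<eta>' \<in> extensional (Obj C)" using nt_form[OF m'] by metis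
  have PQ: "P = P'" "Q = Q'" using assms(3,4) N(1) N'(1) by auto
  have "cmp m c = cmp m' c" if c: "c \<in> Obj C" for c
  proof (rule PiE_ext)
    show "cmp m c \<in> omap P c \<rightarrow>\<^sub>E omap Q c" "cmp m' c \<in> omap P c \<rightarrow>\<^sub>E omap Q c"
      using N(2)[OF c] N'(2)[OF c] PQ by auto
    show "cmp m c z = cmp m' c z" if "z \<in> omap P c" for z
      using eq[OF c] that N(1) by simp
  qed
  then have "\<eta> = \<eta>'" using N(2,3) N'(2,3) PQ by (intro extensionalityI[of _ "Obj C"]) auto
  then show ?thesis using N N' PQ by simp
qed

lemma mk_nt_in:
  assumes "P \<in> Psh" "Q \<in> Psh" "\<And>c z. c \<in> Obj C \<Longrightarrow> z \<in> omap P c \<Longrightarrow> h c z \<in> omap Q c"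
    "\<And>f z. f \<in> Arr C \<Longrightarrow> z \<in> omap P (Cod C f) \<Longrightarrow> h (Dom C f) (restr P f z) = restr Q f (h (Cod C f) z)"
  shows "mk_nt C P h Q \<in> hom PC P Q"
proof -
  have "mk_nt C P h Q \<in> nat_transformations (op_cat C) (set_cat U)"
    using assms restr_in[of P] unfolding nat_transformations_def mk_nt_def
    by (auto simp: psh_omap psh_amap(1) compose_def intro!: ext)
  then show ?thesis by (simp add: hom_def mk_nt_def)
qed

lemma cmp_mk_nt [simp]: "c \<in> Obj C \<Longrightarrow> z \<in> omap P c \<Longrightarrow> cmp (mk_nt C P h Q) c z = h c z"
  by (simp add: cmp_def mk_nt_def)

lemma Comp_nt:
  assumes m: "m \<in> Arr PC" and m': "m' \<in> Arr PC" and "Cod PC m = Dom PC m'"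
  shows "Comp PC m' m = mk_nt C (Dom PC m) (\<lambda>c z. cmp m' c (cmp m c z)) (Cod PC m')"
proof -
  obtain P \<eta> Q where N: "m = (P, \<eta>, Q)" "\<And>c. c \<in> Obj C \<Longrightarrow> \<eta> c = (omap P c, cmp m c, omap Q c) \<and> cmp m c \<in> omap P c \<rightarrow>\<^sub>E omap Q c"
    using nt_form[OF m] by metis
  obtain P' \<eta>' Q' where N': "m' = (P', \<eta>', Q')" "\<And>c. c \<in> Obj C \<Longrightarrow> \<eta>' c = (omap P' c, cmp m' c, omap Q' c) \<and> cmp m' c \<in> omap P' c \<rightarrow>\<^sub>E omap Q' c"
    using nt_form[OF m'] by metis
  have "Comp PC m' m = (P, \<lambda>c \<in> Obj C. Comp (set_cat U) (\<eta>' c) (\<eta> c), Q')"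
    by (simp add: N N' functor_cat_def)
  also have "\<dots> = mk_nt C P (\<lambda>c z. cmp m' c (cmp m c z)) Q'"
    using N(2) N'(2) by (auto simp: mk_nt_def compose_def intro!: restrict_ext)
  finally show ?thesis by (simp add: N(1) N'(1))
qed

lemma Comp_nt_hom:
  assumes m: "m \<in> hom PC P Q" and m': "m' \<in> hom PC Q R"
  shows "Comp PC m' m \<in> hom PC P R"
proof -
  have a: "m \<in> Arr PC" "m' \<in> Arr PC" "Dom PC m = P" "Cod PC m = Q" "Dom PC m' = Q" "Cod PC m' = R"
    using m m' by (auto simp: hom_def)
  show ?thesis
    unfolding Comp_nt[OF a(1,2), unfolded a, OF HOL.refl]
    using nt_psh[OF a(1)] nt_psh[OF a(2)] cmp_in[OF a(1)] cmp_in[OF a(2)] cmp_natural[OF a(1)] cmp_natural[OF a(2)]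
    by (intro mk_nt_in) (auto simp: a)
qed

lemma cmp_Comp [simp]:
  assumes "m \<in> hom PC P Q" "m' \<in> hom PC Q R" "c \<in> Obj C" "z \<in> omap P c"
  shows "cmp (Comp PC m' m) c z = cmp m' c (cmp m c z)"
  using assms by (subst Comp_nt) (auto simp: hom_def)

lemma Ident_nt: "P \<in> Psh \<Longrightarrow> Ident PC P = mk_nt C P (\<lambda>c z. z) P"
  by (simp add: functor_cat_def mk_nt_def restrict_def fun_eq_iff)

lemma Ident_nt_hom: "P \<in> Psh \<Longrightarrow> Ident PC P \<in> hom PC P P"
  unfolding Ident_nt by (rule mk_nt_in) auto

lemma category_PC: "category PC"
proof
  show "Ident PC a \<in> Arr PC" "Dom PC (Ident PC a) = a" "Cod PC (Ident PC a) = a" if "a \<in> Obj PC" for a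
    using Ident_nt_hom that by (auto simp: hom_def)
  fix f assume f: "f \<in> Arr PC"
  then have fh: "f \<in> hom PC (Dom PC f) (Cod PC f)" by (simp add: hom_def)
  show "Dom PC f \<in> Obj PC" "Cod PC f \<in> Obj PC" using nt_psh[OF f] by auto
  then have o: "Dom PC f \<in> Psh" "Cod PC f \<in> Psh" by auto
  have h: "Comp PC f (Ident PC (Dom PC f)) \<in> hom PC (Dom PC f) (Cod PC f)"
    "Comp PC (Ident PC (Cod PC f)) f \<in> hom PC (Dom PC f) (Cod PC f)"
    using Comp_nt_hom[OF Ident_nt_hom fh] Comp_nt_hom[OF fh Ident_nt_hom] o by auto
  show "Comp PC f (Ident PC (Dom PC f)) = f"
    by (rule nt_eqI) (use f h o cmp_Comp[OF Ident_nt_hom fh] in \<open>auto simp: hom_def Ident_nt\<close>)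
  show "Comp PC (Ident PC (Cod PC f)) f = f"
    by (rule nt_eqI) (use f h o cmp_Comp[OF fh Ident_nt_hom] cmp_in[OF f] in \<open>auto simp: hom_def Ident_nt\<close>)
  fix g assume g: "g \<in> Arr PC" "Cod PC f = Dom PC g"
  then have gh: "g \<in> hom PC (Cod PC f) (Cod PC g)" by (simp add: hom_def)
  note gf = Comp_nt_hom[OF fh gh]
  then show "Comp PC g f \<in> Arr PC" "Dom PC (Comp PC g f) = Dom PC f" "Cod PC (Comp PC g f) = Cod PC g"
    by (auto simp: hom_def)
  fix h assume h: "h \<in> Arr PC" "Cod PC g = Dom PC h"
  then have hh: "h \<in> hom PC (Cod PC g) (Cod PC h)" by (simp add: hom_def)
  note hg = Comp_nt_hom[OF gh hh]
  note hgf = Comp_nt_hom[OF gf hh] Comp_nt_hom[OF fh hg]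
  show "Comp PC h (Comp PC g f) = Comp PC (Comp PC h g) f"
    by (rule nt_eqI) (use hgf fh gh hh hg gf cmp_in[OF f] in \<open>auto simp: hom_def[of _ "Dom PC f" "Cod PC h"]\<close>)
qed

end

lemma full_subcat_simps [simp]: "Obj (full_subcat C X) = Obj C \<inter> X"
  "Arr (full_subcat C X) = {f \<in> Arr C. Dom C f \<in> X \<and> Cod C f \<in> X}" "Dom (full_subcat C X) = Dom C"
  "Cod (full_subcat C X) = Cod C" "Ident (full_subcat C X) = Ident C" "Comp (full_subcat C X) = Comp C"
  by (simp_all add: full_subcat_def)

lemma hom_full_subcat: "hom (full_subcat C X) a b = (if a \<in> X \<and> b \<in> X then hom C a b else {})"
  by (auto simp: hom_def)

lemma category_full_subcat: "category C \<Longrightarrow> category (full_subcat C X)"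
proof -
  assume "category C"
  then interpret category C .
  show ?thesis by unfold_locales (auto simp: Comp_Ident_right Comp_Ident_left Comp_assoc)
qed

lemma (in presheaves) hom_psh: "m \<in> hom PC P Q \<Longrightarrow> P \<in> Psh" "m \<in> hom PC P Q \<Longrightarrow> Q \<in> Psh"
  using nt_psh[of m] by (auto simp: hom_def)

declare functor_cat_simps [simp del]

locale small_category = category C for C :: "('u, 'u) cat" +
  fixes U :: "'u set set"
  assumes universe: "set_universe U" and Arr_small: "Arr C \<in> U" and U_infinite: "\<exists>B \<in> U. infinite B"

lemma universe_subset: "set_universe U \<Longrightarrow> A \<in> U \<Longrightarrow> B \<subseteq> A \<Longrightarrow> B \<in> U"
  unfolding set_universe_def by (metis image_ident)

text \<open>The universe is only closed under images and subsets, but a member with one point more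
  is the image of the member itself if it is infinite, and of some infinite member
  otherwise.\<close>

lemma universe_insert:
  assumes "set_universe U" "\<exists>B \<in> U. infinite B" "A \<in> U"
  shows "insert z (e ` A) \<in> U"
proof (cases "finite A")
  case True
  obtain B where B: "B \<in> U" "infinite B" using assms(2) by blast
  let ?S = "insert z (e ` A)"
  obtain B' where B': "B' \<subseteq> B" "card B' = card ?S" "finite B'"
    using infinite_arbitrarily_large[OF B(2)] by blast
  obtain g where "bij_betw g B' ?S"
    using finite_same_card_bij[OF B'(3) _ B'(2)] True by auto
  then have "?S \<subseteq> g ` B" using image_mono[OF B'(1), of g] by (simp add: bij_betw_def)
  then show ?thesis using assms(1) B(1) unfolding set_universe_def by blast
next
  case False
  then obtain a where a: "a \<in> A" by fastforce
  obtain h where h: "bij_betw h A (A - {a})" using infinite_imp_bij_betw[OF False] by blast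
  define f where "f y = (if y = a then z else e (inv_into A h y))" for y
  have "f a = z" by (simp add: f_def)
  moreover have "f (h x) = e x" "h x \<in> A" if "x \<in> A" for x
    using h that by (auto simp: f_def bij_betw_def)
  ultimately have "insert z (e ` A) \<subseteq> f ` A" using a by (auto simp: image_iff) metis+
  then show ?thesis using assms(1,3) unfolding set_universe_def by blast
qed

context small_category
begin

sublocale presheaves C U ..

definition yon :: "'u \<Rightarrow> ('u, 'u, 'u) presheaf" where
  "yon c = mk_psh C (\<lambda>d. hom C d c) (\<lambda>f g. Comp C g f)"

lemma yon_psh: "yon c \<in> Psh"
  unfolding yon_def
proof (rule mk_psh_in)
  show "hom C d c \<in> U" for d
    by (rule universe_subset[OF universe Arr_small]) (auto simp: hom_def)
qed (auto simp: hom_def Comp_Ident_right Comp_assoc)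

lemma yon_omap [simp]: "d \<in> Obj C \<Longrightarrow> omap (yon c) d = hom C d c"
  by (simp add: yon_def)

lemma yon_restr [simp]: "f \<in> Arr C \<Longrightarrow> g \<in> hom C (Cod C f) c \<Longrightarrow> restr (yon c) f g = Comp C g f"
  by (simp add: yon_def)

definition yon_map :: "('u, 'u, 'u) presheaf \<Rightarrow> 'u \<Rightarrow> 'u \<Rightarrow> ('u, 'u, 'u set, 'u set_arr) nat_trans" where
  "yon_map X c x = mk_nt C (yon c) (\<lambda>d g. restr X g x) X"

lemma yon_map_hom:
  assumes "X \<in> Psh" "c \<in> Obj C" "x \<in> omap X c"
  shows "yon_map X c x \<in> hom PC (yon c) X"
  unfolding yon_map_def
proof (rule mk_nt_in)
  show "restr X g x \<in> omap X d" if "d \<in> Obj C" "g \<in> omap (yon c) d" for d g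
    using restr_in[of X g x] that assms by (auto simp: hom_def)
  show "restr X (restr (yon c) f g) x = restr X f (restr X g x)" if "f \<in> Arr C" "g \<in> omap (yon c) (Cod C f)" for f g
    using restr_Comp[of X g f x] that assms by (auto simp: hom_def)
qed (use assms yon_psh in auto)

lemma cmp_yon_map [simp]: "d \<in> Obj C \<Longrightarrow> g \<in> hom C d c \<Longrightarrow> cmp (yon_map X c x) d g = restr X g x"
  by (simp add: yon_map_def)

lemma monic_inj:
  assumes n: "n \<in> hom PC N X" and mono: "monic PC n" and c: "c \<in> Obj C"
    and z: "z \<in> omap N c" "z' \<in> omap N c" and eq: "cmp n c z = cmp n c z'"
  shows "z = z'"
proof -
  have N: "N \<in> Psh" and X: "X \<in> Psh" using hom_psh[OF n] by auto
  let ?u = "yon_map N c z" and ?v = "yon_map N c z'"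
  note u = yon_map_hom[OF N c z(1)] and v = yon_map_hom[OF N c z(2)]
  note nu = Comp_nt_hom[OF u n] and nv = Comp_nt_hom[OF v n]
  have nat: "cmp n d (restr N g w) = restr X g (cmp n c w)" if "g \<in> hom C d c" "w \<in> omap N c" for g d w
    using cmp_natural[of n g w] n that by (auto simp: hom_def)
  have "Comp PC n ?u = Comp PC n ?v"
    by (rule nt_eqI)
      (use nu nv nat z eq cmp_Comp[OF u n] cmp_Comp[OF v n] in \<open>auto simp: hom_def[of PC]\<close>)
  then have "?u = ?v" using mono u v n unfolding monic_def hom_def by auto
  then have "cmp ?u c (Ident C c) = cmp ?v c (Ident C c)" by simp
  then show ?thesis using c z N by (simp add: restr_Ident hom_def)
qed

section \<open>Presheaf categories are prime generated\<close>

text \<open>The largest subpresheaf of \<open>X\<close> that misses \<open>x\<close>.\<close>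

definition avoid :: "('u, 'u, 'u) presheaf \<Rightarrow> 'u \<Rightarrow> 'u \<Rightarrow> 'u \<Rightarrow> 'u set" where
  "avoid X c x d = {z \<in> omap X d. \<forall>g \<in> hom C c d. restr X g z \<noteq> x}"

lemma avoid_restr:
  assumes X: "X \<in> Psh" and f: "f \<in> Arr C" and z: "z \<in> avoid X c x (Cod C f)"
  shows "restr X f z \<in> avoid X c x (Dom C f)"
proof -
  have z': "z \<in> omap X (Cod C f)" using z by (simp add: avoid_def)
  have "restr X g (restr X f z) \<noteq> x" if "g \<in> hom C c (Dom C f)" for g
  proof -
    have "restr X g (restr X f z) = restr X (Comp C f g) z"
      using restr_Comp[OF X f _ _ z', of g] that by (simp add: hom_def)
    moreover have "Comp C f g \<in> hom C c (Cod C f)" using that f by (auto simp: hom_def)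
    ultimately show ?thesis using z by (auto simp: avoid_def)
  qed
  then show ?thesis using restr_in[OF X f z'] by (simp add: avoid_def)
qed

text \<open>A monomorphism that is not split misses some \<open>x\<close>. The classifying arrow of
  \<open>x\<close>, out of a representable, serves as \<open>m\<close>; the quotient that collapses
  \<open>avoid X c x\<close> to a point \<open>star\<close> and the constant map \<open>star\<close>
  serve as \<open>p\<close> and \<open>q\<close>. An arrow whose image is not inside \<open>avoid X
  c x\<close> hits an element that restricts to \<open>x\<close>, so it hits
  \<open>x\<close>.\<close>

lemma presheaf_prime_generated:
  assumes X: "X \<in> Psh"
  shows "prime_generated PC X"
  unfolding prime_generated_def
proof (intro ballI impI)
  fix n assume "n \<in> Arr PC" and "Cod PC n = X \<and> monic PC n \<and> \<not> split_epi PC n"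
  then have n: "n \<in> hom PC (Dom PC n) X" and mono: "monic PC n" and ns: "\<not> split_epi PC n"
    by (auto simp: hom_def)
  let ?N = "Dom PC n"
  have N: "?N \<in> Psh" using hom_psh[OF n] by blast
  note inj = monic_inj[OF n mono]
  have nin: "cmp n c z \<in> omap X c" if "c \<in> Obj C" "z \<in> omap ?N c" for c z
    using cmp_in[of n c z] n that by (auto simp: hom_def)
  have nat: "cmp n (Dom C f) (restr ?N f z) = restr X f (cmp n (Cod C f) z)"
    if "f \<in> Arr C" "z \<in> omap ?N (Cod C f)" for f z
    using cmp_natural[of n f z] n that by (auto simp: hom_def)
  have "\<exists>c \<in> Obj C. \<exists>x \<in> omap X c. x \<notin> cmp n c ` omap ?N c"
  proof (rule ccontr)
    assume "\<not> ?thesis"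
    then have sur: "x \<in> cmp n c ` omap ?N c" if "c \<in> Obj C" "x \<in> omap X c" for c x using that by blast
    define h where "h c x = inv_into (omap ?N c) (cmp n c) x" for c x
    have h: "h c x \<in> omap ?N c" "cmp n c (h c x) = x" if "c \<in> Obj C" "x \<in> omap X c" for c x
      using sur[OF that] by (auto simp: h_def inv_into_into f_inv_into_f)
    let ?s = "mk_nt C X h ?N"
    have s: "?s \<in> hom PC X ?N"
    proof (rule mk_nt_in[OF X N])
      show "h c z \<in> omap ?N c" if "c \<in> Obj C" "z \<in> omap X c" for c z using h(1)[OF that] .
      fix f z assume f: "f \<in> Arr C" and z: "z \<in> omap X (Cod C f)"
      note hz = h[OF pre_Cod[OF f] z]
      have 1: "restr ?N f (h (Cod C f) z) \<in> omap ?N (Dom C f)" using restr_in[OF N f] hz f z by simp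
      have 2: "restr X f z \<in> omap X (Dom C f)" using restr_in[OF X f z] .
      show "h (Dom C f) (restr X f z) = restr ?N f (h (Cod C f) z)"
        by (rule inj[OF pre_Dom[OF f] h(1)[OF pre_Dom[OF f] 2] 1])
          (simp add: h(2)[OF pre_Dom[OF f] 2] nat[OF f hz(1)] hz(2))
    qed
    have "Comp PC n ?s = Ident PC X"
      by (rule nt_eqI)
        (use Comp_nt_hom[OF s n] Ident_nt_hom[OF X] cmp_Comp[OF s n] h in \<open>auto simp: hom_def[of PC] Ident_nt[OF X]\<close>)
    then show False using ns s unfolding split_epi_def hom_Cod[OF n] by blast
  qed
  then obtain c x where c: "c \<in> Obj C" and x: "x \<in> omap X c" and xn: "x \<notin> cmp n c ` omap ?N c" by blast
  note m = yon_map_hom[OF X c x]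
  have not_factors: "x \<in> cmp n' c ` omap (Dom PC n') c" if F: "factors PC (yon_map X c x) n'" "n' \<in> Arr PC" "Cod PC n' = X" for n'
  proof -
    obtain r where r: "r \<in> hom PC (yon c) (Dom PC n')" "Comp PC n' r = yon_map X c x"
      using F(1) unfolding factors_def hom_Dom[OF m] by blast
    have n': "n' \<in> hom PC (Dom PC n') X" using that by (simp add: hom_def)
    have "cmp n' c (cmp r c (Ident C c)) = cmp (yon_map X c x) c (Ident C c)"
      unfolding r(2)[symmetric] using r(1) n' c by (intro cmp_Comp[symmetric]) auto
    also have "\<dots> = x" using c x X by (simp add: restr_Ident hom_def)
    finally have "x = cmp n' c (cmp r c (Ident C c))" ..
    moreover have "cmp r c (Ident C c) \<in> omap (Dom PC n') c"
      using cmp_in[of r c "Ident C c"] r(1) c by (auto simp: hom_def)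
    ultimately show ?thesis by blast
  qed
  \<comment> \<open>an injection missing \<open>star\<close> makes room for the collapsed point of the quotient\<close>
  have "infinite (UNIV :: 'u set)" using U_infinite infinite_super[OF subset_UNIV] by auto
  from infinite_imp_bij_betw[OF this, of undefined]
  obtain e :: "'u \<Rightarrow> 'u" and star where e: "bij_betw e UNIV (UNIV - {star})"
    by (elim exE) (rule that)
  then have e_inj: "e y = e y' \<longleftrightarrow> y = y'" and e_star: "e y \<noteq> star" for y y'
    by (auto simp: bij_betw_def inj_eq)
  define A where "A = avoid X c x"
  define \<pi> where "\<pi> d z = (if z \<in> A d then star else e z)" for d z
  define \<rho> where "\<rho> f y = (if y = star then star else \<pi> (Dom C f) (restr X f (inv e y)))" for f y
  have inv_e: "inv e (e y) = y" for y using e by (simp add: bij_betw_def)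
  have \<rho>\<pi>: "\<rho> f (\<pi> (Cod C f) z) = \<pi> (Dom C f) (restr X f z)" if "f \<in> Arr C" "z \<in> omap X (Cod C f)" for f z
    using avoid_restr[OF X that(1), of z c x] by (auto simp: \<rho>_def \<pi>_def e_star inv_e A_def)
  let ?Q = "mk_psh C (\<lambda>d. insert star (\<pi> d ` omap X d)) \<rho>"
  have Q: "?Q \<in> Psh"
  proof (rule mk_psh_in)
    fix d assume d: "d \<in> Obj C"
    have "insert star (e ` omap X d) \<in> U"
      using universe_insert[OF universe U_infinite] psh_omap[OF X d] .
    then show "insert star (\<pi> d ` omap X d) \<in> U"
      by (rule universe_subset[OF universe]) (auto simp: \<pi>_def)
    show "\<rho> (Ident C d) z = z" if "z \<in> insert star (\<pi> d ` omap X d)" for z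
      using that \<rho>\<pi>[of "Ident C d"] d by (auto simp: restr_Ident[OF X d]) (simp add: \<rho>_def)
  next
    fix f z assume f: "f \<in> Arr C" and z: "z \<in> insert star (\<pi> (Cod C f) ` omap X (Cod C f))"
    show "\<rho> f z \<in> insert star (\<pi> (Dom C f) ` omap X (Dom C f))"
      using z \<rho>\<pi>[OF f] restr_in[OF X f] by auto (simp add: \<rho>_def)
    fix g assume g: "g \<in> Arr C" "Cod C g = Dom C f"
    have "\<rho> (Comp C f g) (\<pi> (Cod C f) y) = \<rho> g (\<rho> f (\<pi> (Cod C f) y))" if y: "y \<in> omap X (Cod C f)" for y
      using \<rho>\<pi>[of "Comp C f g" y] \<rho>\<pi>[OF f y] \<rho>\<pi>[OF g(1), of "restr X f y"] restr_in[OF X f y]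
        restr_Comp[OF X f g(1,2) y] f g y by simp
    then show "\<rho> (Comp C f g) z = \<rho> g (\<rho> f z)" using z by auto (simp add: \<rho>_def)
  qed
  let ?p = "mk_nt C X \<pi> ?Q" and ?q = "mk_nt C X (\<lambda>d z. star) ?Q"
  have p: "?p \<in> hom PC X ?Q"
    by (rule mk_nt_in[OF X Q]) (auto simp: \<rho>\<pi>)
  have q: "?q \<in> hom PC X ?Q"
    by (rule mk_nt_in[OF X Q]) (auto simp: \<rho>_def)
  have "x \<notin> A c" using x c restr_Ident[OF X c x] Ident_hom[OF c] by (auto simp: A_def avoid_def)
  then have "cmp ?p c x \<noteq> cmp ?q c x" using c x by (simp add: \<pi>_def e_star)
  then have "?p \<noteq> ?q" by auto
  moreover have "\<not> factors PC (yon_map X c x) n" using not_factors[of n] n xn by (auto simp: hom_def)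
  moreover have "factors PC (yon_map X c x) n' \<or> Comp PC ?p n' = Comp PC ?q n'"
    if n': "n' \<in> Arr PC" "Cod PC n' = X" for n'
  proof (cases "\<forall>d \<in> Obj C. \<forall>y \<in> omap (Dom PC n') d. cmp n' d y \<in> A d")
    case True
    have nh: "n' \<in> hom PC (Dom PC n') X" using n' by (simp add: hom_def)
    have "cmp n' d y \<in> omap X d" if "d \<in> Obj C" "y \<in> omap (Dom PC n') d" for d y
      using cmp_in[OF n'(1) that] n'(2) by simp
    then have "Comp PC ?p n' = Comp PC ?q n'"
      by (intro nt_eqI)
        (use Comp_nt_hom[OF nh p] Comp_nt_hom[OF nh q] cmp_Comp[OF nh p] cmp_Comp[OF nh q] True
          in \<open>auto simp: hom_def[of PC] \<pi>_def\<close>)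
    then show ?thesis ..
  next
    case False
    then obtain d y where d: "d \<in> Obj C" and y: "y \<in> omap (Dom PC n') d" and "cmp n' d y \<notin> A d" by blast
    moreover have ny: "cmp n' d y \<in> omap X d" using cmp_in[OF n'(1) d y] n'(2) by simp
    ultimately obtain g where g: "g \<in> hom C c d" "restr X g (cmp n' d y) = x" by (auto simp: A_def avoid_def)
    have g': "g \<in> Arr C" "Dom C g = c" "Cod C g = d" using g by (auto simp: hom_def)
    have nh: "n' \<in> hom PC (Dom PC n') X" using n' by (auto simp: hom_def)
    note N' = hom_psh(1)[OF nh]
    let ?y = "restr (Dom PC n') g y"
    have ny': "?y \<in> omap (Dom PC n') c" using restr_in[OF N' g'(1)] g' y by auto
    have nx: "cmp n' c ?y = x" using cmp_natural[OF n'(1) g'(1)] g g' y n'(2) by auto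
    note r = yon_map_hom[OF N' c ny']
    have "cmp n' b (restr (Dom PC n') f ?y) = restr X f x" if "f \<in> hom C b c" for f b
      using cmp_natural[OF n'(1), of f ?y] that nx ny' n'(2) by (auto simp: hom_def)
    then have "Comp PC n' (yon_map (Dom PC n') c ?y) = yon_map X c x"
      by (intro nt_eqI) (use Comp_nt_hom[OF r nh] m cmp_Comp[OF r nh] in \<open>auto simp: hom_def[of PC]\<close>)
    then show ?thesis using r unfolding factors_def hom_Dom[OF m] by blast
  qed
  ultimately show "\<exists>P Q. \<exists>m \<in> hom PC P X. \<exists>p \<in> hom PC X Q. \<exists>q \<in> hom PC X Q. p \<noteq> q \<and> \<not> factors PC m n \<and>
      (\<forall>n' \<in> Arr PC. Cod PC n' = X \<longrightarrow> factors PC m n' \<or> Comp PC p n' = Comp PC q n')"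
    using m p q by blast
qed

end

section \<open>The syntactic category and its points\<close>

lemma syn_cat_simps [simp]:
  "Dom (syn_cat T) (a, X, b) = a" "Cod (syn_cat T) (a, X, b) = b" "Obj (syn_cat T) = {(n, \<phi>). wff \<phi> n}"
  "Ident (syn_cat T) (n, \<phi>) = ((n, \<phi>), prov_class T (n + n) (id_form (n, \<phi>)), (n, \<phi>))"
  by (simp_all add: syn_cat_def)

lemma syn_arrE:
  assumes "f \<in> Arr (syn_cat T)"
  obtains n \<phi> m \<psi> \<theta> where "f = ((n, \<phi>), prov_class T (m + n) \<theta>, (m, \<psi>))" "wff \<phi> n" "wff \<psi> m"
    "functional T (n, \<phi>) (m, \<psi>) \<theta>"
  using assms by (auto simp: syn_cat_def)

lemma syn_arrI:
  "wff \<phi> n \<Longrightarrow> wff \<psi> m \<Longrightarrow> functional T (n, \<phi>) (m, \<psi>) \<theta> \<Longrightarrow>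
    ((n, \<phi>), prov_class T (m + n) \<theta>, (m, \<psi>)) \<in> Arr (syn_cat T)"
  by (auto simp: syn_cat_def)

lemma syn_arr_mem:
  assumes "((n, \<phi>), X, (m, \<psi>)) \<in> Arr (syn_cat T)" "\<theta> \<in> X"
  shows "wff \<phi> n" "wff \<psi> m" "functional T (n, \<phi>) (m, \<psi>) \<theta>" "X = prov_class T (m + n) \<theta>"
proof -
  obtain \<theta>0 where X: "X = prov_class T (m + n) \<theta>0" and w: "wff \<phi> n" "wff \<psi> m"
    and F: "functional T (n, \<phi>) (m, \<psi>) \<theta>0"
    using syn_arrE[OF assms(1)] by (metis prod.inject)
  show "wff \<phi> n" "wff \<psi> m" by fact+
  have "prov T (m + n) \<theta>0 \<theta>" "prov T (m + n) \<theta> \<theta>0" using assms(2) X by (auto simp: prov_class_def)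
  then show "functional T (n, \<phi>) (m, \<psi>) \<theta>" "X = prov_class T (m + n) \<theta>"
    using functional_cong[OF F] prov_class_eq X w by blast+
qed

lemma syn_Comp:
  assumes "wff \<theta> (m + n)" "wff \<gamma> (l + m)"
  shows "Comp (syn_cat T) ((m, \<psi>), prov_class T (l + m) \<gamma>, (l, \<chi>)) ((n, \<phi>), prov_class T (m + n) \<theta>, (m, \<psi>)) =
    ((n, \<phi>), prov_class T (l + n) (comp_form m l \<gamma> \<theta>), (l, \<chi>))"
proof -
  have "prov_class T (l + n) (comp_form m l \<gamma>' \<theta>') = prov_class T (l + n) (comp_form m l \<gamma> \<theta>)"
    if "\<theta>' \<in> prov_class T (m + n) \<theta>" "\<gamma>' \<in> prov_class T (l + m) \<gamma>" for \<theta>' \<gamma>'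
    using that by (intro prov_class_eq comp_form_mono) (auto simp: prov_class_def)
  moreover have "\<theta> \<in> prov_class T (m + n) \<theta>" "\<gamma> \<in> prov_class T (l + m) \<gamma>"
    using assms by (auto intro: prov_classI)
  ultimately have "(\<Union>\<theta>' \<in> prov_class T (m + n) \<theta>. \<Union>\<gamma>' \<in> prov_class T (l + m) \<gamma>. prov_class T (l + n) (comp_form m l \<gamma>' \<theta>'))
     = prov_class T (l + n) (comp_form m l \<gamma> \<theta>)" by blast
  then show ?thesis by (simp add: syn_cat_def)
qed

lemma precategory_syn: "precategory (syn_cat T)"
proof
  fix f assume f: "f \<in> Arr (syn_cat T)"
  then obtain n \<phi> m \<psi> \<theta> where f': "f = ((n, \<phi>), prov_class T (m + n) \<theta>, (m, \<psi>))" "wff \<phi> n" "wff \<psi> m"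
    "functional T (n, \<phi>) (m, \<psi>) \<theta>" by (rule syn_arrE)
  then show "Dom (syn_cat T) f \<in> Obj (syn_cat T)" "Cod (syn_cat T) f \<in> Obj (syn_cat T)" by auto
  fix g assume "g \<in> Arr (syn_cat T)" and c: "Cod (syn_cat T) f = Dom (syn_cat T) g"
  then obtain l \<chi> \<gamma> where g': "g = ((m, \<psi>), prov_class T (l + m) \<gamma>, (l, \<chi>))" "wff \<chi> l"
    "functional T (m, \<psi>) (l, \<chi>) \<gamma>" using f' by (auto elim!: syn_arrE)
  note C = syn_Comp[OF functional_wff[OF f'(4)] functional_wff[OF g'(3)], of T \<psi> \<chi> \<phi>]
  show "Comp (syn_cat T) g f \<in> Arr (syn_cat T)"
    "Dom (syn_cat T) (Comp (syn_cat T) g f) = Dom (syn_cat T) f" "Cod (syn_cat T) (Comp (syn_cat T) g f) = Cod (syn_cat T) g"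
    unfolding f'(1) g'(1) C using f' g' by (auto intro!: syn_arrI functional_comp)
next
  fix a :: "'a fobj" assume "a \<in> Obj (syn_cat T)"
  then obtain n \<phi> where a: "a = (n, \<phi>)" "wff \<phi> n" by auto
  have "functional T (n, \<phi>) (n, \<phi>) (graph_form n (\<lambda>k. k) \<phi>)"
    by (rule functional_graph_form) (use a in \<open>auto intro: prov.refl\<close>)
  then show "Ident (syn_cat T) a \<in> Arr (syn_cat T)"
    using a by (simp add: id_form_graph_form syn_arrI)
  show "Dom (syn_cat T) (Ident (syn_cat T) a) = a" "Cod (syn_cat T) (Ident (syn_cat T) a) = a"
    using a by auto
qed

text \<open>The unit interval, as a model of the theory, turns formulas into sets of real points and
  arrows of the syntactic category into functions between them.\<close>

definition pts :: "'i fobj \<Rightarrow> (nat \<Rightarrow> real) set" where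
  "pts c = {v \<in> fcube (fst c). sat (snd c) v}"

definition act :: "'i farr \<Rightarrow> (nat \<Rightarrow> real) \<Rightarrow> nat \<Rightarrow> real" where
  "act f v = (THE w. w \<in> fcube (fst (snd (snd f))) \<and> (\<exists>\<theta> \<in> fst (snd f). sat \<theta> (app (fst (snd (snd f))) w v)))"

lemma app_cube: "w \<in> cube \<Longrightarrow> v \<in> cube \<Longrightarrow> app m w v \<in> cube"
  by (auto simp: cube_def app_def)

lemma app_fcube: "w \<in> fcube m \<Longrightarrow> v \<in> fcube n \<Longrightarrow> app m w v \<in> fcube (m + n)"
  by (auto simp: fcube_def app_cube) (auto simp: app_def)

lemma fcube_eqI: "v \<in> fcube n \<Longrightarrow> w \<in> fcube n \<Longrightarrow> (\<And>k. k < n \<Longrightarrow> v k = w k) \<Longrightarrow> v = w"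
  by (rule ext) (metis (mono_tags, lifting) fcube_def linorder_not_less mem_Collect_eq)

lemma functional_sat:
  assumes F: "functional Loc (n, \<phi>) (m, \<psi>) \<theta>" and w: "wff \<psi> m"
  shows "v \<in> pts (n, \<phi>) \<Longrightarrow> \<exists>w \<in> fcube m. sat \<theta> (app m w v)"
    and "w \<in> fcube m \<Longrightarrow> v \<in> fcube n \<Longrightarrow> sat \<theta> (app m w v) \<Longrightarrow> v \<in> pts (n, \<phi>) \<and> w \<in> pts (m, \<psi>)"
    and "w \<in> fcube m \<Longrightarrow> w' \<in> fcube m \<Longrightarrow> v \<in> fcube n \<Longrightarrow> sat \<theta> (app m w v) \<Longrightarrow> sat \<theta> (app m w' v) \<Longrightarrow> w = w'"
proof -
  show "\<exists>w \<in> fcube m. sat \<theta> (app m w v)" if "v \<in> pts (n, \<phi>)"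
  proof -
    have "prov Loc n \<phi> ((Ex ^^ m) \<theta>)" using F by (simp add: functional_def)
    from soundness[OF this, of v] show ?thesis using that fcube_cube by (auto simp: pts_def sat_Ex_pow)
  qed
  show "v \<in> pts (n, \<phi>) \<and> w \<in> pts (m, \<psi>)" if v: "w \<in> fcube m" "v \<in> fcube n" "sat \<theta> (app m w v)"
  proof -
    have "app m w v \<in> cube" using v by (auto intro!: app_cube intro: fcube_cube)
    then have "sat \<phi> v" "sat \<psi> (app m w v)"
      using soundness[OF functional_src0[OF F] _ v(3)] soundness[OF functional_tgt0[OF F] _ v(3)] by auto
    moreover have "sat \<psi> (app m w v) = sat \<psi> w" using w by (rule sat_cong) simp
    ultimately show ?thesis using v by (simp add: pts_def)
  qed
  show "w = w'" if v: "w \<in> fcube m" "w' \<in> fcube m" "v \<in> fcube n" "sat \<theta> (app m w v)" "sat \<theta> (app m w' v)"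
  proof -
    let ?s = "app m w (app m w' v)"
    have "(\<lambda>k. ?s (if k < m then k else m + k)) = app m w v" by (auto simp: app_def)
    then have 1: "sat (And (ren \<theta> (\<lambda>k. if k < m then k else m + k)) (ren \<theta> (\<lambda>k. m + k))) ?s"
      using v by simp
    have 2: "?s \<in> cube" using v by (auto intro!: app_cube intro: fcube_cube)
    have "prov Loc (m + m + n)
       (And (ren \<theta> (\<lambda>k. if k < m then k else m + k)) (ren \<theta> (\<lambda>k. m + k)))
       (Conj (map (\<lambda>j. Eq (Var j) (Var (m + j))) [0..<m]))"
      using F by (simp add: functional_def)
    from soundness[OF this 2 1] have "w k = w' k" if "k < m" for k using that by simp
    then show ?thesis using v by (intro fcube_eqI)
  qed
qed

lemma act_eq:
  assumes F: "functional Loc (n, \<phi>) (m, \<psi>) \<theta>" and w: "wff \<psi> m" and v: "v \<in> pts (n, \<phi>)"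
  shows "act ((n, \<phi>), prov_class Loc (m + n) \<theta>, (m, \<psi>)) v = w \<longleftrightarrow> w \<in> fcube m \<and> sat \<theta> (app m w v)"
proof -
  have vf: "v \<in> fcube n" using v by (simp add: pts_def)
  have s: "(\<exists>\<theta>' \<in> prov_class Loc (m + n) \<theta>. sat \<theta>' (app m w v)) \<longleftrightarrow> sat \<theta> (app m w v)" if "w \<in> fcube m" for w
  proof -
    have "app m w v \<in> cube" using vf that by (auto intro!: app_cube intro: fcube_cube)
    moreover have "\<theta> \<in> prov_class Loc (m + n) \<theta>" using functional_wff[OF F] by (rule prov_classI)
    ultimately show ?thesis unfolding prov_class_def by (blast dest: soundness)
  qed
  have "\<exists>!w. w \<in> fcube m \<and> (\<exists>\<theta>' \<in> prov_class Loc (m + n) \<theta>. sat \<theta>' (app m w v))"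
    using functional_sat(1)[OF F w v] functional_sat(3)[OF F w _ _ vf] s by blast
  from theI'[OF this] this show ?thesis using s by (auto simp: act_def)
qed

lemma act_pts: "f \<in> Arr (syn_cat Loc) \<Longrightarrow> v \<in> pts (Dom (syn_cat Loc) f) \<Longrightarrow> act f v \<in> pts (Cod (syn_cat Loc) f)"
proof (erule syn_arrE)
  fix n \<phi> m \<psi> \<theta>
  assume f: "f = ((n, \<phi>), prov_class Loc (m + n) \<theta>, (m, \<psi>))" and w: "wff \<psi> m"
    and F: "functional Loc (n, \<phi>) (m, \<psi>) \<theta>" and "v \<in> pts (Dom (syn_cat Loc) f)"
  then have v: "v \<in> pts (n, \<phi>)" by simp
  then show "act f v \<in> pts (Cod (syn_cat Loc) f)"
    using act_eq[OF F w v, of "act f v"] functional_sat(2)[OF F w, of "act f v" v] f by (auto simp: pts_def)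
qed

lemma sat_comp_form:
  assumes "wff \<gamma> (l + m)"
  shows "sat (comp_form m l \<gamma> \<theta>) (app l y v) \<longleftrightarrow> (\<exists>w \<in> fcube m. sat \<theta> (app m w v) \<and> sat \<gamma> (app l y w))"
proof -
  have "sat \<gamma> (\<lambda>k. app m w (app l y v) (if k < l then m + k else k - l)) = sat \<gamma> (app l y w)" for w
    by (rule sat_cong[OF assms]) (rule app_comp2)
  then show ?thesis unfolding comp_form_def by (simp add: sat_Ex_pow app_comp1)
qed

lemma act_Comp:
  assumes f: "f \<in> Arr (syn_cat Loc)" and g: "g \<in> Arr (syn_cat Loc)" and c: "Cod (syn_cat Loc) f = Dom (syn_cat Loc) g"
    and v: "v \<in> pts (Dom (syn_cat Loc) f)"
  shows "act (Comp (syn_cat Loc) g f) v = act g (act f v)"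
proof -
  obtain n \<phi> m \<psi> \<theta> where f': "f = ((n, \<phi>), prov_class Loc (m + n) \<theta>, (m, \<psi>))" "wff \<phi> n" "wff \<psi> m"
    and F: "functional Loc (n, \<phi>) (m, \<psi>) \<theta>" using f by (rule syn_arrE)
  obtain l \<chi> \<gamma> where g': "g = ((m, \<psi>), prov_class Loc (l + m) \<gamma>, (l, \<chi>))" "wff \<chi> l"
    and G: "functional Loc (m, \<psi>) (l, \<chi>) \<gamma>" using g c f' by (auto elim!: syn_arrE)
  note wt = functional_wff[OF F] and wg = functional_wff[OF G]
  have v': "v \<in> pts (n, \<phi>)" using v f' by simp
  have fv: "act f v \<in> pts (m, \<psi>)" using act_pts[OF f v] f' by simp
  have 1: "act f v \<in> fcube m" "sat \<theta> (app m (act f v) v)"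
    using act_eq[OF F f'(3) v', of "act f v"] f'(1) by auto
  have 2: "act g (act f v) \<in> fcube l" "sat \<gamma> (app l (act g (act f v)) (act f v))"
    using act_eq[OF G g'(2) fv, of "act g (act f v)"] g'(1) by auto
  have "sat (comp_form m l \<gamma> \<theta>) (app l (act g (act f v)) v)"
    unfolding sat_comp_form[OF wg] using 1 2 by blast
  then show ?thesis
    unfolding f'(1) g'(1) syn_Comp[OF wt wg] act_eq[OF functional_comp[OF F G g'(2)] g'(2) v']
    using 2 unfolding f'(1) g'(1) by blast
qed

lemma act_graph_form:
  assumes r: "\<And>j. j < n \<Longrightarrow> r j < N" and F: "functional Loc (N, \<chi>) (n, \<phi>) (graph_form n r \<chi>)" and w: "wff \<phi> n"
    and z: "z \<in> pts (N, \<chi>)"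
  shows "act ((N, \<chi>), prov_class Loc (n + N) (graph_form n r \<chi>), (n, \<phi>)) z = (\<lambda>j. if j < n then z (r j) else 0)"
  unfolding act_eq[OF F w z] unfolding graph_form_def using z by (auto simp: pts_def fcube_def cube_def)

lemma act_Ident:
  assumes "c \<in> Obj (syn_cat Loc)" "v \<in> pts c"
  shows "act (Ident (syn_cat Loc) c) v = v"
proof -
  obtain n \<phi> where c: "c = (n, \<phi>)" "wff \<phi> n" using assms(1) by auto
  have F: "functional Loc (n, \<phi>) (n, \<phi>) (graph_form n (\<lambda>k. k) \<phi>)"
    by (rule functional_graph_form) (use c in \<open>auto intro: prov.refl\<close>)
  have "act (Ident (syn_cat Loc) c) v = (\<lambda>j. if j < n then v j else 0)"
    using act_graph_form[OF _ F c(2)] assms(2) c by (simp add: id_form_graph_form)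
  also have "\<dots> = v" using assms(2) c by (auto simp: pts_def fcube_def)
  finally show ?thesis .
qed

text \<open>This is what makes matching families consistent on points. The refinement is the formula
  \<open>\<theta>(w, u) \<and> \<theta>'(w, v)\<close> with the common value \<open>w\<close> kept
  as a variable, so that both composites are the tuple of variables \<open>w\<close> and no
  quantifier is needed.\<close>

lemma common_refinement:
  assumes f: "f \<in> Arr (syn_cat Loc)" and g: "g \<in> Arr (syn_cat Loc)" and c: "Cod (syn_cat Loc) f = Cod (syn_cat Loc) g"
    and u: "u \<in> pts (Dom (syn_cat Loc) f)" and v: "v \<in> pts (Dom (syn_cat Loc) g)" and eq: "act f u = act g v"
  shows "\<exists>h \<in> Arr (syn_cat Loc). \<exists>k \<in> Arr (syn_cat Loc). \<exists>z \<in> pts (Dom (syn_cat Loc) h).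
    Cod (syn_cat Loc) h = Dom (syn_cat Loc) f \<and> Cod (syn_cat Loc) k = Dom (syn_cat Loc) g \<and>
    Dom (syn_cat Loc) k = Dom (syn_cat Loc) h \<and>
    Comp (syn_cat Loc) f h = Comp (syn_cat Loc) g k \<and> act h z = u \<and> act k z = v"
proof -
  obtain n \<phi> m \<psi> \<theta> where f': "f = ((n, \<phi>), prov_class Loc (m + n) \<theta>, (m, \<psi>))" "wff \<phi> n" "wff \<psi> m"
    and F: "functional Loc (n, \<phi>) (m, \<psi>) \<theta>" using f by (rule syn_arrE)
  obtain n' \<phi>' \<theta>' where g': "g = ((n', \<phi>'), prov_class Loc (m + n') \<theta>', (m, \<psi>))" "wff \<phi>' n'"
    and G: "functional Loc (n', \<phi>') (m, \<psi>) \<theta>'" using g c f' by (auto elim!: syn_arrE)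
  note wt = functional_wff[OF F] and wt' = functional_wff[OF G]
  have u': "u \<in> pts (n, \<phi>)" and v': "v \<in> pts (n', \<phi>')" using u v f' g' by auto
  define N where "N = m + n + n'"
  define \<chi> where "\<chi> = And \<theta> (ren \<theta>' (\<lambda>k. if k < m then k else n + k))"
  have w1: "wff \<theta> N" using wff_ren[OF wt, of "\<lambda>k. k" N] by (simp add: N_def)
  have w\<chi>: "wff \<chi> N" using w1 wt' by (auto simp: \<chi>_def N_def intro!: wff_ren)
  have "prov Loc N \<chi> \<chi>" using w\<chi> by (rule prov.refl)
  then have p1: "prov Loc N \<chi> \<theta>" and p2: "prov Loc N \<chi> (ren \<theta>' (\<lambda>k. if k < m then k else n + k))"
    by (simp_all add: \<chi>_def prov_And)
  let ?r = "\<lambda>j. m + j" and ?r' = "\<lambda>j. m + n + j" and ?id = "\<lambda>j. j :: nat"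
  have a1: "app m ?id ?r = ?id" and a2: "app m ?id ?r' = (\<lambda>k. if k < m then k else n + k)"
    by (auto simp: app_def)
  have b: "\<And>j. j < n \<Longrightarrow> ?r j < N" "\<And>j. j < n' \<Longrightarrow> ?r' j < N" "\<And>j. j < m \<Longrightarrow> ?id j < N"
    by (auto simp: N_def)
  have q1: "prov Loc N \<chi> (ren \<theta> (app m ?id ?r))" using p1 by (simp add: a1)
  have q2: "prov Loc N \<chi> (ren \<theta>' (app m ?id ?r'))" using p2 by (simp add: a2)
  have s1: "prov Loc N \<chi> (ren \<phi> ?r)"
    using prov_instance[OF functional_src0[OF F] _ q1] by (auto simp: a1 N_def)
  have "scoped (m + n') N (\<lambda>k. Var (app m ?id ?r' k))" by (auto simp: a2 N_def)
  from prov_instance[OF functional_src0[OF G] this q2]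
  have s2: "prov Loc N \<chi> (ren \<phi>' ?r')" by simp
  have H: "functional Loc (N, \<chi>) (n, \<phi>) (graph_form n ?r \<chi>)"
    by (rule functional_graph_form[OF b(1) s1 f'(2)])
  have K: "functional Loc (N, \<chi>) (n', \<phi>') (graph_form n' ?r' \<chi>)"
    by (rule functional_graph_form[OF b(2) s2 g'(2)])
  let ?h = "((N, \<chi>), prov_class Loc (n + N) (graph_form n ?r \<chi>), (n, \<phi>))"
  let ?k = "((N, \<chi>), prov_class Loc (n' + N) (graph_form n' ?r' \<chi>), (n', \<phi>'))"
  have hk: "?h \<in> Arr (syn_cat Loc)" "?k \<in> Arr (syn_cat Loc)"
    using w\<chi> f' g' H K by (auto intro!: syn_arrI)
  have e1: "prov_class Loc (m + N) (comp_form n m \<theta> (graph_form n ?r \<chi>)) = prov_class Loc (m + N) (graph_form m ?id \<chi>)"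
    using F q1 b(1,3) by (rule comp_graph_form)
  have e2: "prov_class Loc (m + N) (comp_form n' m \<theta>' (graph_form n' ?r' \<chi>)) = prov_class Loc (m + N) (graph_form m ?id \<chi>)"
    using G q2 b(2,3) by (rule comp_graph_form)
  have comp: "Comp (syn_cat Loc) f ?h = Comp (syn_cat Loc) g ?k"
    unfolding f'(1) g'(1) syn_Comp[OF functional_wff[OF H] wt] syn_Comp[OF functional_wff[OF K] wt'] e1 e2 ..
  define w where "w = act f u"
  have wf: "w \<in> fcube m" "sat \<theta> (app m w u)" "sat \<theta>' (app m w v)"
    using act_eq[OF F f'(3) u', of w] act_eq[OF G f'(3) v', of w] f'(1) g'(1) eq by (auto simp: w_def)
  have uv: "u \<in> fcube n" "v \<in> fcube n'" using u' v' by (auto simp: pts_def)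
  define z where "z = app m w (app n u v)"
  have zf: "z \<in> fcube N" using app_fcube[OF wf(1) app_fcube[OF uv]] by (simp add: z_def N_def add.assoc)
  have "sat \<theta> z = sat \<theta> (app m w u)" by (rule sat_cong[OF wt]) (auto simp: z_def app_def)
  moreover have "(\<lambda>k. z (if k < m then k else n + k)) = app m w v"
    unfolding z_def by (rule app_comp1)
  ultimately have z: "z \<in> pts (N, \<chi>)" using wf zf by (simp add: pts_def \<chi>_def)
  have "act ?h z = (\<lambda>j. if j < n then z (?r j) else 0)" by (rule act_graph_form[OF b(1) H f'(2) z])
  also have "\<dots> = u" using uv by (auto simp: z_def app_def fcube_def)
  finally have hz: "act ?h z = u" .
  have "act ?k z = (\<lambda>j. if j < n' then z (?r' j) else 0)" by (rule act_graph_form[OF b(2) K g'(2) z])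
  also have "\<dots> = v" using uv by (auto simp: z_def app_def fcube_def)
  finally have kz: "act ?k z = v" .
  show ?thesis
    by (rule bexI[OF _ hk(1)], rule bexI[OF _ hk(2)], rule bexI[of _ z]) (use comp hz kz z f' g' in auto)
qed

lemma cover_pts:
  assumes p: "prov Loc m \<psi> (Disj I (\<lambda>i. image_form (n i) m (\<theta> i)))"
    and F: "\<And>i. i \<in> I \<Longrightarrow> functional Loc (n i, \<phi> i) (m, \<psi>) (\<theta> i)" and w: "wff \<psi> m" and v: "v \<in> pts (m, \<psi>)"
  shows "\<exists>i \<in> I. \<exists>u \<in> pts (n i, \<phi> i). act ((n i, \<phi> i), prov_class Loc (m + n i) (\<theta> i), (m, \<psi>)) u = v"
proof -
  have vf: "v \<in> fcube m" "sat \<psi> v" using v by (auto simp: pts_def)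
  obtain i where i: "i \<in> I" "sat (image_form (n i) m (\<theta> i)) v"
    using soundness[OF p fcube_cube[OF vf(1)] vf(2)] by auto
  then obtain u where u: "u \<in> fcube (n i)" "sat (swap_form (n i) m (\<theta> i)) (app (n i) u v)"
    unfolding image_form_swap sat_Ex_pow by blast
  have "sat (\<theta> i) (\<lambda>k. app (n i) u v (if k < m then n i + k else k - m)) = sat (\<theta> i) (app m v u)"
    by (rule sat_cong[OF functional_wff[OF F[OF i(1)]]]) (auto simp: app_def)
  then have s: "sat (\<theta> i) (app m v u)" using u(2) by (simp add: swap_form_def)
  then have "u \<in> pts (n i, \<phi> i)" using functional_sat(2)[OF F[OF i(1)] w vf(1) u(1)] by blast
  then show ?thesis using act_eq[OF F[OF i(1)] w, of u v] s i(1) vf(1) by blast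
qed

section \<open>The sheaves of definable functions\<close>

text \<open>The graph is required to be provably total, but single-valued only in the unit interval.
  Totality has to be provable because it produces covers of the syntactic site; asking for provable
  uniqueness as well would give the representable sheaf of the universal algebra, whose gluing is a
  syntactic problem. With uniqueness in the model, functions are glued pointwise.\<close>

definition graph_of :: "'i fobj \<Rightarrow> ((nat \<Rightarrow> real) \<Rightarrow> real) \<Rightarrow> 'i form \<Rightarrow> bool" where
  "graph_of c F \<gamma> \<longleftrightarrow> prov Loc (fst c) (snd c) (Ex \<gamma>) \<and>
     (\<forall>v \<in> pts c. \<forall>x \<in> {0..1}. sat \<gamma> (case_nat x v) \<longrightarrow> x = F v)"

definition dfuns :: "real set \<Rightarrow> 'i fobj \<Rightarrow> ((nat \<Rightarrow> real) \<Rightarrow> real) set" where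
  "dfuns V c = {F \<in> pts c \<rightarrow>\<^sub>E V. \<exists>\<gamma>. graph_of c F \<gamma>}"

definition pull :: "'i farr \<Rightarrow> ((nat \<Rightarrow> real) \<Rightarrow> real) \<Rightarrow> (nat \<Rightarrow> real) \<Rightarrow> real" where
  "pull f F = (\<lambda>v \<in> pts (Dom (syn_cat Loc) f). F (act f v))"

lemma graph_of_wff: "graph_of c F \<gamma> \<Longrightarrow> wff \<gamma> (Suc (fst c))"
  by (auto simp: graph_of_def dest: prov_wff)

lemma graph_of_sat:
  assumes "graph_of c F \<gamma>" "v \<in> pts c"
  shows "F v \<in> {0..1}" "sat \<gamma> (case_nat (F v) v)"
proof -
  have "sat (Ex \<gamma>) v"
    using assms soundness[of "fst c" "snd c" "Ex \<gamma>" v] fcube_cube by (auto simp: graph_of_def pts_def)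
  then obtain x where x: "x \<in> {0..1}" "sat \<gamma> (case_nat x v)" by auto
  moreover have "x = F v" using assms x by (auto simp: graph_of_def)
  ultimately show "F v \<in> {0..1}" "sat \<gamma> (case_nat (F v) v)" by auto
qed

lemma graph_of_unique:
  assumes "graph_of c F \<gamma>" "graph_of c F' \<gamma>" "v \<in> pts c"
  shows "F v = F' v"
  using graph_of_sat[OF assms(1,3)] assms(2,3) by (auto simp: graph_of_def)

lemma dfuns_mono: "V \<subseteq> V' \<Longrightarrow> dfuns V c \<subseteq> dfuns V' c"
  by (auto simp: dfuns_def PiE_iff)

lemma dfuns_eqI:
  assumes "F \<in> dfuns V c" "F' \<in> dfuns V' c" "\<And>v. v \<in> pts c \<Longrightarrow> F v = F' v"
  shows "F = F'"
proof
  fix v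
  have "F \<in> pts c \<rightarrow>\<^sub>E V" "F' \<in> pts c \<rightarrow>\<^sub>E V'" using assms(1,2) by (simp_all add: dfuns_def)
  then show "F v = F' v" using assms(3)[of v] PiE_arb[of F] PiE_arb[of F'] by (cases "v \<in> pts c") metis+
qed

lemma case_nat_app: "case_nat x v = app 1 (\<lambda>k. if k = 0 then x else 0) v"
  by (auto simp: app_def fun_eq_iff split: nat.split)

lemma sat_comp_form1:
  assumes "wff \<gamma> (Suc m)"
  shows "sat (comp_form m 1 \<gamma> \<theta>) (case_nat x v) \<longleftrightarrow> (\<exists>w \<in> fcube m. sat \<theta> (app m w v) \<and> sat \<gamma> (case_nat x w))"
  unfolding case_nat_app[of x] by (rule sat_comp_form) (use assms in simp)

lemma pull_dfuns:
  assumes f: "f \<in> Arr (syn_cat Loc)" and F: "F \<in> dfuns V (Cod (syn_cat Loc) f)"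
  shows "pull f F \<in> dfuns V (Dom (syn_cat Loc) f)"
proof -
  obtain n \<phi> m \<psi> \<theta> where f': "f = ((n, \<phi>), prov_class Loc (m + n) \<theta>, (m, \<psi>))" "wff \<phi> n" "wff \<psi> m"
    and T: "functional Loc (n, \<phi>) (m, \<psi>) \<theta>" using f by (rule syn_arrE)
  obtain \<gamma> where \<gamma>: "graph_of (m, \<psi>) F \<gamma>" and FV: "F \<in> pts (m, \<psi>) \<rightarrow>\<^sub>E V" using F f' by (auto simp: dfuns_def)
  have act: "act f v \<in> pts (m, \<psi>)" if "v \<in> pts (n, \<phi>)" for v using act_pts[OF f, of v] that f' by simp
  have "pull f F \<in> pts (n, \<phi>) \<rightarrow>\<^sub>E V" using FV act f' by (auto simp: pull_def PiE_iff)
  moreover have "graph_of (n, \<phi>) (pull f F) (comp_form m 1 \<gamma> \<theta>)"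
    unfolding graph_of_def
  proof (intro conjI ballI impI)
    have "prov Loc n \<phi> (subst ((Ex ^^ 1) (comp_form m 1 \<gamma> \<theta>)) Var)"
    proof (rule comp_form_total[OF _ functional_tgt0[OF T]])
      show "prov Loc n \<phi> (subst ((Ex ^^ m) \<theta>) Var)" using T by (simp add: functional_def)
      show "prov Loc m \<psi> ((Ex ^^ 1) \<gamma>)" using \<gamma> by (simp add: graph_of_def)
    qed simp
    then show "prov Loc (fst (n, \<phi>)) (snd (n, \<phi>)) (Ex (comp_form m 1 \<gamma> \<theta>))" by simp
    fix v :: "nat \<Rightarrow> real" and x :: real
    assume v: "v \<in> pts (n, \<phi>)" and x: "x \<in> {0..1}" and "sat (comp_form m 1 \<gamma> \<theta>) (case_nat x v)"
    then obtain w where w: "w \<in> fcube m" "sat \<theta> (app m w v)" "sat \<gamma> (case_nat x w)"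
      using sat_comp_form1[of \<gamma> m \<theta> x v] graph_of_wff[OF \<gamma>] by auto
    then have "act f v = w" using act_eq[OF T f'(3) v] f' by simp
    then have "x = F (act f v)" using \<gamma> w x act[OF v] by (auto simp: graph_of_def)
    then show "x = pull f F v" using v f' by (simp add: pull_def)
  qed
  ultimately show ?thesis using f' by (auto simp: dfuns_def)
qed

locale loc_site =
  fixes U :: "'u set set" and j :: "'i form \<Rightarrow> 'u"
  assumes universe: "set_universe U" and inj_j: "inj j" and range_j: "range j \<in> U"
begin

abbreviation S :: "('i fobj, 'i farr) cat" where "S \<equiv> syn_cat Loc"
abbreviation J :: "'i fobj \<Rightarrow> 'i farr set set" where "J \<equiv> syn_top Loc"

sublocale presheaves S U
  using precategory_syn by (simp add: presheaves_def)

text \<open>Definable functions are coded by their defining formulas, since the universe only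
  contains sets that embed in members of it, and need not contain sets of real functions.\<close>

definition enc :: "'i fobj \<Rightarrow> ((nat \<Rightarrow> real) \<Rightarrow> real) \<Rightarrow> 'u" where
  "enc c F = j (SOME \<gamma>. graph_of c F \<gamma>)"

lemma enc_inj: "inj_on (enc c) (dfuns UNIV c)"
proof (rule inj_onI)
  fix F F' assume F: "F \<in> dfuns UNIV c" and F': "F' \<in> dfuns UNIV c" and e: "enc c F = enc c F'"
  have "(SOME \<gamma>. graph_of c F \<gamma>) = (SOME \<gamma>. graph_of c F' \<gamma>)" using e inj_j by (simp add: enc_def inj_eq)
  moreover have "graph_of c F (SOME \<gamma>. graph_of c F \<gamma>)" "graph_of c F' (SOME \<gamma>. graph_of c F' \<gamma>)"
    using F F' by (auto simp: dfuns_def intro: someI_ex)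
  ultimately have "F v = F' v" if "v \<in> pts c" for v using that by (metis graph_of_unique)
  then show "F = F'" using dfuns_eqI[OF F F'] by blast
qed

definition dec :: "'i fobj \<Rightarrow> 'u \<Rightarrow> (nat \<Rightarrow> real) \<Rightarrow> real" where
  "dec c = inv_into (dfuns UNIV c) (enc c)"

lemma dec_enc [simp]: "F \<in> dfuns V c \<Longrightarrow> dec c (enc c F) = F"
  unfolding dec_def using inv_into_f_f[OF enc_inj] dfuns_mono[of V UNIV c] by blast

definition Shf :: "real set \<Rightarrow> ('i fobj, 'i farr, 'u) presheaf" where
  "Shf V = mk_psh S (\<lambda>c. enc c ` dfuns V c) (\<lambda>f z. enc (Dom S f) (pull f (dec (Cod S f) z)))"

lemma Shf_omap [simp]: "c \<in> Obj S \<Longrightarrow> omap (Shf V) c = enc c ` dfuns V c"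
  unfolding Shf_def by (rule mk_psh_simps)

lemma Shf_restr: "f \<in> Arr S \<Longrightarrow> F \<in> dfuns V (Cod S f) \<Longrightarrow> restr (Shf V) f (enc (Cod S f) F) = enc (Dom S f) (pull f F)"
  unfolding Shf_def by simp

lemma Shf_psh: "Shf V \<in> Psh"
  unfolding Shf_def
proof (rule mk_psh_in)
  show "enc c ` dfuns V c \<in> U" for c
    by (rule universe_subset[OF universe range_j]) (auto simp: enc_def)
  show "enc (Dom S f) (pull f (dec (Cod S f) z)) \<in> enc (Dom S f) ` dfuns V (Dom S f)"
    if "f \<in> Arr S" "z \<in> enc (Cod S f) ` dfuns V (Cod S f)" for f z
    using that pull_dfuns[OF that(1)] by auto
  show "enc (Dom S (Ident S c)) (pull (Ident S c) (dec (Cod S (Ident S c)) z)) = z"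
    if c: "c \<in> Obj S" and z: "z \<in> enc c ` dfuns V c" for c z
  proof -
    obtain F where F: "F \<in> dfuns V c" "z = enc c F" using z by blast
    have "pull (Ident S c) F = F"
    proof (rule dfuns_eqI[OF _ F(1)])
      show "pull (Ident S c) F \<in> dfuns V c"
        using pull_dfuns[OF pre_Ident[OF c], of F V] F c by (simp del: syn_cat_simps)
      show "pull (Ident S c) F v = F v" if "v \<in> pts c" for v
        using that act_Ident[OF c that] c by (simp add: pull_def del: syn_cat_simps)
    qed
    then show ?thesis using F c by (simp del: syn_cat_simps)
  qed
  fix f g z assume f: "f \<in> Arr S" and g: "g \<in> Arr S" "Cod S g = Dom S f" and z: "z \<in> enc (Cod S f) ` dfuns V (Cod S f)"
  obtain F where F: "F \<in> dfuns V (Cod S f)" "z = enc (Cod S f) F" using z by blast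
  have "pull (Comp S f g) F = pull g (pull f F)"
    using act_Comp[OF g(1) f g(2)] act_pts[OF g(1)] f g by (intro ext) (simp add: pull_def restrict_def)
  then show "enc (Dom S (Comp S f g)) (pull (Comp S f g) (dec (Cod S (Comp S f g)) z)) =
     enc (Dom S g) (pull g (dec (Cod S g) (enc (Dom S f) (pull f (dec (Cod S f) z)))))"
    using F f g pull_dfuns[OF f F(1)] by simp
qed

lemma syn_topE:
  assumes "R \<in> J (m, \<psi>)"
  obtains I n \<phi> \<theta> where "sieve S (m, \<psi>) R" "prov Loc m \<psi> (Disj I (\<lambda>i. image_form (n i) m (\<theta> i)))"
    "\<And>i. i \<in> I \<Longrightarrow> ((n i, \<phi> i), prov_class Loc (m + n i) (\<theta> i), (m, \<psi>)) \<in> R"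
    "\<And>i. i \<in> I \<Longrightarrow> functional Loc (n i, \<phi> i) (m, \<psi>) (\<theta> i)"
proof -
  obtain I n \<theta> where R: "sieve S (m, \<psi>) R" "prov Loc m \<psi> (Disj I (\<lambda>i. image_form (n i) m (\<theta> i)))"
    and "\<forall>i \<in> I. \<exists>\<phi> X. ((n i, \<phi>), X, (m, \<psi>)) \<in> R \<and> \<theta> i \<in> X"
    using assms by (auto simp: syn_top_def)
  then obtain \<phi> X where X: "\<And>i. i \<in> I \<Longrightarrow> ((n i, \<phi> i), X i, (m, \<psi>)) \<in> R" "\<And>i. i \<in> I \<Longrightarrow> \<theta> i \<in> X i"
    by metis
  have "((n i, \<phi> i), X i, (m, \<psi>)) \<in> Arr S" if "i \<in> I" for i
    using X(1)[OF that] R(1) by (auto simp: sieve_def)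
  note A = syn_arr_mem[OF this X(2)]
  show ?thesis
    by (rule that[OF R]) (use A X in \<open>auto simp: A(4)[symmetric]\<close>)
qed

text \<open>Every point of the covered object lies over a point of some piece, where it takes its
  value; by \<open>common_refinement\<close> the value does not depend on the choice. The glued
  function is definable because the graphs glue (\<open>glue_total\<close>).\<close>

lemma Shf_sheaf: "is_sheaf S J (Shf V)"
  unfolding is_sheaf_def
proof (intro ballI allI impI)
  fix c R s assume c: "c \<in> Obj S" and R: "R \<in> J c" and match: "matching S (Shf V) R s"
  obtain m \<psi> where c': "c = (m, \<psi>)" "wff \<psi> m" using c by auto
  obtain I n \<theta> \<phi> where sv: "sieve S (m, \<psi>) R" and cov: "prov Loc m \<psi> (Disj I (\<lambda>i. image_form (n i) m (\<theta> i)))"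
    and inR: "\<And>i. i \<in> I \<Longrightarrow> ((n i, \<phi> i), prov_class Loc (m + n i) (\<theta> i), (m, \<psi>)) \<in> R"
    and fn: "\<And>i. i \<in> I \<Longrightarrow> functional Loc (n i, \<phi> i) (m, \<psi>) (\<theta> i)"
    using R unfolding c'(1) by (elim syn_topE) (rule that)
  note sv = sv[folded c'(1)] and inR = inR[folded c'(1)]
  have RA: "f \<in> Arr S" "Cod S f = c" if "f \<in> R" for f using sv that by (auto simp: sieve_def)
  define G where "G f = dec (Dom S f) (s f)" for f
  have G: "G f \<in> dfuns V (Dom S f)" "s f = enc (Dom S f) (G f)" if f: "f \<in> R" for f
  proof -
    have "s f \<in> omap (Shf V) (Dom S f)" using match f by (auto simp: matching_def)
    then show "G f \<in> dfuns V (Dom S f)" "s f = enc (Dom S f) (G f)"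
      unfolding Shf_omap[OF pre_Dom[OF RA(1)[OF f]]] by (auto simp: G_def)
  qed
  have G_comp: "G (Comp S f g) = pull g (G f)" if f: "f \<in> R" and g: "g \<in> Arr S" "Cod S g = Dom S f" for f g
  proof -
    have fg: "Comp S f g \<in> R" using sv f g by (auto simp: sieve_def)
    have "s (Comp S f g) = restr (Shf V) g (s f)" using match f g by (auto simp: matching_def)
    then have "enc (Dom S g) (G (Comp S f g)) = enc (Dom S g) (pull g (G f))"
      using G(2)[OF fg] G[OF f] Shf_restr[OF g(1), of "G f" V] g RA[OF f] by simp
    moreover have "G (Comp S f g) \<in> dfuns V (Dom S g)" using G(1)[OF fg] g RA[OF f] by simp
    moreover have "pull g (G f) \<in> dfuns V (Dom S g)" using pull_dfuns[OF g(1)] G(1)[OF f] g by simp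
    ultimately show ?thesis by (metis dec_enc)
  qed
  have agree: "G f u = G g v"
    if f: "f \<in> R" and g: "g \<in> R" and u: "u \<in> pts (Dom S f)" and v: "v \<in> pts (Dom S g)" and e: "act f u = act g v" for f g u v
  proof -
    obtain h k z where hk: "h \<in> Arr S" "k \<in> Arr S" "z \<in> pts (Dom S h)" "Cod S h = Dom S f" "Cod S k = Dom S g"
      "Dom S k = Dom S h" "Comp S f h = Comp S g k" "act h z = u" "act k z = v"
      using common_refinement[OF RA(1)[OF f] RA(1)[OF g] _ u v e] RA f g by auto
    have "G f u = pull h (G f) z" using hk by (simp add: pull_def)
    also have "\<dots> = pull k (G g) z" using G_comp[OF f hk(1,4)] G_comp[OF g hk(2,5)] hk(7) by simp
    also have "\<dots> = G g v" using hk by (simp add: pull_def)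
    finally show ?thesis .
  qed
  have surj: "\<exists>f \<in> R. \<exists>u \<in> pts (Dom S f). act f u = v" if v: "v \<in> pts c" for v
  proof -
    obtain i u where "i \<in> I" "u \<in> pts (n i, \<phi> i)" "act ((n i, \<phi> i), prov_class Loc (m + n i) (\<theta> i), c) u = v"
      using cover_pts[OF cov fn c'(2), of v] v unfolding c'(1) by blast
    then show ?thesis using inR[of i] by (intro bexI[of _ "((n i, \<phi> i), prov_class Loc (m + n i) (\<theta> i), c)"]) auto
  qed
  define H where "H = (\<lambda>v \<in> pts c. THE x. \<exists>f \<in> R. \<exists>u \<in> pts (Dom S f). act f u = v \<and> x = G f u)"
  have H: "H (act f u) = G f u" if f: "f \<in> R" and u: "u \<in> pts (Dom S f)" for f u
  proof -
    have "act f u \<in> pts c" using act_pts[OF RA(1)[OF f] u] RA(2)[OF f] by simp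
    moreover have "(THE x. \<exists>f' \<in> R. \<exists>u' \<in> pts (Dom S f'). act f' u' = act f u \<and> x = G f' u') = G f u"
    proof (rule the_equality)
      show "\<exists>f' \<in> R. \<exists>u' \<in> pts (Dom S f'). act f' u' = act f u \<and> G f u = G f' u'" using f u by blast
      fix x assume "\<exists>f' \<in> R. \<exists>u' \<in> pts (Dom S f'). act f' u' = act f u \<and> x = G f' u'"
      then obtain f' u' where "f' \<in> R" "u' \<in> pts (Dom S f')" "act f' u' = act f u" "x = G f' u'" by blast
      then show "x = G f u" using agree[OF _ f _ u] by simp
    qed
    ultimately show ?thesis unfolding H_def by simp
  qed
  obtain \<gamma> where \<gamma>: "\<And>i. i \<in> I \<Longrightarrow> graph_of (n i, \<phi> i) (G ((n i, \<phi> i), prov_class Loc (m + n i) (\<theta> i), c)) (\<gamma> i)"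
    using G(1)[OF inR] unfolding dfuns_def syn_cat_simps mem_Collect_eq by metis
  let ?\<gamma> = "\<lambda>i. comp_form (n i) 1 (\<gamma> i) (swap_form (n i) m (\<theta> i))"
  have "graph_of c H (Disj I ?\<gamma>)"
    unfolding graph_of_def c'(1) fst_conv snd_conv
  proof (intro conjI ballI impI)
    show "prov Loc m \<psi> (Ex (Disj I ?\<gamma>))"
      by (rule glue_total[OF cov fn]) (use \<gamma> in \<open>auto simp: graph_of_def\<close>)
    fix v :: "nat \<Rightarrow> real" and x :: real
    assume v: "v \<in> pts (m, \<psi>)" and x: "x \<in> {0..1}" and "sat (Disj I ?\<gamma>) (case_nat x v)"
    then obtain i where i: "i \<in> I" and "sat (?\<gamma> i) (case_nat x v)" by auto
    then obtain u where u: "u \<in> fcube (n i)" "sat (swap_form (n i) m (\<theta> i)) (app (n i) u v)" "sat (\<gamma> i) (case_nat x u)"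
      using sat_comp_form1[of "\<gamma> i" "n i" "swap_form (n i) m (\<theta> i)" x v] graph_of_wff[OF \<gamma>[OF i]] by auto
    have vf: "v \<in> fcube m" using v by (simp add: pts_def)
    have "sat (\<theta> i) (\<lambda>k. app (n i) u v (if k < m then n i + k else k - m)) = sat (\<theta> i) (app m v u)"
      by (rule sat_cong[OF functional_wff[OF fn[OF i]]]) (auto simp: app_def)
    then have s: "sat (\<theta> i) (app m v u)" using u(2) by (simp add: swap_form_def)
    then have up: "u \<in> pts (n i, \<phi> i)" using functional_sat(2)[OF fn[OF i] c'(2) vf u(1)] by blast
    then have "act ((n i, \<phi> i), prov_class Loc (m + n i) (\<theta> i), c) u = v"
      using act_eq[OF fn[OF i] c'(2), of u v] s vf c'(1) by blast
    then have "H v = G ((n i, \<phi> i), prov_class Loc (m + n i) (\<theta> i), c) u"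
      using H[OF inR[OF i], of u] up by simp
    then show "x = H v" using \<gamma>[OF i] up u(3) x by (auto simp: graph_of_def)
  qed
  moreover have "H \<in> pts c \<rightarrow>\<^sub>E V"
  proof (rule PiE_I)
    show "H v \<in> V" if "v \<in> pts c" for v
      using surj[OF that] H G(1) by (force simp: dfuns_def PiE_iff)
  qed (simp add: H_def)
  ultimately have Hd: "H \<in> dfuns V c" by (auto simp: dfuns_def)
  show "\<exists>!x. x \<in> omap (Shf V) c \<and> (\<forall>f \<in> R. restr (Shf V) f x = s f)"
  proof (rule ex1I[of _ "enc c H"])
    have "restr (Shf V) f (enc c H) = s f" if f: "f \<in> R" for f
    proof -
      have "pull f H = G f"
        using H[OF f] G(1)[OF f] by (auto simp: pull_def dfuns_def PiE_iff extensional_def fun_eq_iff)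
      then show ?thesis using Shf_restr[OF RA(1)[OF f], of H V] Hd G(2)[OF f] RA(2)[OF f] by simp
    qed
    then show "enc c H \<in> omap (Shf V) c \<and> (\<forall>f \<in> R. restr (Shf V) f (enc c H) = s f)"
      using Hd c by (simp del: syn_cat_simps)
    fix y assume y: "y \<in> omap (Shf V) c \<and> (\<forall>f \<in> R. restr (Shf V) f y = s f)"
    then obtain H' where H': "H' \<in> dfuns V c" "y = enc c H'" using c by (auto simp del: syn_cat_simps)
    have "pull f H' = G f" if f: "f \<in> R" for f
    proof -
      have "enc (Dom S f) (pull f H') = enc (Dom S f) (G f)"
        using Shf_restr[OF RA(1)[OF f], of H' V] H' y f G(2)[OF f] RA(2)[OF f] by simp
      then show ?thesis using pull_dfuns[OF RA(1)[OF f], of H' V] G(1)[OF f] H' RA(2)[OF f] by (metis dec_enc)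
    qed
    then have "H' v = H v" if "v \<in> pts c" for v
      using surj[OF that] H by (metis pull_def restrict_apply')
    then have "H' = H" using dfuns_eqI[OF H'(1) Hd] by blast
    then show "y = enc c H" using H' by simp
  qed
qed

end

section \<open>The classifying topos is not prime generated\<close>

lemma tsubst_multiple [simp]: "tsubst (multiple k t) \<sigma> = multiple k (tsubst t \<sigma>)"
  by (induction k t rule: multiple.induct) auto

lemma tvars_multiple: "tvars (multiple k t) \<subseteq> tvars t"
  by (induction k t rule: multiple.induct) auto

lemma subst_Or: "subst (Or \<phi> \<psi>) \<sigma> = Or (subst \<phi> \<sigma>) (subst \<psi> \<sigma>)"
  by (simp add: Or_def fun_eq_iff)

text \<open>The disjuncts of the locality axiom at the term \<open>t\<close>, both alternatives
  enumerated by one natural number: \<open>2 k\<close> stands for \<open>k t = 1\<close> and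
  \<open>2 k + 1\<close> for \<open>k (\<not> t) = 1\<close>.\<close>

definition branch :: "mvterm \<Rightarrow> nat \<Rightarrow> 'i form" where
  "branch t i = Eq (multiple (i div 2) (if even i then t else Neg t)) One"

definition level :: "mvterm \<Rightarrow> nat \<Rightarrow> real set" where
  "level t i = {x \<in> {0..1}. tval (multiple (i div 2) (if even i then t else Neg t)) (\<lambda>_. x) = 1}"

lemma wff_branch: "tvars t \<subseteq> {..<n} \<Longrightarrow> wff (branch t i) n"
  using tvars_multiple[of "i div 2" t] tvars_multiple[of "i div 2" "Neg t"] by (auto simp: branch_def)

lemma prov_branches:
  assumes t: "tvars t \<subseteq> {..<n}" and w: "wff \<Gamma> n"
  shows "prov Loc n \<Gamma> (Disj (range Inl) (\<lambda>i. branch t (projl i)) :: 'i form)"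
proof -
  let ?f = "\<lambda>i :: nat + 'i. Or (Eq (multiple (projl i) (Var 0)) One) (Eq (multiple (projl i) (Neg (Var 0))) One) :: 'i form"
  let ?g = "\<lambda>i :: nat + 'i. Or (Eq (multiple (projl i) t) One) (Eq (multiple (projl i) (Neg t)) One) :: 'i form"
  let ?B = "Disj (range Inl) (\<lambda>i. branch t (projl i)) :: 'i form"
  have wb: "wff (branch t i :: 'i form) n" for i using t by (rule wff_branch)
  then have wB: "wff ?B n" by simp
  have "prov Loc 1 Top (Disj (Inl ` {1..}) ?f)"
  proof (rule prov.axm)
    show "(1, Top, Disj (Inl ` {1..}) ?f) \<in> Loc" by (simp add: Loc_def)
    show "wff (Disj (Inl ` {1..}) ?f) 1"
      using tvars_multiple[of _ "Var 0"] tvars_multiple[of _ "Neg (Var 0)"] by (fastforce simp: Or_def)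
  qed simp
  from prov_subst[OF this, of n "\<lambda>_. t"] have "prov Loc n Top (Disj (Inl ` {1..}) ?g)"
    using t by (simp add: scoped_def subst_Or)
  then have 1: "prov Loc n \<Gamma> (Disj (Inl ` {1..}) ?g)" using w by (blast intro: prov.cut prov.top)
  have b: "prov Loc n \<Gamma>' ?B" if "prov Loc n \<Gamma>' (branch t i)" for \<Gamma>' i
    by (rule disjI[where i = "Inl i"]) (use that wb in auto)
  show ?thesis
  proof (rule disjE[OF 1 wB])
    fix i :: "nat + 'i" and \<Gamma>' :: "'i form"
    let ?k = "projl i"
    assume "prov Loc n \<Gamma>' (?g i)"
    then show "prov Loc n \<Gamma>' ?B"
      unfolding Or_def
    proof (rule disjE[OF _ wB])
      fix l :: "nat + 'i" and \<Gamma>'' :: "'i form"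
      assume "l \<in> {Inl 0, Inl 1}"
        and 2: "prov Loc n \<Gamma>'' (if l = Inl 0 then Eq (multiple ?k t) One else Eq (multiple ?k (Neg t)) One)"
      then consider "l = Inl 0" | "l = Inl 1" by blast
      then show "prov Loc n \<Gamma>'' ?B"
      proof cases
        case 1
        then show ?thesis using 2 b[of \<Gamma>'' "2 * ?k"] by (simp add: branch_def)
      next
        case 2
        then show ?thesis using \<open>prov Loc n \<Gamma>'' _\<close> b[of \<Gamma>'' "2 * ?k + 1"] by (simp add: branch_def)
      qed
    qed
  qed
qed

context loc_site
begin

lemma sheaf_unique:
  assumes Q: "Q \<in> Psh" "is_sheaf S J Q" and c: "c \<in> Obj S" and xy: "x \<in> omap Q c" "y \<in> omap Q c"
    and R: "{f \<in> Arr S. Cod S f = c \<and> restr Q f x = restr Q f y} \<in> J c" (is "?R \<in> _")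
  shows "x = y"
proof -
  have "matching S Q ?R (\<lambda>f. restr Q f x)"
    unfolding matching_def
  proof (intro ballI conjI impI)
    fix f assume f: "f \<in> ?R"
    then show "restr Q f x \<in> omap Q (Dom S f)" using restr_in[OF Q(1)] xy by auto
    show "restr Q (Comp S f g) x = restr Q g (restr Q f x)" if "g \<in> Arr S" "Cod S g = Dom S f" for g
      using restr_Comp[OF Q(1)] f that xy by auto
  qed
  then have "\<exists>!z. z \<in> omap Q c \<and> (\<forall>f \<in> ?R. restr Q f z = restr Q f x)"
    using Q(2) c R unfolding is_sheaf_def by blast
  moreover have "\<forall>f \<in> ?R. restr Q f y = restr Q f x" by auto
  ultimately show ?thesis using xy by blast
qed

lemma agree_sieve:
  assumes Q: "Q \<in> Psh" and xy: "x \<in> omap Q c" "y \<in> omap Q c"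
  shows "sieve S c {f \<in> Arr S. Cod S f = c \<and> restr Q f x = restr Q f y}"
  unfolding sieve_def using restr_Comp[OF Q] xy by auto

text \<open>The level sets of a term cover the sheaf of all definable functions: the locality axiom,
  applied to the value of a definable function, splits its domain into pieces on which the function
  takes values in a single level set.\<close>

lemma agree_on_levels:
  assumes t: "tvars t \<subseteq> {0}" and Q: "Q \<in> Psh" "is_sheaf S J Q"
    and p: "p \<in> hom PC (Shf {0..1}) Q" and q: "q \<in> hom PC (Shf {0..1}) Q"
    and eq: "\<And>i c z. c \<in> Obj S \<Longrightarrow> z \<in> omap (Shf (level t i)) c \<Longrightarrow> cmp p c z = cmp q c z"
  shows "p = q"
proof (rule nt_eqI)
  show "p \<in> Arr PC" "q \<in> Arr PC" "Dom PC p = Dom PC q" "Cod PC p = Cod PC q"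
    using p q by (auto simp: hom_def)
  fix c z assume c: "c \<in> Obj S" and "z \<in> omap (Dom PC p) c"
  then have "z \<in> omap (Shf {0..1}) c" using p by (simp add: hom_def)
  then obtain F where F: "F \<in> dfuns {0..1} c" "z = enc c F" unfolding Shf_omap[OF c] by blast
  obtain n \<phi> where c': "c = (n, \<phi>)" "wff \<phi> n" using c by auto
  obtain \<gamma> where \<gamma>: "graph_of c F \<gamma>" using F by (auto simp: dfuns_def)
  have z: "z \<in> omap (Shf {0..1}) c" by fact
  have pz: "cmp m c z \<in> omap Q c" if "m \<in> hom PC (Shf {0..1}) Q" for m
    using cmp_in[of m c z] that c z by (auto simp: hom_def simp del: syn_cat_simps)
  have nat: "restr Q f (cmp m c z) = cmp m (Dom S f) (enc (Dom S f) (pull f F))"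
    if "m \<in> hom PC (Shf {0..1}) Q" "f \<in> Arr S" "Cod S f = c" for m f
    using cmp_natural[of m f z] that Shf_restr[of f F "{0..1}"] F z by (auto simp: hom_def)
  let ?R = "{f \<in> Arr S. Cod S f = c \<and> restr Q f (cmp p c z) = restr Q f (cmp q c z)}"
  let ?\<alpha> = "\<lambda>i :: nat + 'i. branch t (projl i) :: 'i form"
  let ?G = "And (ren \<phi> Suc) \<gamma>"
  let ?\<delta> = "\<lambda>i. And ?G (?\<alpha> i)"
  have p1: "prov Loc n \<phi> (Ex \<gamma>)" using \<gamma> c' by (simp add: graph_of_def)
  have wG: "wff ?G (Suc n)" using prov_wff[OF p1] by (auto intro: wff_ren)
  have p2: "prov Loc (Suc n) ?G (Disj (range Inl) ?\<alpha>)"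
    by (rule prov_branches[OF _ wG]) (use t in auto)
  note cover = split_cover[OF p1 p2]
  let ?f = "\<lambda>i. ((Suc n, ?\<delta> i), prov_class Loc (n + Suc n) (graph_form n Suc (?\<delta> i)), c)"
  have fR: "?f i \<in> ?R" if i: "i \<in> range Inl" for i
  proof -
    note fn = cover(2)[OF i] and wd = cover(3)[OF i]
    have fA: "?f i \<in> Arr S" unfolding c'(1) using wd c'(2) fn by (rule syn_arrI)
    have pF: "pull (?f i) F \<in> dfuns {0..1} (Suc n, ?\<delta> i)"
      using pull_dfuns[OF fA, of F "{0..1}"] F by simp
    have "pull (?f i) F v \<in> level t (projl i)" if v: "v \<in> pts (Suc n, ?\<delta> i)" for v
    proof -
      have vf: "v \<in> fcube (Suc n)" and sv: "sat \<phi> (\<lambda>k. v (Suc k))" "sat \<gamma> v" "sat (?\<alpha> i) v"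
        using v by (auto simp: pts_def)
      have a: "act (?f i) v = (\<lambda>k. v (Suc k))"
        using act_graph_form[OF _ fn c'(2) v] vf unfolding c'(1) by (auto simp: fcube_def)
      have "(\<lambda>k. v (Suc k)) \<in> pts c" using vf sv c' by (auto simp: pts_def fcube_def cube_def)
      moreover have "case_nat (v 0) (\<lambda>k. v (Suc k)) = v" by (auto split: nat.split)
      moreover have x: "v 0 \<in> {0..1}" using vf by (auto simp: fcube_def cube_def)
      ultimately have "v 0 = F (\<lambda>k. v (Suc k))" using \<gamma> sv(2) unfolding graph_of_def by metis
      then have 1: "pull (?f i) F v = v 0" using v a by (simp add: pull_def)
      let ?s = "multiple (projl i div 2) (if even (projl i) then t else Neg t)"
      have "tvars ?s \<subseteq> {..<1}" using t tvars_multiple[of "projl i div 2" t] tvars_multiple[of "projl i div 2" "Neg t"] by auto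
      then have "tval ?s v = tval ?s (\<lambda>_. v 0)" by (rule tval_cong) simp
      then show ?thesis using sv(3) x 1 by (simp add: branch_def level_def)
    qed
    then have "pull (?f i) F \<in> dfuns (level t (projl i)) (Suc n, ?\<delta> i)"
      using pF by (auto simp: dfuns_def PiE_iff)
    then have "enc (Suc n, ?\<delta> i) (pull (?f i) F) \<in> omap (Shf (level t (projl i))) (Suc n, ?\<delta> i)"
      using wd by simp
    then have "cmp p (Suc n, ?\<delta> i) (enc (Suc n, ?\<delta> i) (pull (?f i) F)) = cmp q (Suc n, ?\<delta> i) (enc (Suc n, ?\<delta> i) (pull (?f i) F))"
      using wd by (intro eq) auto
    then show ?thesis using fA nat[OF p fA] nat[OF q fA] by simp
  qed
  have "\<exists>\<phi>' X. ((Suc n, \<phi>'), X, c) \<in> ?R \<and> graph_form n Suc (?\<delta> i) \<in> X" if i: "i \<in> range Inl" for i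
  proof (intro exI conjI)
    show "?f i \<in> ?R" using i by (rule fR)
    show "graph_form n Suc (?\<delta> i) \<in> prov_class Loc (n + Suc n) (graph_form n Suc (?\<delta> i))"
      using functional_wff[OF cover(2)[OF i]] by (rule prov_classI)
  qed
  then have "\<exists>I n' \<theta>. (\<forall>i \<in> I. \<exists>\<phi>' X. ((n' i, \<phi>'), X, c) \<in> ?R \<and> \<theta> i \<in> X) \<and>
      prov Loc n \<phi> (Disj I (\<lambda>i. image_form (n' i) n (\<theta> i)))"
    using cover(1) by (intro exI[of _ "range Inl"] exI[of _ "\<lambda>_. Suc n"] exI[of _ "\<lambda>i. graph_form n Suc (?\<delta> i)"]) blast
  then have "?R \<in> J c"
    using agree_sieve[OF Q(1) pz[OF p] pz[OF q]] unfolding syn_top_def c'(1) case_prod_conv mem_Collect_eq by blast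
  then show "cmp p c z = cmp q c z" by (rule sheaf_unique[OF Q c pz[OF p] pz[OF q]])
qed

definition incl :: "real set \<Rightarrow> ('i fobj, 'i farr, 'u set, 'u set_arr) nat_trans" where
  "incl V = mk_nt S (Shf V) (\<lambda>c z. z) (Shf {0..1})"

lemma Shf_restr_mono:
  assumes "V \<subseteq> W" and f: "f \<in> Arr S" and z: "z \<in> omap (Shf V) (Cod S f)"
  shows "restr (Shf V) f z = restr (Shf W) f z"
proof -
  obtain F where F: "F \<in> dfuns V (Cod S f)" "z = enc (Cod S f) F"
    using z unfolding Shf_omap[OF pre_Cod[OF f]] by blast
  have "F \<in> dfuns W (Cod S f)" using F(1) dfuns_mono[OF assms(1)] by blast
  then show ?thesis using Shf_restr[OF f F(1)] Shf_restr[OF f, of F W] F(2) by simp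
qed

lemma incl_hom:
  assumes "V \<subseteq> {0..1}"
  shows "incl V \<in> hom PC (Shf V) (Shf {0..1})"
  unfolding incl_def
proof (rule mk_nt_in[OF Shf_psh Shf_psh])
  show "z \<in> omap (Shf {0..1}) c" if "c \<in> Obj S" "z \<in> omap (Shf V) c" for c z
    using that dfuns_mono[OF assms, of c] unfolding Shf_omap[OF that(1)] by auto
qed (rule Shf_restr_mono[OF assms])

lemma cmp_incl [simp]: "c \<in> Obj S \<Longrightarrow> z \<in> omap (Shf V) c \<Longrightarrow> cmp (incl V) c z = z"
  unfolding incl_def by (rule cmp_mk_nt)

lemma factors_incl:
  assumes m: "m \<in> hom PC P (Shf {0..1})" and V: "V \<subseteq> {0..1}"
  shows "factors PC m (incl V) \<longleftrightarrow> (\<forall>c \<in> Obj S. \<forall>b \<in> omap P c. cmp m c b \<in> omap (Shf V) c)"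
proof
  note i = incl_hom[OF V]
  {
    assume "factors PC m (incl V)"
    then obtain r where r: "r \<in> hom PC P (Shf V)" "Comp PC (incl V) r = m"
      unfolding factors_def hom_Dom[OF m] hom_Dom[OF i] by blast
    show "\<forall>c \<in> Obj S. \<forall>b \<in> omap P c. cmp m c b \<in> omap (Shf V) c"
    proof (intro ballI)
      fix c b assume c: "c \<in> Obj S" and b: "b \<in> omap P c"
      have rb: "cmp r c b \<in> omap (Shf V) c" using cmp_in[of r c b] r(1) c b by (simp add: hom_def)
      have "cmp m c b = cmp r c b"
        using cmp_Comp[OF r(1) i c b] cmp_incl[OF c rb] r(2) by simp
      then show "cmp m c b \<in> omap (Shf V) c" using rb by simp
    qed
  next
    assume all: "\<forall>c \<in> Obj S. \<forall>b \<in> omap P c. cmp m c b \<in> omap (Shf V) c"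
    let ?r = "mk_nt S P (cmp m) (Shf V)"
    have r: "?r \<in> hom PC P (Shf V)"
    proof (rule mk_nt_in[OF hom_psh(1)[OF m] Shf_psh])
      show "cmp m c z \<in> omap (Shf V) c" if "c \<in> Obj S" "z \<in> omap P c" for c z using all that by blast
      fix f z assume f: "f \<in> Arr S" and z: "z \<in> omap P (Cod S f)"
      then have v: "cmp m (Cod S f) z \<in> omap (Shf V) (Cod S f)" using all pre_Cod[OF f] by blast
      have "cmp m (Dom S f) (restr P f z) = restr (Shf {0..1}) f (cmp m (Cod S f) z)"
        using cmp_natural[of m f z] m f z by (simp add: hom_def)
      also have "\<dots> = restr (Shf V) f (cmp m (Cod S f) z)"
        using Shf_restr_mono[OF V f v] by simp
      finally show "cmp m (Dom S f) (restr P f z) = restr (Shf V) f (cmp m (Cod S f) z)" .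
    qed
    have "Comp PC (incl V) ?r = m"
    proof (rule nt_eqI)
      show "Comp PC (incl V) ?r \<in> Arr PC" "m \<in> Arr PC" "Dom PC (Comp PC (incl V) ?r) = Dom PC m"
        "Cod PC (Comp PC (incl V) ?r) = Cod PC m"
        using Comp_nt_hom[OF r i] m by (auto simp: hom_def)
      fix c z assume c: "c \<in> Obj S" and "z \<in> omap (Dom PC (Comp PC (incl V) ?r)) c"
      then have z: "z \<in> omap P c" using Comp_nt_hom[OF r i] by (simp add: hom_def)
      show "cmp (Comp PC (incl V) ?r) c z = cmp m c z"
        unfolding cmp_Comp[OF r i c z] cmp_mk_nt[OF c z] using all c z by (intro cmp_incl) auto
    qed
    then show "factors PC m (incl V)" unfolding factors_def hom_Dom[OF m] hom_Dom[OF i] using r by blast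
  }
qed

abbreviation topos :: "(('i fobj, 'i farr, 'u) presheaf, ('i fobj, 'i farr, 'u set, 'u set_arr) nat_trans) cat" where
  "topos \<equiv> classifying_topos U Loc"

lemma topos_eq: "topos = full_subcat PC {P. is_sheaf S J P}"
  by (simp add: classifying_topos_def sheaf_cat_def)

lemma topos_category: "category topos"
  unfolding topos_eq using category_PC by (rule category_full_subcat)

lemma topos_hom: "m \<in> hom topos P Q \<longleftrightarrow> m \<in> hom PC P Q \<and> is_sheaf S J P \<and> is_sheaf S J Q"
  by (auto simp: topos_eq hom_full_subcat)

lemma topos_simps [simp]: "Comp topos = Comp PC" "Dom topos = Dom PC" "Cod topos = Cod PC" "Ident topos = Ident PC"
  by (simp_all add: topos_eq)

lemma topos_factors:
  assumes "m \<in> hom topos P X" "n \<in> hom topos N X"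
  shows "factors topos m n \<longleftrightarrow> factors PC m n"
  using assms topos_hom unfolding factors_def by (auto simp: hom_Dom[of _ PC])

lemma incl_topos: "V \<subseteq> {0..1} \<Longrightarrow> incl V \<in> hom topos (Shf V) (Shf {0..1})"
  by (simp add: topos_hom incl_hom Shf_sheaf)

lemma incl_monic:
  assumes V: "V \<subseteq> {0..1}" shows "monic topos (incl V)"
  unfolding monic_def
proof (intro ballI impI)
  note i = incl_hom[OF V]
  fix u v assume "u \<in> Arr topos" "v \<in> Arr topos" and "Dom topos u = Dom topos v \<and> Cod topos u = Dom topos (incl V) \<and>
    Cod topos v = Dom topos (incl V) \<and> Comp topos (incl V) u = Comp topos (incl V) v"
  then have u: "u \<in> hom PC (Dom PC u) (Shf V)" and v: "v \<in> hom PC (Dom PC u) (Shf V)"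
    and e: "Comp PC (incl V) u = Comp PC (incl V) v"
    using hom_Dom[OF i] by (auto simp: topos_eq hom_def)
  show "u = v"
  proof (rule nt_eqI)
    show "u \<in> Arr PC" "v \<in> Arr PC" "Dom PC u = Dom PC v" "Cod PC u = Cod PC v" using u v by (auto simp: hom_def)
    fix c z assume c: "c \<in> Obj S" and z: "z \<in> omap (Dom PC u) c"
    have "cmp w c z \<in> omap (Shf V) c" if "w \<in> hom PC (Dom PC u) (Shf V)" for w
      using cmp_in[of w c z] that c z by (simp add: hom_def)
    then show "cmp u c z = cmp v c z"
      using cmp_Comp[OF u i c z] cmp_Comp[OF v i c z] e cmp_incl[OF c] u v by metis
  qed
qed

lemma coordinate_dfun:
  defines "c \<equiv> (1, Top) :: 'i fobj"
  shows "(\<lambda>v \<in> pts c. v 0) \<in> dfuns {0..1} c"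
proof -
  have "(\<lambda>v \<in> pts c. v 0) \<in> pts c \<rightarrow>\<^sub>E {0..1}" by (auto simp: c_def pts_def fcube_def cube_def)
  moreover have "graph_of c (\<lambda>v \<in> pts c. v 0) (Eq (Var 0) (Var 1))"
  proof -
    have "prov Loc 1 Top (subst ((Ex ^^ 1) (Eq (Var 0) (Var 1))) Var)"
      by (rule exI_block[where w = "\<lambda>_. Var 0" and n = 1]) (auto simp: app_def intro: prov_eq_refl)
    then show ?thesis by (simp add: graph_of_def c_def)
  qed
  ultimately show ?thesis by (auto simp: dfuns_def)
qed

text \<open>Let \<open>a\<close> be irrational. The functions avoiding \<open>a\<close> form a
  proper subobject, so prime generation gives an arrow \<open>m\<close> into \<open>Shf
  {0..1}\<close> that takes the value \<open>a\<close> somewhere and factors through one of the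
  level sets of each term. Separating terms show that \<open>a\<close> is its only value, whereas
  perturbing the point where it is taken gives a value \<open>a + \<epsilon>\<close>.\<close>

lemma not_prime_generated: "\<not> prime_generated topos (Shf {0..1})"
proof
  assume pg: "prime_generated topos (Shf {0..1})"
  obtain a :: real where a: "0 < a" "a < 1" "a \<notin> \<rat>" using irrational_ex by blast
  obtain L :: "real \<Rightarrow> real" where L: "\<And>x y. L (x + y) = L x + L y" "L 1 = 0" "L a = 1"
    using additive_ex[OF a(3)] by blast
  let ?W = "{0..1} :: real set" and ?V = "{0..1} - {a}"
  have V: "?V \<subseteq> ?W" by blast
  note i = incl_hom[OF V] and i' = incl_topos[OF V]
  have "\<not> split_epi topos (incl ?V)"
  proof
    assume "split_epi topos (incl ?V)"
    then obtain s where "s \<in> hom topos (Shf ?W) (Shf ?V)" "Comp PC (incl ?V) s = Ident PC (Shf ?W)"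
      unfolding split_epi_def hom_Cod[OF i'] hom_Dom[OF i'] by auto
    then have s: "s \<in> hom PC (Shf ?W) (Shf ?V)" "Comp PC (incl ?V) s = mk_nt S (Shf ?W) (\<lambda>c z. z) (Shf ?W)"
      by (auto simp: topos_hom Ident_nt[OF Shf_psh])
    let ?c = "(1, Top) :: 'i fobj" and ?F = "\<lambda>v \<in> pts (1, Top :: 'i form). v 0 :: real"
    let ?z = "enc ?c ?F"
    have c: "?c \<in> Obj S" by simp
    have z: "?z \<in> omap (Shf ?W) ?c" unfolding Shf_omap[OF c] using coordinate_dfun by blast
    have sz: "cmp s ?c ?z \<in> omap (Shf ?V) ?c" using cmp_in[OF hom_Arr[OF s(1)] c] z s(1) by (simp add: hom_def)
    have "cmp s ?c ?z = ?z"
      using cmp_Comp[OF s(1) i c z] cmp_incl[OF c sz] cmp_mk_nt[OF c z] s(2) by metis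
    then obtain F where F: "F \<in> dfuns ?V ?c" "enc ?c ?F = enc ?c F" using sz unfolding Shf_omap[OF c] by auto
    then have "?F = F" using dec_enc[OF F(1)] dec_enc[OF coordinate_dfun] by metis
    then have "?F v \<noteq> a" if "v \<in> pts ?c" for v using F(1) that by (auto simp: dfuns_def PiE_iff)
    moreover have "(\<lambda>k. if k = 0 then a else 0) \<in> pts ?c" using a by (auto simp: pts_def fcube_def cube_def)
    ultimately show False by fastforce
  qed
  then obtain P Q m p q where m': "m \<in> hom topos P (Shf ?W)" and p': "p \<in> hom topos (Shf ?W) Q"
    and q': "q \<in> hom topos (Shf ?W) Q" and pq: "p \<noteq> q" and nf: "\<not> factors topos m (incl ?V)"
    and all: "\<And>n'. n' \<in> Arr topos \<Longrightarrow> Cod topos n' = Shf ?W \<Longrightarrow> factors topos m n' \<or> Comp topos p n' = Comp topos q n'"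
    using pg incl_monic[OF V] hom_Arr[OF i'] hom_Cod[OF i'] unfolding prime_generated_def by metis
  have m: "m \<in> hom PC P (Shf ?W)" and p: "p \<in> hom PC (Shf ?W) Q" and q: "q \<in> hom PC (Shf ?W) Q" and sh: "is_sheaf S J Q"
    using m' p' q' by (auto simp: topos_hom)
  define val where "val c b = dec c (cmp m c b)" for c b
  have val: "val c b \<in> dfuns ?W c" "cmp m c b = enc c (val c b)" if c: "c \<in> Obj S" and b: "b \<in> omap P c" for c b
  proof -
    have "cmp m c b \<in> omap (Shf ?W) c" using cmp_in[OF hom_Arr[OF m] c] b m by (simp add: hom_def)
    then show "val c b \<in> dfuns ?W c" "cmp m c b = enc c (val c b)"
      unfolding Shf_omap[OF c] by (auto simp: val_def)
  qed
  have fac: "factors topos m (incl X) \<longleftrightarrow> (\<forall>c \<in> Obj S. \<forall>b \<in> omap P c. \<forall>v \<in> pts c. val c b v \<in> X)"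
    if X: "X \<subseteq> ?W" for X
  proof -
    have "cmp m c b \<in> omap (Shf X) c \<longleftrightarrow> (\<forall>v \<in> pts c. val c b v \<in> X)" if c: "c \<in> Obj S" and b: "b \<in> omap P c" for c b
    proof -
      have "cmp m c b \<in> omap (Shf X) c \<longleftrightarrow> val c b \<in> dfuns X c"
      proof
        assume "cmp m c b \<in> omap (Shf X) c"
        then obtain F where F: "F \<in> dfuns X c" "enc c (val c b) = enc c F"
          unfolding Shf_omap[OF c] val(2)[OF c b] by blast
        have "val c b = dec c (enc c (val c b))" using dec_enc[OF val(1)[OF c b]] by simp
        also have "\<dots> = F" unfolding F(2) by (rule dec_enc[OF F(1)])
        finally show "val c b \<in> dfuns X c" using F(1) by simp
      qed (simp add: Shf_omap[OF c] val(2)[OF c b] del: syn_cat_simps)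
      then show ?thesis using val(1)[OF c b] by (auto simp: dfuns_def PiE_iff)
    qed
    then show ?thesis unfolding topos_factors[OF m' incl_topos[OF X]] factors_incl[OF m X] by blast
  qed
  \<comment> \<open>some level set of a term separating \<open>a\<close> from another value contains all values of \<open>m\<close>; it either
    misses \<open>a\<close>, which would make \<open>m\<close> factor through the given subobject, or misses the other value\<close>
  have only: "val c b v = a" if c: "c \<in> Obj S" and b: "b \<in> omap P c" and v: "v \<in> pts c" for c b v
  proof (rule ccontr)
    let ?a = "val c b v"
    assume ne: "?a \<noteq> a"
    have "?a \<in> ?W" using val(1)[OF c b] v by (auto simp: dfuns_def)
    then obtain t where t: "tvars t \<subseteq> {0}" "\<And>v. v 0 = a \<Longrightarrow> tval t v = 0" "\<And>v. v 0 = ?a \<Longrightarrow> tval t v = 1"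
      using separating_term[of a ?a] a ne by auto
    have lW: "level t k \<subseteq> ?W" for k by (auto simp: level_def)
    have "\<exists>k. factors topos m (incl (level t k))"
    proof (rule ccontr)
      assume none: "\<not> ?thesis"
      have "cmp p c z = cmp q c z" if c: "c \<in> Obj S" and z: "z \<in> omap (Shf (level t k)) c" for k c z
      proof -
        note ik = incl_hom[OF lW[of k]]
        have "Comp PC p (incl (level t k)) = Comp PC q (incl (level t k))"
          using all[of "incl (level t k)"] incl_topos[OF lW[of k]] none by (auto simp: hom_def)
        then show ?thesis
          using cmp_Comp[OF ik p c z] cmp_Comp[OF ik q c z] cmp_incl[OF c z] by metis
      qed
      then show False using agree_on_levels[OF t(1) hom_psh(2)[OF p] sh p q] pq by blast
    qed
    then obtain k where k: "\<And>c b v. c \<in> Obj S \<Longrightarrow> b \<in> omap P c \<Longrightarrow> v \<in> pts c \<Longrightarrow> val c b v \<in> level t k"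
      using fac[OF lW] by blast
    have cube: "(\<lambda>_. x) \<in> cube" if "x \<in> ?W" for x using that by (simp add: cube_def)
    show False
    proof (cases "even k")
      case True
      have "a \<notin> level t k" using True t(2)[of "\<lambda>_. a"] cube[of a] a by (auto simp: level_def tval_multiple)
      then have "level t k \<subseteq> ?V" using lW[of k] by blast
      then have "\<forall>c \<in> Obj S. \<forall>b \<in> omap P c. \<forall>v \<in> pts c. val c b v \<in> ?V"
        using k by (intro ballI) (rule subsetD)
      then show False using fac[OF V] nf by blast
    next
      case False
      then have "?a \<notin> level t k" using t(3)[of "\<lambda>_. ?a"] cube[of ?a] by (auto simp: level_def tval_multiple)
      then show False using k[OF c b v] by blast
    qed
  qed
  obtain c b v where c: "c \<in> Obj S" and b: "b \<in> omap P c" and v: "v \<in> pts c" and va: "val c b v = a"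
    using nf only unfolding fac[OF V] by blast
  obtain \<gamma> where \<gamma>: "graph_of c (val c b) \<gamma>" using val(1)[OF c b] by (auto simp: dfuns_def)
  have vf: "v \<in> fcube (fst c)" and sv: "sat (snd c) v" using v by (auto simp: pts_def)
  have s: "sat \<gamma> (case_nat a v)" using graph_of_sat(2)[OF \<gamma> v] va by simp
  have wf: "case_nat a v \<in> fcube (Suc (fst c))"
    using vf a by (auto simp: fcube_def cube_def split: nat.split)
  note ev = eventually_conj[OF eventually_conj[OF perturb_sat[OF L(1,2) wf s] perturb_fcube[OF L(1,2) wf]]
      eventually_conj[OF eventually_conj[OF perturb_sat[OF L(1,2) vf sv] perturb_fcube[OF L(1,2) vf]]
        eventually_at_right_less[of "0::real"]]]
  obtain \<epsilon> where \<epsilon>: "\<epsilon> > 0" "sat \<gamma> (perturb L \<epsilon> (case_nat a v))" "perturb L \<epsilon> (case_nat a v) \<in> fcube (Suc (fst c))"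
    "sat (snd c) (perturb L \<epsilon> v)" "perturb L \<epsilon> v \<in> fcube (fst c)"
    using eventually_happens[OF ev] by auto
  let ?v = "perturb L \<epsilon> v"
  have eq: "perturb L \<epsilon> (case_nat a v) = case_nat (a + \<epsilon>) ?v"
    using L(3) by (auto simp: perturb_def split: nat.split)
  have v': "?v \<in> pts c" using \<epsilon> by (simp add: pts_def)
  have "case_nat (a + \<epsilon>) ?v 0 \<in> ?W" using \<epsilon>(3) unfolding eq fcube_def cube_def by (auto simp del: nat.case)
  then have "a + \<epsilon> = val c b ?v" using \<gamma> v' \<epsilon>(2) unfolding eq graph_of_def by simp
  then show False using only[OF c b v'] \<epsilon>(1) by simp
qed

end

theorem mainTheorem1:
  fixes U :: "'u set set"
  assumes "set_universe U"
    and "small U (UNIV :: 'i form set)"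
  shows "\<not> presheaf_type U (Loc :: 'i gtheory)"
proof
  assume "presheaf_type U (Loc :: 'i gtheory)"
  then obtain C :: "('u, 'u) cat" where C: "category C" "Obj C \<in> U" "Arr C \<in> U"
    and eq: "equivalent_cats (classifying_topos U (Loc :: 'i gtheory)) (presheaf_cat U C)"
    unfolding presheaf_type_def by blast
  obtain A and j :: "'i form \<Rightarrow> 'u" where A: "A \<in> U" and j: "inj j" "range j \<subseteq> A"
    using assms(2) unfolding small_def by blast
  have rj: "range j \<in> U" using universe_subset[OF assms(1) A j(2)] .
  have "inj (\<lambda>k. j (Eq (Var k) Zero))" using j(1) by (auto simp: inj_def)
  then have "infinite (range (\<lambda>k. j (Eq (Var k) Zero)))" by (simp add: finite_image_iff)
  then have "infinite (range j)" by (rule infinite_super[rotated]) auto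
  then interpret C: small_category C U
    using C assms(1) rj by (auto simp: small_category_def small_category_axioms_def)
  interpret loc_site U j using assms(1) j(1) rj by unfold_locales
  obtain G where "ff_equivalence (presheaf_cat U C) topos G"
    using equivalence_ff[OF C.category_PC topos_category eq] by blast
  then interpret ff_equivalence "presheaf_cat U C" topos G .
  have "Shf {0..1} \<in> Obj topos" using Shf_psh Shf_sheaf by (simp add: topos_eq functor_cat_simps)
  moreover have "prime_generated (presheaf_cat U C) Y" if "Y \<in> Obj (presheaf_cat U C)" for Y
    using that C.presheaf_prime_generated by (simp add: functor_cat_simps)
  ultimately have "prime_generated topos (Shf {0..1})"
    by (rule prime_generated_transport[rotated])
  then show False using not_prime_generated by blast
qed

end
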